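(* Let $h$ be a positive integer. Let $\tau_1,\ldots,\tau_h\in(0,1)$ and $a_1,\ldots,a_h\in(0,\infty)$ satisfy $\sum_{i=1}^h\tau_i=1$ and $\prod_{i=1}^h a_i=1$. Then there exists a multiplicative complement $(A_1,\ldots,A_h)$ of order $h$ such that $$\lim_{x\to\infty}A_i(x)\frac{(\log x)^{1-\tau_i}}{x}=\frac{a_i}{\Gamma(\tau_i)}$$ for all $1\le i\le h$.
   Context: $\mathbb{Z}^+$ denotes the set of positive integers, $\log$ the natural logarithm, and $\Gamma$ the Euler gamma function. For $A\subseteq\mathbb{Z}^+$, the counting function is $A(x)=|\{a\in A:a\le x\}|$. An $h$-tuple $(A_1,\ldots,A_h)$ of subsets of $\mathbb{Z}^+$ is a multiplicative complement of order $h$ if every positive integer can be written in the form $a_1\cdots a_h$ with $a_i\in A_i$ for all $1\le i\le h$. *)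

theory Defs
  imports "HOL-Analysis.Gamma_Function"
begin

definition counting_fun :: "nat set \<Rightarrow> real \<Rightarrow> nat" where
  "counting_fun A x = card {a \<in> A. real a \<le> x}"

text \<open>A tuple of sets is a function on indices, of which only the values at \<open>1, \<dots>, h\<close> matter.\<close>

definition mult_complement :: "nat \<Rightarrow> (nat \<Rightarrow> nat set) \<Rightarrow> bool" where
  "mult_complement h A \<longleftrightarrow>
     (\<forall>i\<in>{1..h}. A i \<subseteq> {0<..}) \<and>
     (\<forall>n>0. \<exists>b. (\<forall>i\<in>{1..h}. b i \<in> A i) \<and> n = (\<Prod>i=1..h. b i))"

end

theory Submission
  imports
    Defs
    "HOL-Analysis.Analysis"
    "HOL-Number_Theory.Prime_Powers"
    "HOL-Computational_Algebra.Squarefree"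
    "HOL-Real_Asymp.Real_Asymp"
begin

text \<open>
  The primes are split into classes \<open>P\<^sub>1, \<dots>, P\<^sub>h\<close> of relative densities \<open>\<tau>\<^sub>1, \<dots>, \<tau>\<^sub>h\<close>, and \<open>A\<^sub>i\<close> is the
  set of integers all of whose prime factors lie in \<open>P\<^sub>i\<close>; unique factorisation makes \<open>(A\<^sub>1, \<dots>, A\<^sub>h)\<close>
  a multiplicative complement. A greedy choice of the classes ensures that
  \<open>(s - 1) powr \<tau>\<^sub>i * (\<Sum>n\<in>A\<^sub>i. n powr -s)\<close> tends to \<open>a\<^sub>i\<close> as \<open>s\<close> decreases to 1, so that Karamata's
  Tauberian theorem gives \<open>S(x) = (\<Sum>n\<in>A\<^sub>i, n \<le> x. 1/n) \<sim> a\<^sub>i / \<Gamma>(\<tau>\<^sub>i + 1) * (ln x) powr \<tau>\<^sub>i\<close>.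

  The passage from \<open>S\<close> to the counting function does not need the prime number theorem. With \<open>f\<close> the
  indicator function of \<open>A\<^sub>i\<close>, convolving Selberg's symmetry formula with \<open>f\<close> shows that the error
  \<open>R(x) = (\<Sum>m\<le>x. f m * psi (x / m)) - x * S(x)\<close> satisfies
  \<open>\<bar>R(x)\<bar> * ln x \<le> (1 - \<tau>\<^sub>i) * (\<Sum>n\<le>x. \<Lambda>(n) * \<bar>R(x / n)\<bar>) + o(x * S(x) * ln x)\<close>. Since \<open>1 - \<tau>\<^sub>i < 1\<close>, this
  is a contraction for the upper limit of \<open>\<bar>R(x)\<bar> / (x * S(x))\<close>, which therefore vanishes.
\<close>

section \<open>Sums over the positive integers up to a real bound\<close>

text \<open>Relative densities fix the order of growth of the counting functions but not the
  constants: each constant comes from the limit of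
  \<open>\<Sum>n\<le>N. (indicator P n - \<tau>) * prime_weight 1 n\<close>, which must be exactly
  \<open>ln a\<close>. Hence the greedy choice; the product condition on the constants makes the
  targets add up to 0, as these sums do over a partition. The Dirichlet series on the real axis
  right of 1 controls only the logarithmic sum S. To return to the counting function, the classes
  must also be regular on the scale x: the prime powers of a class must carry the share \<tau> of
  psi(x) up to o(x). Comparing with psi instead of x is what keeps the prime number theorem out. The
  factor 1 - \<tau> arises because Selberg's formula contributes the average of
  \<open>mangoldt n * R (x / n)\<close> with coefficient 1, while the convolution identity for
  \<open>f n * ln n\<close> gives back the share \<tau> of it. Errors of size O(x) are harmless
  throughout, since S is unbounded.\<close>

definition nats_le :: "real \<Rightarrow> nat set" where
  "nats_le x = {n. 0 < n \<and> real n \<le> x}"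

lemma nats_le_altdef: "nats_le x = {1..nat \<lfloor>x\<rfloor>}"
  by (auto simp: nats_le_def le_nat_iff le_floor_iff not_le intro: Suc_leI) linarith+

lemma finite_nats_le [simp]: "finite (nats_le x)"
  by (simp add: nats_le_altdef)

lemma nats_le_empty: "x < 1 \<Longrightarrow> nats_le x = {}"
  by (auto simp: nats_le_def)

lemma card_nats_le: "0 \<le> x \<Longrightarrow> real (card (nats_le x)) \<le> x"
  by (simp add: nats_le_altdef)

lemma nats_le_mono: "x \<le> y \<Longrightarrow> nats_le x \<subseteq> nats_le y"
  by (auto simp: nats_le_def)

lemma nats_le_divide:
  assumes "m \<in> nats_le x"
  shows "nats_le (x / real m) = {n \<in> nats_le x. real (m * n) \<le> x}"
proof -
  have m: "m > 0" using assms by (simp add: nats_le_def)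
  have "real n \<le> x" if "real m * real n \<le> x" for n
  proof -
    have "real n \<le> real m * real n" using m by (cases m) (auto simp: algebra_simps)
    thus ?thesis using that by linarith
  qed
  thus ?thesis using m by (auto simp: nats_le_def field_simps)
qed

lemma sum_nats_le_swap:
  "(\<Sum>m\<in>nats_le x. \<Sum>n\<in>nats_le (x / real m). t m n) =
   (\<Sum>n\<in>nats_le x. \<Sum>m\<in>nats_le (x / real n). t m n)"
proof -
  have "(\<Sum>m\<in>nats_le x. \<Sum>n\<in>nats_le (x / real m). t m n) =
        (\<Sum>m\<in>nats_le x. \<Sum>n | n \<in> nats_le x \<and> real (m * n) \<le> x. t m n)"
    by (intro sum.cong refl) (auto simp: nats_le_divide)
  also have "\<dots> = (\<Sum>n\<in>nats_le x. \<Sum>m | m \<in> nats_le x \<and> real (m * n) \<le> x. t m n)"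
    by (rule sum.swap_restrict) auto
  also have "\<dots> = (\<Sum>n\<in>nats_le x. \<Sum>m\<in>nats_le (x / real n). t m n)"
    by (intro sum.cong refl) (auto simp: nats_le_divide mult.commute)
  finally show ?thesis .
qed

text \<open>Grouping the pairs under the hyperbola by their product turns a nested sum into the
  summatory function of a Dirichlet convolution. Together with the swap above, this is how every
  convolution identity enters.\<close>

lemma sum_nats_le_divisors:
  "(\<Sum>m\<in>nats_le x. \<Sum>n\<in>nats_le (x / real m). t m n) =
   (\<Sum>k\<in>nats_le x. \<Sum>d | d dvd k. t d (k div d))"
proof -
  have "(\<Sum>m\<in>nats_le x. \<Sum>n\<in>nats_le (x / real m). t m n) =
        (\<Sum>(m,n)\<in>(SIGMA m:nats_le x. nats_le (x / real m)). t m n)"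
    by (rule sum.Sigma) auto
  also have "\<dots> = (\<Sum>(k,d)\<in>(SIGMA k:nats_le x. {d. d dvd k}). t d (k div d))"
  proof (rule sum.reindex_bij_witness[where i = "\<lambda>(k,d). (d, k div d)" and j = "\<lambda>(m,n). (m * n, m)"],
         goal_cases)
    case (2 a)
    thus ?case
      by (auto simp: nats_le_divide) (auto simp: nats_le_def)
  next
    case (4 b)
    then obtain k d where b: "b = (k, d)" "0 < k" "real k \<le> x" "d dvd k"
      by (auto simp: nats_le_def)
    then obtain e where e: "k = d * e" by (elim dvdE)
    with b have "d > 0" "e > 0" by auto
    hence "d \<le> k" "e \<le> k" using e by auto
    hence "real d \<le> x" "real e \<le> x" using b(3) by linarith+
    hence d: "d \<in> nats_le x" using \<open>d > 0\<close> by (simp add: nats_le_def)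
    show ?case using b e \<open>d > 0\<close> \<open>e > 0\<close> \<open>real e \<le> x\<close> d
      by (simp add: nats_le_divide[OF d]) (simp add: nats_le_def)
  qed (auto simp: nats_le_def)
  also have "\<dots> = (\<Sum>k\<in>nats_le x. \<Sum>d | d dvd k. t d (k div d))"
    by (rule sum.Sigma [symmetric], simp, rule ballI, rule finite_divisors_nat) (auto simp: nats_le_def)
  finally show ?thesis .
qed

section \<open>Chebyshev, Mertens and Selberg estimates\<close>

lemma sum_nats_le_ln_bounds:
  assumes "n > 0"
  shows "real n * ln n - n + 1 \<le> (\<Sum>k=1..n. ln (real k))"
    and "(\<Sum>k=1..n. ln (real k)) \<le> real n * ln n - n + 1 + ln n"
proof -
  have "real n * ln n - n + 1 \<le> (\<Sum>k=1..n. ln (real k)) \<and>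
        (\<Sum>k=1..n. ln (real k)) \<le> real n * ln n - n + 1 + ln n"
    using assms
  proof (induction n rule: nat_induct_non_zero)
    case (Suc n)
    have n: "real n > 0" using Suc by simp
    have "ln (real (Suc n) / real n) \<le> real (Suc n) / real n - 1"
      using n by (intro ln_le_minus_one) auto
    hence 1: "real n * (ln (real (Suc n)) - ln (real n)) \<le> 1"
      using n by (simp add: ln_div field_simps)
    have "ln (real n / real (Suc n)) \<le> real n / real (Suc n) - 1"
      using n by (intro ln_le_minus_one) auto
    hence 2: "real (Suc n) * (ln (real (Suc n)) - ln (real n)) \<ge> 1"
      using n by (simp add: ln_div field_simps)
    show ?case using Suc.IH 1 2 by (simp add: algebra_simps)
  qed simp
  thus "real n * ln n - n + 1 \<le> (\<Sum>k=1..n. ln (real k))"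
       "(\<Sum>k=1..n. ln (real k)) \<le> real n * ln n - n + 1 + ln n" by blast+
qed

lemma nat_floor_bounds:
  fixes x :: real
  assumes "x \<ge> 1"
  defines "n \<equiv> nat \<lfloor>x\<rfloor>"
  shows "n > 0" "real n \<le> x" "x < real n + 1"
  using assms unfolding n_def by linarith+

lemma sum_nats_le_ln:
  assumes "x \<ge> 1"
  shows "\<bar>(\<Sum>k\<in>nats_le x. ln (real k)) - (x * ln x - x)\<bar> \<le> 1 + ln x"
proof -
  define n where "n = nat \<lfloor>x\<rfloor>"
  have n: "n > 0" "real n \<le> x" "x < real n + 1"
    using nat_floor_bounds[OF assms] by (auto simp: n_def)
  have T: "(\<Sum>k\<in>nats_le x. ln (real k)) = (\<Sum>k=1..n. ln (real k))"
    by (simp add: nats_le_altdef n_def)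
  have "ln (x / real n) \<le> x / real n - 1" using n by (intro ln_le_minus_one) auto
  hence 1: "real n * ln x \<le> real n * ln n + x - n"
    using n assms by (simp add: ln_div field_simps)
  have "ln (real n / x) \<le> real n / x - 1" using n assms by (intro ln_le_minus_one) auto
  hence 2: "x * ln n \<le> x * ln x + n - x"
    using n assms by (simp add: ln_div field_simps)
  have 3: "(x - n) * ln x \<le> 1 * ln x" using n assms by (intro mult_right_mono) auto
  have 4: "(x - n) * ln n \<ge> 0" using n by auto
  have 5: "ln n \<le> ln x" using n by simp
  show ?thesis
    using sum_nats_le_ln_bounds[OF n(1)] 1 2 3 4 5 unfolding T
    by (simp add: algebra_simps abs_le_iff)
qed

lemma sum_nats_le_inverse:
  assumes "x \<ge> 1"
  shows "\<bar>(\<Sum>k\<in>nats_le x. 1 / real k) - ln x - euler_mascheroni\<bar> \<le> 4 / x"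
proof -
  define n where "n = nat \<lfloor>x\<rfloor>"
  have n: "n > 0" "real n \<le> x" "x < real n + 1"
    using nat_floor_bounds[OF assms] by (auto simp: n_def)
  have T: "(\<Sum>k\<in>nats_le x. 1 / real k) = harm n"
    by (simp add: nats_le_altdef n_def harm_def inverse_eq_divide)
  have "euler_mascheroni \<in> {harm n - ln (Suc n) + inverse (of_nat (2*(n+1)))..harm n - ln (Suc n) + inverse (of_nat (2*n)) :: real}"
    using euler_mascheroni_bounds[of n] n by simp
  moreover have "inverse (of_nat (2*(n+1))) \<ge> (0::real)" by simp
  moreover have "inverse (of_nat (2*n)) \<le> 1 / real n" using n by (simp add: field_simps)
  ultimately have 1: "euler_mascheroni \<ge> harm n - ln (real (Suc n))"
      "euler_mascheroni \<le> harm n - ln (real (Suc n)) + 1 / n"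
    unfolding atLeastAtMost_iff by linarith+
  have 2: "ln x \<ge> ln (real n)" "ln x \<le> ln (real (Suc n))" using n assms by auto
  have "ln (real (Suc n) / real n) \<le> real (Suc n) / real n - 1"
    using n by (intro ln_le_minus_one) auto
  hence 3: "ln (real (Suc n)) \<le> ln n + 1 / n"
    using n by (simp add: ln_div field_simps)
  have "real n \<ge> 1" using n(1) by linarith
  hence "x \<le> real n * 2" using n by linarith
  hence "2 / real n \<le> 4 / x" using \<open>real n \<ge> 1\<close> assms by (simp add: field_simps)
  thus ?thesis unfolding T using 1 2 3 by (simp add: abs_le_iff)
qed

section \<open>Chebyshev's upper bound and Mertens' first theorem\<close>

definition psi :: "real \<Rightarrow> real" where
  "psi x = (\<Sum>n\<in>nats_le x. mangoldt n)"

lemma psi_nonneg: "psi x \<ge> 0"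
  unfolding psi_def by (intro sum_nonneg mangoldt_nonneg)

lemma sum_mangoldt_dvd: "k > 0 \<Longrightarrow> (\<Sum>d | d dvd k. mangoldt d) = ln (real k)"
  using mangoldt_sum[of k, where ?'a = real] by simp

lemma sum_nats_le_mangoldt_divide:
  "(\<Sum>n\<in>nats_le x. mangoldt n * real (card (nats_le (x / n)))) = (\<Sum>k\<in>nats_le x. ln (real k))"
proof -
  have "(\<Sum>n\<in>nats_le x. mangoldt n * real (card (nats_le (x / n)))) =
        (\<Sum>n\<in>nats_le x. \<Sum>m\<in>nats_le (x / n). mangoldt n)"
    by (simp add: mult.commute)
  also have "\<dots> = (\<Sum>k\<in>nats_le x. \<Sum>d | d dvd k. mangoldt d)"
    by (rule sum_nats_le_divisors)
  also have "\<dots> = (\<Sum>k\<in>nats_le x. ln (real k))"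
    by (intro sum.cong refl sum_mangoldt_dvd) (auto simp: nats_le_def)
  finally show ?thesis .
qed

text \<open>The weight in Chebyshev's combination T(x) - 2 T(x/2), taken at y = x / n: it is never
  negative, and it is at least 1 when x / 2 < n \<le> x.\<close>

lemma card_nats_le_half:
  assumes "y \<ge> 1"
  shows "card (nats_le y) \<ge> 2 * card (nats_le (y / 2)) + (if y < 2 then 1 else 0)"
proof (cases "y < 2")
  case True
  hence "nats_le (y / 2) = {}" by (intro nats_le_empty) auto
  moreover have "card (nats_le y) \<noteq> 0" using assms
    by (simp add: nats_le_altdef)
  ultimately show ?thesis by (auto simp: Suc_le_eq card_gt_0_iff)
next
  case False
  have "2 * \<lfloor>y / 2\<rfloor> \<le> \<lfloor>y\<rfloor>" by linarith
  thus ?thesis using False by (simp add: nats_le_altdef)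
qed

text \<open>In T(x) - 2 T(x/2) the terms of size x ln x cancel and O(x) remains; the constant 7 is
  generous.\<close>

lemma psi_minus_psi_half:
  assumes "x \<ge> 2"
  shows "psi x - psi (x / 2) \<le> 7 * x"
proof -
  define T where "T = (\<lambda>x. \<Sum>k\<in>nats_le x. ln (real k))"
  have T1: "T x = (\<Sum>n\<in>nats_le x. mangoldt n * real (card (nats_le (x / n))))"
    unfolding T_def by (rule sum_nats_le_mangoldt_divide [symmetric])
  have "T (x / 2) = (\<Sum>n\<in>nats_le (x / 2). mangoldt n * real (card (nats_le (x / 2 / n))))"
    unfolding T_def by (rule sum_nats_le_mangoldt_divide [symmetric])
  also have "\<dots> = (\<Sum>n\<in>nats_le x. mangoldt n * real (card (nats_le (x / n / 2))))"
  proof (rule sum.mono_neutral_cong_left)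
    show "\<forall>n\<in>nats_le x - nats_le (x / 2). mangoldt n * real (card (nats_le (x / n / 2))) = 0"
    proof
      fix n assume "n \<in> nats_le x - nats_le (x / 2)"
      hence "x / real n / 2 < 1" by (auto simp: nats_le_def field_simps)
      thus "mangoldt n * real (card (nats_le (x / n / 2))) = 0" by (simp add: nats_le_empty)
    qed
  qed (use assms in \<open>auto intro!: nats_le_mono simp: field_simps\<close>)
  finally have "T x - 2 * T (x / 2) = (\<Sum>n\<in>nats_le x. mangoldt n *
      (real (card (nats_le (x / n))) - 2 * real (card (nats_le (x / n / 2)))))"
    unfolding T1 by (simp add: sum_distrib_left sum_subtractf algebra_simps)
  also have "\<dots> \<ge> (\<Sum>n\<in>nats_le x. mangoldt n * (if n \<in> nats_le (x / 2) then 0 else 1))"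
  proof (intro sum_mono mult_left_mono mangoldt_nonneg)
    fix n assume n: "n \<in> nats_le x"
    hence "x / n \<ge> 1" by (auto simp: nats_le_def field_simps)
    from card_nats_le_half[OF this]
    have "real (card (nats_le (x / n))) \<ge> real (2 * card (nats_le (x / n / 2)) + (if x / n < 2 then 1 else 0))"
      by (simp only: of_nat_le_iff)
    moreover have "x / n < 2 \<longleftrightarrow> n \<notin> nats_le (x / 2)"
      using n by (auto simp: nats_le_def field_simps)
    ultimately show "(if n \<in> nats_le (x / 2) then 0 else 1) \<le>
        real (card (nats_le (x / n))) - 2 * real (card (nats_le (x / n / 2)))"
      by (auto split: if_splits)
  qed
  also have "(\<Sum>n\<in>nats_le x. mangoldt n * (if n \<in> nats_le (x / 2) then 0 else 1)) =
             (\<Sum>n\<in>nats_le x. mangoldt n) - (\<Sum>n\<in>nats_le x. if n \<in> nats_le (x / 2) then mangoldt n else 0)"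
    by (subst sum_subtractf [symmetric]) (intro sum.cong refl, auto)
  also have "(\<Sum>n\<in>nats_le x. if n \<in> nats_le (x / 2) then mangoldt n else 0) = psi (x / 2)"
    unfolding psi_def using assms nats_le_mono[of "x / 2" x]
    by (subst sum.inter_restrict [symmetric]) (auto intro!: sum.cong)
  finally have 1: "psi x - psi (x / 2) \<le> T x - 2 * T (x / 2)" by (simp add: psi_def)
  have 2: "T x \<le> x * ln x - x + 1 + ln x"
    using sum_nats_le_ln[of x] assms unfolding T_def by simp
  have 3: "T (x / 2) \<ge> x / 2 * ln (x / 2) - x / 2 - 1 - ln (x / 2)"
    using sum_nats_le_ln[of "x / 2"] assms unfolding T_def by (simp add: abs_le_iff)
  have 4: "ln (x / 2) = ln x - ln 2" using assms by (simp add: ln_div)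
  have 5: "ln x \<le> x - 1" "ln 2 \<le> (1::real)" "ln 2 \<ge> (0::real)"
    using assms ln_le_minus_one[of x] ln_le_minus_one[of 2] by auto
  have 6: "x * ln 2 \<le> x * 1" using 5 assms by (intro mult_left_mono) auto
  have 7: "x / 2 * (ln x - ln 2) = x * ln x / 2 - x * ln 2 / 2" by (simp add: algebra_simps)
  show ?thesis using 1 2 3 5 6 assms unfolding 4 7 by linarith
qed

text \<open>Repeated halving sums a geometric series, which doubles the constant 7. The induction is
  on a power of 2 exceeding x.\<close>

lemma psi_le: "x \<ge> 0 \<Longrightarrow> psi x \<le> 14 * x"
proof -
  have "\<forall>x\<ge>0. x < 2 ^ n \<longrightarrow> psi x \<le> 14 * x" for n :: nat
  proof (induction n)
    case 0
    thus ?case by (auto simp: psi_def nats_le_empty)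
  next
    case (Suc n)
    show ?case
    proof safe
      fix x :: real assume x: "x \<ge> 0" "x < 2 ^ Suc n"
      show "psi x \<le> 14 * x"
      proof (cases "x \<ge> 2")
        case True
        have "psi (x / 2) \<le> 14 * (x / 2)" using x by (intro Suc.IH[rule_format]) auto
        with psi_minus_psi_half[OF True] show ?thesis by simp
      next
        case False
        hence "nats_le x \<subseteq> {1}" by (auto simp: nats_le_def)
        hence "psi x = 0" unfolding psi_def by (intro sum.neutral) auto
        thus ?thesis using x by simp
      qed
    qed
  qed
  moreover assume "x \<ge> 0"
  moreover obtain n where "x < 2 ^ n" using real_arch_pow[of 2 x] by auto
  ultimately show ?thesis by blast
qed

lemma nats_le_card_ge: "y \<ge> 0 \<Longrightarrow> real (card (nats_le y)) \<ge> y - 1"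
  by (simp add: nats_le_altdef)

text \<open>Replacing the floors of x / n by x / n in the factorisation of T(x) costs at most
  \<open>psi x\<close>, which Chebyshev's bound makes O(x); dividing by x gives the claim.\<close>

lemma sum_mangoldt_over_n:
  assumes "x \<ge> 1"
  shows "\<bar>(\<Sum>n\<in>nats_le x. mangoldt n / real n) - ln x\<bar> \<le> 15"
proof -
  define T where "T = (\<Sum>k\<in>nats_le x. ln (real k))"
  define M :: real where "M = (\<Sum>n\<in>nats_le x. mangoldt n / real n)"
  have T: "T = (\<Sum>n\<in>nats_le x. mangoldt n * real (card (nats_le (x / n))))"
    unfolding T_def by (rule sum_nats_le_mangoldt_divide [symmetric])
  have "T \<le> (\<Sum>n\<in>nats_le x. mangoldt n * (x / n))"
    unfolding T using assms by (intro sum_mono mult_left_mono card_nats_le mangoldt_nonneg) auto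
  also have "\<dots> = x * M" by (simp add: M_def sum_distrib_left mult_ac)
  finally have 1: "T \<le> x * M" .
  have "T \<ge> (\<Sum>n\<in>nats_le x. mangoldt n * (x / n - 1))"
    unfolding T using assms by (intro sum_mono mult_left_mono nats_le_card_ge mangoldt_nonneg) auto
  also have "(\<Sum>n\<in>nats_le x. mangoldt n * (x / n - 1)) = x * M - psi x"
    by (simp add: M_def psi_def sum_distrib_left mult_ac algebra_simps sum_subtractf)
  finally have 2: "T \<ge> x * M - psi x" .
  have 3: "\<bar>T - (x * ln x - x)\<bar> \<le> 1 + ln x" unfolding T_def by (rule sum_nats_le_ln) fact
  have 4: "ln x \<le> x - 1" using assms by (intro ln_le_minus_one) auto
  have "psi x \<le> 14 * x" using assms by (intro psi_le) auto
  hence "x * (M - ln x) \<le> x * 15" "x * (ln x - M) \<le> x * 15"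
    using 1 2 3 4 assms by (auto simp: algebra_simps abs_le_iff)
  thus ?thesis unfolding M_def [symmetric] using assms by (auto simp: abs_le_iff)
qed

section \<open>Moebius inversion of summatory functions\<close>

definition moebius :: "nat \<Rightarrow> real" where
  "moebius n = (if squarefree n then (-1) ^ card (prime_factors n) else 0)"

lemma moebius_prime_mult:
  assumes "prime p" "\<not> p dvd n" "n > 0"
  shows "moebius (p * n) = - moebius n"
proof -
  have cop: "coprime p n" using assms by (simp add: prime_imp_coprime)
  have "squarefree (p * n) \<longleftrightarrow> squarefree n"
    using squarefree_mult_coprime[OF cop squarefree_prime[OF assms(1)]] squarefree_multD(2)[of p n]
    by blast
  moreover have "prime_factors (p * n) = insert p (prime_factors n)"
    using assms by (simp add: prime_factors_product prime_prime_factors)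
  moreover have "p \<notin> prime_factors n" using assms by auto
  ultimately show ?thesis by (simp add: moebius_def)
qed

text \<open>For a fixed prime p dividing n, the squarefree divisors pair off as d and p * d with
  opposite signs.\<close>

lemma sum_moebius_dvd:
  assumes "n > 0"
  shows "(\<Sum>d | d dvd n. moebius d) = (if n = 1 then 1 else 0)"
proof (cases "n = 1")
  case False
  then obtain p where p: "prime p" "p dvd n" using prime_factor_nat by blast
  define X where "X = {d. d dvd n \<and> \<not> p dvd d \<and> squarefree d}"
  have fin: "finite X" unfolding X_def using assms by auto
  have "(\<Sum>d | d dvd n. moebius d) = (\<Sum>d\<in>X \<union> (\<lambda>d. p * d) ` X. moebius d)"
  proof (rule sum.mono_neutral_right)
    have "p * d dvd n" if "d \<in> X" for d
      using p that by (intro divides_mult prime_imp_coprime) (auto simp: X_def)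
    thus "X \<union> (\<lambda>d. p * d) ` X \<subseteq> {d. d dvd n}" by (auto simp: X_def)
    show "\<forall>d\<in>{d. d dvd n} - (X \<union> (\<lambda>d. p * d) ` X). moebius d = 0"
    proof
      fix d assume d: "d \<in> {d. d dvd n} - (X \<union> (\<lambda>d. p * d) ` X)"
      have "\<not> squarefree d"
      proof
        assume sq: "squarefree d"
        with d have "p dvd d" by (auto simp: X_def)
        then obtain e where e: "d = p * e" by auto
        have "\<not> p dvd e"
        proof
          assume "p dvd e"
          hence "p ^ 2 dvd d" by (auto simp: e power2_eq_square)
          with sq have "is_unit p" by (auto simp: squarefree_def)
          with p show False by auto
        qed
        moreover have "e dvd n" using d e by (auto intro: dvd_trans[of e d n])
        moreover have "squarefree e" using sq unfolding e by (rule squarefree_multD(2))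
        ultimately have "e \<in> X" by (simp add: X_def)
        with d e show False by auto
      qed
      thus "moebius d = 0" by (simp add: moebius_def)
    qed
  qed (use assms in auto)
  also have "\<dots> = (\<Sum>d\<in>X. moebius d) + (\<Sum>d\<in>(\<lambda>d. p * d) ` X. moebius d)"
    using fin by (intro sum.union_disjoint) (auto simp: X_def)
  also have "(\<Sum>d\<in>(\<lambda>d. p * d) ` X. moebius d) = (\<Sum>d\<in>X. moebius (p * d))"
    using p by (subst sum.reindex) (auto intro!: inj_onI)
  also have "\<dots> = (\<Sum>d\<in>X. - moebius d)"
    using p assms by (intro sum.cong refl moebius_prime_mult) (auto simp: X_def intro!: Nat.gr0I)
  finally show ?thesis using False by (simp add: sum_negf)
qed (simp_all add: moebius_def)

lemma abs_moebius_le: "\<bar>moebius n\<bar> \<le> 1"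
  by (simp add: moebius_def)

text \<open>Recovers H from its sums over H(y / m): after grouping by the product k = n * m, only k
  = 1 survives.\<close>

lemma moebius_summatory_inversion:
  fixes H :: "real \<Rightarrow> real"
  assumes "x \<ge> 1"
  shows "(\<Sum>n\<in>nats_le x. moebius n * (\<Sum>m\<in>nats_le (x / n). H (x / (real n * real m)))) = H x"
proof -
  have "(\<Sum>n\<in>nats_le x. moebius n * (\<Sum>m\<in>nats_le (x / n). H (x / (real n * real m)))) =
        (\<Sum>n\<in>nats_le x. \<Sum>m\<in>nats_le (x / n). moebius n * H (x / (real n * real m)))"
    by (simp add: sum_distrib_left)
  also have "\<dots> = (\<Sum>k\<in>nats_le x. \<Sum>d | d dvd k. moebius d * H (x / (real d * real (k div d))))"
    by (rule sum_nats_le_divisors)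
  also have "\<dots> = (\<Sum>k\<in>nats_le x. if k = 1 then H x else 0)"
  proof (intro sum.cong refl)
    fix k assume k: "k \<in> nats_le x"
    have "(\<Sum>d | d dvd k. moebius d * H (x / (real d * real (k div d)))) = (\<Sum>d | d dvd k. moebius d * H (x / k))"
      by (intro sum.cong refl) (auto simp: of_nat_mult [symmetric] simp del: of_nat_mult)
    also have "\<dots> = (\<Sum>d | d dvd k. moebius d) * H (x / k)"
      by (simp add: sum_distrib_right)
    finally show "(\<Sum>d | d dvd k. moebius d * H (x / (real d * real (k div d)))) = (if k = 1 then H x else 0)"
      using k by (simp add: sum_moebius_dvd nats_le_def)
  qed
  also have "\<dots> = H x"
    using assms by (subst sum.delta) (auto simp: nats_le_def finite_nats_le[unfolded nats_le_def])
  finally show ?thesis .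
qed

text \<open>The inversion sums an error bound over all x / n. A bound of order sqrt y survives this
  as O(x), whereas a bound linear in y would gain a factor ln x.\<close>

lemma sum_sqrt_divide_le:
  assumes "x \<ge> 0"
  shows "(\<Sum>n\<in>nats_le x. sqrt (x / real n)) \<le> 2 * x"
proof -
  have *: "(\<Sum>n=1..N. 1 / sqrt (real n)) \<le> 2 * sqrt N" for N :: nat
  proof (induction N)
    case (Suc N)
    have "(sqrt (real N + 1) - sqrt (real N)) ^ 2 \<ge> 0" by simp
    hence "1 + 2 * (sqrt (real N) * sqrt (real N + 1)) \<le> 2 * (real N + 1)"
      by (simp add: power2_eq_square algebra_simps)
    hence "1 / sqrt (real N + 1) \<le> 2 * sqrt (real N + 1) - 2 * sqrt (real N)"
      by (simp add: field_simps)
    with Suc show ?case by (simp add: add.commute)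
  qed auto
  have "(\<Sum>n\<in>nats_le x. sqrt (x / real n)) = sqrt x * (\<Sum>n=1..nat \<lfloor>x\<rfloor>. 1 / sqrt (real n))"
    by (simp add: nats_le_altdef sum_distrib_left real_sqrt_divide)
  also have "\<dots> \<le> sqrt x * (2 * sqrt (nat \<lfloor>x\<rfloor>))"
    using assms by (intro mult_left_mono *) auto
  also have "\<dots> \<le> sqrt x * (2 * sqrt x)"
    using assms by (intro mult_left_mono) (auto simp: of_nat_floor)
  also have "\<dots> = 2 * x" using assms by simp
  finally show ?thesis .
qed

text \<open>
  The constant \<open>euler_mascheroni + 1\<close> makes \<open>\<Sum>m\<le>y. F (y / m)\<close> logarithmic in size, so that the
  inversion below costs only \<open>O(x)\<close> (Tatuzawa and Iseki).
\<close>
theorem Selberg_symmetry: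
  obtains K where "\<And>x. x \<ge> 1 \<Longrightarrow>
    \<bar>psi x * ln x + (\<Sum>n\<in>nats_le x. mangoldt n * psi (x / n)) - 2 * x * ln x\<bar> \<le> K * x"
proof -
  define c :: real where "c = euler_mascheroni + 1"
  have c: "c \<ge> 0" using euler_mascheroni_pos by (simp add: c_def)
  define F where "F = (\<lambda>y. psi y - y + c)"
  \<comment> \<open>Selberg's combination, formed with the error F. In the sum over m of H(y / m)
    the convolution contributes ln m because the sum of \<open>mangoldt\<close> over the divisors of
    m is ln m; this completes ln(y / m) to ln y.\<close>
  define H where "H = (\<lambda>y. F y * ln y + (\<Sum>n\<in>nats_le y. mangoldt n * F (y / real n)))"
  \<comment> \<open>The first summand bounds H, the 15 is Mertens' error, and 15 * c covers c * ln x
    \<le> c * x and c * psi x \<le> 14 * c * x.\<close>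
  define K where "K = 2 * (16 + 4 * (5 + c)) + 15 + 15 * c"

  have sumF: "\<bar>\<Sum>m\<in>nats_le y. F (y / real m)\<bar> \<le> ln y + (5 + c)" if "y \<ge> 1" for y
  proof -
    have "(\<Sum>m\<in>nats_le y. psi (y / real m)) = (\<Sum>m\<in>nats_le y. \<Sum>n\<in>nats_le (y / real m). mangoldt n)"
      by (simp add: psi_def)
    also have "\<dots> = (\<Sum>n\<in>nats_le y. \<Sum>m\<in>nats_le (y / real n). mangoldt n)"
      by (rule sum_nats_le_swap)
    also have "\<dots> = (\<Sum>k\<in>nats_le y. ln (real k))"
      by (subst sum_nats_le_mangoldt_divide [symmetric]) (simp add: mult.commute)
    finally have 1: "(\<Sum>m\<in>nats_le y. psi (y / real m)) = (\<Sum>k\<in>nats_le y. ln (real k))" .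
    have "(\<Sum>m\<in>nats_le y. F (y / real m)) =
          (\<Sum>k\<in>nats_le y. ln (real k)) - y * (\<Sum>k\<in>nats_le y. 1 / real k) + c * card (nats_le y)"
      by (simp add: F_def sum_subtractf sum.distrib 1 sum_distrib_left)
    \<comment> \<open>By the choice of c, the main terms of the three sums cancel completely and
      only their errors remain.\<close>
    also have "\<dots> = ((\<Sum>k\<in>nats_le y. ln (real k)) - (y * ln y - y))
            - y * ((\<Sum>k\<in>nats_le y. 1 / real k) - ln y - euler_mascheroni)
            + c * (card (nats_le y) - y)"
      by (simp add: c_def algebra_simps)
    also have "\<bar>\<dots>\<bar> \<le> \<bar>(\<Sum>k\<in>nats_le y. ln (real k)) - (y * ln y - y)\<bar>
            + \<bar>y * ((\<Sum>k\<in>nats_le y. 1 / real k) - ln y - euler_mascheroni)\<bar>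
            + \<bar>c * (card (nats_le y) - y)\<bar>"
      by linarith
    also have "\<dots> \<le> (1 + ln y) + 4 + c"
    proof (intro add_mono)
      show "\<bar>(\<Sum>k\<in>nats_le y. ln (real k)) - (y * ln y - y)\<bar> \<le> 1 + ln y"
        by (rule sum_nats_le_ln) fact
      show "\<bar>y * ((\<Sum>k\<in>nats_le y. 1 / real k) - ln y - euler_mascheroni)\<bar> \<le> 4"
        using mult_left_mono[OF sum_nats_le_inverse[OF that], of y] that by (simp add: abs_mult)
      have "\<bar>card (nats_le y) - y\<bar> \<le> 1"
        using card_nats_le[of y] nats_le_card_ge[of y] that by (simp add: abs_le_iff)
      thus "\<bar>c * (card (nats_le y) - y)\<bar> \<le> c"
        using c mult_left_mono[of "\<bar>card (nats_le y) - y\<bar>" 1 c] by (simp add: abs_mult)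
    qed
    finally show ?thesis by simp
  qed

  have sumH: "(\<Sum>m\<in>nats_le y. H (y / real m)) = ln y * (\<Sum>m\<in>nats_le y. F (y / real m))" if "y \<ge> 1" for y
  proof -
    have "(\<Sum>m\<in>nats_le y. \<Sum>n\<in>nats_le (y / real m). mangoldt n * F (y / (real m * real n))) =
          (\<Sum>n\<in>nats_le y. \<Sum>m\<in>nats_le (y / real n). mangoldt n * F (y / (real m * real n)))"
      by (rule sum_nats_le_swap)
    also have "\<dots> = (\<Sum>k\<in>nats_le y. \<Sum>d | d dvd k. mangoldt d * F (y / (real (k div d) * real d)))"
      by (rule sum_nats_le_divisors)
    also have "\<dots> = (\<Sum>k\<in>nats_le y. (\<Sum>d | d dvd k. mangoldt d) * F (y / k))"
      unfolding sum_distrib_right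
      by (intro sum.cong refl) (auto simp: of_nat_mult [symmetric] simp del: of_nat_mult)
    also have "\<dots> = (\<Sum>k\<in>nats_le y. ln (real k) * F (y / k))"
      by (intro sum.cong refl) (auto simp: sum_mangoldt_dvd nats_le_def)
    finally have "(\<Sum>m\<in>nats_le y. H (y / real m)) =
        (\<Sum>m\<in>nats_le y. F (y / real m) * ln (y / real m)) + (\<Sum>k\<in>nats_le y. ln (real k) * F (y / k))"
      by (simp add: H_def sum.distrib)
    also have "\<dots> = (\<Sum>m\<in>nats_le y. ln y * F (y / real m))"
      unfolding sum.distrib [symmetric]
      using that by (intro sum.cong refl) (auto simp: nats_le_def ln_div algebra_simps)
    finally show ?thesis by (simp add: sum_distrib_left)
  qed

  have sumH_bound: "\<bar>\<Sum>m\<in>nats_le y. H (y / real m)\<bar> \<le> (16 + 4 * (5 + c)) * sqrt y" if "y \<ge> 1" for y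
  proof -
    \<comment> \<open>With z the fourth root of y, ln y \<le> 4 * z, so a quadratic expression in ln
      y is O(sqrt y).\<close>
    define z where "z = sqrt (sqrt y)"
    have z: "z \<ge> 1" "z ^ 2 = sqrt y" using that by (simp_all add: z_def)
    have "z ^ 4 = (z ^ 2) ^ 2" by simp
    hence z4: "y = z ^ 4" using that z by simp
    have "ln y = 4 * ln z" using z z4 by (simp add: ln_realpow)
    also have "ln z \<le> z" using z ln_le_minus_one[of z] by simp
    finally have l: "ln y \<le> 4 * z" by simp
    have "\<bar>\<Sum>m\<in>nats_le y. H (y / real m)\<bar> = ln y * \<bar>\<Sum>m\<in>nats_le y. F (y / real m)\<bar>"
      using that by (simp add: sumH abs_mult)
    also have "\<dots> \<le> ln y * (ln y + (5 + c))"
      using that by (intro mult_left_mono sumF) auto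
    also have "\<dots> \<le> (4 * z) * (4 * z + (5 + c) * z)"
      using l that z c mult_left_mono[of 1 z "5 + c"] by (intro mult_mono add_mono) auto
    also have "\<dots> = (16 + 4 * (5 + c)) * sqrt y"
      by (simp add: z(2) [symmetric] power2_eq_square algebra_simps)
    finally show ?thesis .
  qed

  have H_bound: "\<bar>H x\<bar> \<le> (16 + 4 * (5 + c)) * (2 * x)" if "x \<ge> 1" for x
  proof -
    have "\<bar>H x\<bar> = \<bar>\<Sum>n\<in>nats_le x. moebius n * (\<Sum>m\<in>nats_le (x / n). H (x / (real n * real m)))\<bar>"
      using that by (simp add: moebius_summatory_inversion)
    also have "\<dots> \<le> (\<Sum>n\<in>nats_le x. \<bar>moebius n * (\<Sum>m\<in>nats_le (x / n). H (x / (real n * real m)))\<bar>)"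
      by (rule sum_abs)
    also have "\<dots> \<le> (\<Sum>n\<in>nats_le x. 1 * ((16 + 4 * (5 + c)) * sqrt (x / n)))"
      unfolding abs_mult
    proof (intro sum_mono mult_mono abs_moebius_le)
      fix n assume "n \<in> nats_le x"
      hence "x / n \<ge> 1" by (auto simp: nats_le_def)
      from sumH_bound[OF this]
      show "\<bar>\<Sum>m\<in>nats_le (x / n). H (x / (real n * real m))\<bar> \<le> (16 + 4 * (5 + c)) * sqrt (x / n)"
        by simp
    qed auto
    also have "\<dots> = (16 + 4 * (5 + c)) * (\<Sum>n\<in>nats_le x. sqrt (x / n))"
      by (simp add: sum_distrib_left)
    also have "\<dots> \<le> (16 + 4 * (5 + c)) * (2 * x)"
      using that c by (intro mult_left_mono sum_sqrt_divide_le) auto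
    finally show ?thesis .
  qed

  show ?thesis
  proof (rule that[of K])
    fix x :: real assume x: "x \<ge> 1"
    define M :: real where "M = (\<Sum>n\<in>nats_le x. mangoldt n / real n)"
    have "H x = psi x * ln x + (\<Sum>n\<in>nats_le x. mangoldt n * psi (x / n)) - x * ln x - x * M + c * ln x + c * psi x"
      by (simp add: H_def F_def M_def psi_def algebra_simps sum.distrib sum_subtractf sum_distrib_left)
    hence "psi x * ln x + (\<Sum>n\<in>nats_le x. mangoldt n * psi (x / n)) - 2 * x * ln x =
           H x + x * (M - ln x) - c * ln x - c * psi x"
      by (simp add: algebra_simps)
    also have "\<bar>\<dots>\<bar> \<le> \<bar>H x\<bar> + x * \<bar>M - ln x\<bar> + c * ln x + c * psi x"
    proof -
      have "\<bar>x * (M - ln x)\<bar> = x * \<bar>M - ln x\<bar>" "c * ln x \<ge> 0" "c * psi x \<ge> 0"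
        using x c psi_nonneg by (auto simp: abs_mult)
      thus ?thesis by linarith
    qed
    also have "\<dots> \<le> (16 + 4 * (5 + c)) * (2 * x) + x * 15 + c * x + c * (14 * x)"
      using x c ln_le_minus_one[of x] psi_le[of x] sum_mangoldt_over_n[OF x]
      by (intro add_mono mult_left_mono H_bound) (auto simp: M_def)
    also have "\<dots> = K * x" by (simp add: K_def algebra_simps)
    finally show "\<bar>psi x * ln x + (\<Sum>n\<in>nats_le x. mangoldt n * psi (x / n)) - 2 * x * ln x\<bar> \<le> K * x" .
  qed
qed

section \<open>Summatory functions with a logarithmic convolution identity\<close>

lemma harm_nat_le:
  fixes x :: real
  assumes "x \<ge> 1"
  shows "harm (nat \<lfloor>x\<rfloor>) \<le> 1 + ln x"
proof -
  have *: "n > 0 \<Longrightarrow> harm n \<le> 1 + ln (real n)" for n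
  proof (induction n rule: nat_induct_non_zero)
    case (Suc n)
    have n: "real n > 0" using Suc by simp
    have "ln (real n / real (Suc n)) \<le> real n / real (Suc n) - 1"
      using n by (intro ln_le_minus_one) auto
    hence "inverse (real (Suc n)) \<le> ln (real (Suc n)) - ln (real n)"
      using n by (simp add: ln_div field_simps)
    thus ?case using Suc by (simp add: harm_Suc)
  qed (simp add: harm_def)
  have n: "nat \<lfloor>x\<rfloor> > 0" "real (nat \<lfloor>x\<rfloor>) \<le> x" using nat_floor_bounds[OF assms] by auto
  have "ln (real (nat \<lfloor>x\<rfloor>)) \<le> ln x" using n assms by simp
  thus ?thesis using *[OF n(1)] by linarith
qed

text \<open>In the application \<open>f\<close> is the indicator of the integers composed of a set
  of primes, and \<open>lam\<close> is the von Mangoldt function restricted to powers of those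
  primes. \<open>conv\<close> is the coefficient form of -L' = (-L' / L) * L for the Dirichlet
  series L of \<open>f\<close>.\<close>

locale log_convolution =
  fixes f lam :: "nat \<Rightarrow> real" and \<tau> :: real
  assumes f_nonneg: "f n \<ge> 0" and f_le_1: "f n \<le> 1"
    and tau: "0 < \<tau>" "\<tau> \<le> 1"
    and conv: "k > 0 \<Longrightarrow> f k * ln (real k) = (\<Sum>d | d dvd k. lam d * f (k div d))"
    and lam_asymp: "((\<lambda>x. (\<Sum>n\<in>nats_le x. lam n - \<tau> * mangoldt n) / x) \<longlongrightarrow> 0) at_top"
    and log_sum_at_top: "filterlim (\<lambda>x. \<Sum>n\<in>nats_le x. f n / real n) at_top at_top"
begin

text \<open>\<open>U x\<close> is the integral of S(t) / t over [1, x], and \<open>A\<close> is the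
  summatory function of the convolution of \<open>f\<close> with \<open>mangoldt\<close>.
  \<open>R\<close> is the error psi(y) - y convolved with \<open>f\<close>, because x * S(x) is the
  sum of f(m) * (x / m).\<close>

definition "S x = (\<Sum>n\<in>nats_le x. f n / real n)"
definition "U x = (\<Sum>n\<in>nats_le x. f n / real n * ln (x / real n))"
definition "A x = (\<Sum>n\<in>nats_le x. f n * psi (x / real n))"
definition "G x = (\<Sum>n\<in>nats_le x. f n * ln (real n))"
definition "E x = (\<Sum>n\<in>nats_le x. lam n - \<tau> * mangoldt n)"
definition "R x = A x - x * S x"

lemma S_nonneg: "S x \<ge> 0"
  unfolding S_def by (intro sum_nonneg) (auto simp: f_nonneg)

lemma S_mono: "x \<le> y \<Longrightarrow> S x \<le> S y"
  unfolding S_def by (intro sum_mono2 nats_le_mono) (auto simp: f_nonneg)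

lemma U_le:
  assumes "x \<ge> 1"
  shows "U x \<le> S x * ln x"
proof -
  have "U x \<le> (\<Sum>n\<in>nats_le x. f n / real n * ln x)"
    unfolding U_def using assms
    by (intro sum_mono mult_left_mono) (auto simp: f_nonneg nats_le_def field_simps)
  thus ?thesis by (simp add: S_def sum_distrib_right)
qed

lemma sum_f_ln_over_n:
  assumes "x \<ge> 1"
  shows "(\<Sum>n\<in>nats_le x. f n * ln (real n) / real n) = S x * ln x - U x"
proof -
  have "(\<Sum>n\<in>nats_le x. f n * ln (real n) / real n) =
        (\<Sum>n\<in>nats_le x. f n / real n * ln x - f n / real n * ln (x / real n))"
    using assms by (intro sum.cong refl) (auto simp: nats_le_def ln_div algebra_simps diff_divide_distrib)
  thus ?thesis by (simp add: S_def U_def sum_subtractf sum_distrib_right)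
qed

text \<open>The convolutions evaluate \<open>E\<close> at all x / m, including small arguments where
  o(x) says nothing; the constant K absorbs that initial range.\<close>

lemma E_bound:
  assumes "\<eta> > 0"
  obtains K where "K \<ge> 0" "\<And>x. x \<ge> 0 \<Longrightarrow> \<bar>E x\<bar> \<le> \<eta> * x + K"
proof -
  have "eventually (\<lambda>x. \<bar>E x / x\<bar> < \<eta>) at_top"
    using lam_asymp assms unfolding E_def tendsto_iff dist_real_def by simp
  then obtain X where X: "\<And>x. x \<ge> X \<Longrightarrow> \<bar>E x / x\<bar> < \<eta>"
    unfolding eventually_at_top_linorder by blast
  define K where "K = (\<Sum>n\<in>nats_le X. \<bar>lam n - \<tau> * mangoldt n\<bar>)"
  have "K \<ge> 0" unfolding K_def by (intro sum_nonneg) auto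
  moreover have "\<bar>E x\<bar> \<le> \<eta> * x + K" if x: "x \<ge> 0" for x
  proof (cases "x \<le> X")
    case True
    have "\<bar>E x\<bar> \<le> (\<Sum>n\<in>nats_le x. \<bar>lam n - \<tau> * mangoldt n\<bar>)"
      unfolding E_def by (rule sum_abs)
    also have "\<dots> \<le> K"
      unfolding K_def using True by (intro sum_mono2 nats_le_mono) auto
    finally have "\<bar>E x\<bar> \<le> K" .
    moreover have "\<eta> * x \<ge> 0" using assms x by simp
    ultimately show ?thesis by linarith
  next
    case False
    show ?thesis
    proof (cases "x = 0")
      case True
      thus ?thesis using \<open>K \<ge> 0\<close> by (simp add: E_def nats_le_empty)
    next
      case x0: False
      have "\<bar>E x\<bar> \<le> \<eta> * x" using X[of x] False x x0 by (simp add: abs_divide field_simps)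
      thus ?thesis using \<open>K \<ge> 0\<close> by linarith
    qed
  qed
  ultimately show ?thesis using that by blast
qed

lemma sum_lam_over_n:
  assumes "\<eta> > 0"
  obtains K where "K \<ge> 0"
    "\<And>x. x \<ge> 1 \<Longrightarrow> \<bar>(\<Sum>n\<in>nats_le x. lam n / real n) - \<tau> * ln x\<bar> \<le> \<eta> * ln x + K"
proof -
  obtain K where K: "K \<ge> 0" "\<And>x. x \<ge> 0 \<Longrightarrow> \<bar>E x\<bar> \<le> \<eta> * x + K"
    using E_bound[OF assms] by blast
  define e where "e = (\<lambda>n. lam n - \<tau> * mangoldt n)"
  have E_Suc: "E (real (Suc n)) = E (real n) + e (Suc n)" for n
    unfolding E_def e_def nats_le_altdef floor_of_nat nat_int by (simp add: sum.cl_ivl_Suc)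
  have E_nat: "\<bar>E (real n)\<bar> \<le> \<eta> * real n + K" for n
    using K(2)[of "real n"] by simp
  \<comment> \<open>Abel summation as an induction: each step adds E(n+1) / ((n+1) * (n+2)). The
    linear part of the bound on E builds up the harmonic sum, and the constant part telescopes to 1
    - 1 / (n+1). Dividing the boundary term by n + 1 rather than n makes n = 0 a valid
    start.\<close>
  have ind: "\<bar>(\<Sum>k=1..n. e k / real k) - E n / (n + 1)\<bar> \<le> \<eta> * harm n + K * (1 - 1 / (n + 1))" for n :: nat
  proof (induction n)
    case 0
    thus ?case by (simp add: harm_def E_def nats_le_empty)
  next
    case (Suc n)
    have "(\<Sum>k=1..Suc n. e k / real k) - E (Suc n) / (Suc n + 1) =
          ((\<Sum>k=1..n. e k / real k) - E n / (n + 1)) + E (Suc n) / ((real n + 1) * (real n + 2))"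
    proof -
      have alg: "d / (m + 1) - (c + d) / (m + 1 + 1) = - (c / (m + 1)) + (c + d) / ((m + 1) * (m + 2))"
        if "m \<ge> 0" for m c d :: real
      proof -
        have "m + 1 \<noteq> 0" "m + 2 \<noteq> 0" "m + 1 + 1 = m + 2" using that by auto
        thus ?thesis by (simp add: divide_simps) (simp add: algebra_simps)
      qed
      have "real (Suc n) = real n + 1" by simp
      thus ?thesis
        unfolding E_Suc sum.cl_ivl_Suc using alg[of "real n" "e (Suc n)" "E (real n)"] by (simp add: add_ac)
    qed
    also have "\<bar>\<dots>\<bar> \<le> (\<eta> * harm n + K * (1 - 1 / (n + 1))) + (\<eta> * (real n + 2) + K) / ((real n + 1) * (real n + 2))"
    proof (intro order.trans[OF abs_triangle_ineq] add_mono Suc.IH)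
      have "\<bar>E (Suc n)\<bar> \<le> \<eta> * (real n + 2) + K" using E_nat[of "Suc n"] assms by (simp add: algebra_simps)
      thus "\<bar>E (Suc n) / ((real n + 1) * (real n + 2))\<bar> \<le> (\<eta> * (real n + 2) + K) / ((real n + 1) * (real n + 2))"
        by (simp add: abs_divide abs_mult divide_right_mono)
    qed
    also have "\<dots> = \<eta> * harm (Suc n) + K * (1 - 1 / (Suc n + 1))"
      by (simp add: harm_Suc divide_simps) (simp add: algebra_simps)
    finally show ?case .
  qed
  show ?thesis
  proof (rule that[of "2 * \<eta> + 2 * K + 15 * \<tau>"])
    show "2 * \<eta> + 2 * K + 15 * \<tau> \<ge> 0" using assms K tau by simp
  next
    fix x :: real assume x: "x \<ge> 1"
    define n where "n = nat \<lfloor>x\<rfloor>"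
    have "(\<Sum>k\<in>nats_le x. lam k / real k) = (\<Sum>k=1..n. e k / real k) + \<tau> * (\<Sum>k\<in>nats_le x. mangoldt k / real k)"
      by (simp add: nats_le_altdef n_def e_def sum_distrib_left diff_divide_distrib sum_subtractf)
    hence "(\<Sum>k\<in>nats_le x. lam k / real k) - \<tau> * ln x =
        ((\<Sum>k=1..n. e k / real k) - E n / (n + 1)) + E n / (n + 1)
         + \<tau> * ((\<Sum>k\<in>nats_le x. mangoldt k / real k) - ln x)"
      by (simp add: algebra_simps)
    also have "\<bar>\<dots>\<bar> \<le> (\<eta> * harm n + K * (1 - 1 / (n + 1))) + (\<eta> + K) + \<tau> * 15"
    proof (intro order.trans[OF abs_triangle_ineq] add_mono ind)
      have "K * real n \<ge> 0" using K(1) by simp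
      hence "\<bar>E n\<bar> \<le> \<eta> * (n + 1) + K * (n + 1)" using E_nat[of n] assms
        unfolding of_nat_add of_nat_1 distrib_left by linarith
      thus "\<bar>E n / (n + 1)\<bar> \<le> \<eta> + K" by (simp add: abs_divide divide_simps algebra_simps)
      show "\<bar>\<tau> * ((\<Sum>k\<in>nats_le x. mangoldt k / real k) - ln x)\<bar> \<le> \<tau> * 15"
        unfolding abs_mult using sum_mangoldt_over_n[OF x] tau by (intro mult_mono) auto
    qed
    also have "\<dots> \<le> (\<eta> * (1 + ln x) + K * 1) + (\<eta> + K) + \<tau> * 15"
      using assms K x tau harm_nat_le[OF x] unfolding n_def
      by (intro add_mono mult_left_mono) auto
    finally show "\<bar>(\<Sum>n\<in>nats_le x. lam n / real n) - \<tau> * ln x\<bar> \<le> \<eta> * ln x + (2 * \<eta> + 2 * K + 15 * \<tau>)"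
      by (simp add: algebra_simps)
  qed
qed

text \<open>\<open>conv\<close> makes \<open>G\<close> the convolution of \<open>lam\<close> with
  \<open>f\<close>, so that the difference is the sum of f(m) * E(x / m). Since \<open>f\<close> is
  at most 1, the constant from \<open>E_bound\<close> adds up to only K * x.\<close>

lemma G_minus_A:
  assumes "\<eta> > 0"
  obtains K where "K \<ge> 0" "\<And>x. x \<ge> 1 \<Longrightarrow> \<bar>G x - \<tau> * A x\<bar> \<le> \<eta> * x * S x + K * x"
proof -
  obtain K where K: "K \<ge> 0" "\<And>x. x \<ge> 0 \<Longrightarrow> \<bar>E x\<bar> \<le> \<eta> * x + K"
    using E_bound[OF assms] by blast
  have "\<bar>G x - \<tau> * A x\<bar> \<le> \<eta> * x * S x + K * x" if x: "x \<ge> 1" for x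
  proof -
    have "G x = (\<Sum>k\<in>nats_le x. \<Sum>d | d dvd k. lam d * f (k div d))"
      unfolding G_def by (intro sum.cong refl conv) (auto simp: nats_le_def)
    also have "\<dots> = (\<Sum>d\<in>nats_le x. \<Sum>m\<in>nats_le (x / d). lam d * f m)"
      by (rule sum_nats_le_divisors [symmetric])
    also have "\<dots> = (\<Sum>m\<in>nats_le x. \<Sum>d\<in>nats_le (x / m). lam d * f m)"
      by (rule sum_nats_le_swap)
    finally have "G x - \<tau> * A x = (\<Sum>m\<in>nats_le x. f m * E (x / m))"
      by (simp add: A_def psi_def E_def sum_distrib_left sum_subtractf algebra_simps)
    also have "\<bar>\<dots>\<bar> \<le> (\<Sum>m\<in>nats_le x. f m * (\<eta> * (x / m)) + 1 * K)"
    proof (rule order.trans[OF sum_abs], rule sum_mono)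
      fix m
      have "\<bar>f m * E (x / m)\<bar> \<le> f m * (\<eta> * (x / m) + K)"
        unfolding abs_mult using x K(2)[of "x / m"] f_nonneg[of m] by (simp add: mult_left_mono)
      also have "\<dots> \<le> f m * (\<eta> * (x / m)) + 1 * K"
        using f_le_1[of m] K(1) by (auto simp: algebra_simps intro: mult_right_le_one_le mult_left_le)
      finally show "\<bar>f m * E (x / m)\<bar> \<le> f m * (\<eta> * (x / m)) + 1 * K" .
    qed
    also have "\<dots> = \<eta> * x * S x + K * card (nats_le x)"
      by (simp add: sum.distrib S_def sum_distrib_left mult_ac)
    also have "\<dots> \<le> \<eta> * x * S x + K * x"
      using x K card_nats_le[of x] by (intro add_left_mono mult_left_mono) auto
    finally show ?thesis .
  qed
  thus ?thesis using that K by blast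
qed

text \<open>After exchanging the sums, Mertens' theorem evaluates the inner one with an error that
  is uniform in m.\<close>

lemma sum_mangoldt_S:
  assumes "x \<ge> 1"
  shows "\<bar>(\<Sum>n\<in>nats_le x. mangoldt n / real n * S (x / n)) - U x\<bar> \<le> 15 * S x"
proof -
  have "(\<Sum>n\<in>nats_le x. mangoldt n / real n * S (x / n)) =
        (\<Sum>n\<in>nats_le x. \<Sum>m\<in>nats_le (x / n). mangoldt n / real n * (f m / m))"
    by (simp add: S_def sum_distrib_left)
  also have "\<dots> = (\<Sum>m\<in>nats_le x. \<Sum>n\<in>nats_le (x / m). mangoldt n / real n * (f m / m))"
    by (rule sum_nats_le_swap)
  also have "\<dots> - U x = (\<Sum>m\<in>nats_le x. f m / m * ((\<Sum>n\<in>nats_le (x / m). mangoldt n / real n) - ln (x / m)))"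
    by (simp add: U_def sum_distrib_left sum_subtractf algebra_simps)
  also have "\<bar>\<dots>\<bar> \<le> (\<Sum>m\<in>nats_le x. f m / m * 15)"
  proof (rule order.trans[OF sum_abs], rule sum_mono)
    fix m assume "m \<in> nats_le x"
    hence "x / m \<ge> 1" by (auto simp: nats_le_def)
    from sum_mangoldt_over_n[OF this]
    show "\<bar>f m / m * ((\<Sum>n\<in>nats_le (x / m). mangoldt n / real n) - ln (x / m))\<bar> \<le> f m / m * 15"
      unfolding abs_mult using f_nonneg[of m] by (intro mult_mono) auto
  qed
  finally show ?thesis by (simp add: S_def sum_distrib_left mult_ac)
qed

text \<open>
  Here \<open>S x * ln x - U x = (\<Sum>n\<le>x. f n * ln n / n)\<close>, which the convolution identity evaluates as
  roughly \<open>\<tau> * U x\<close>.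
\<close>
lemma V_minus_U:
  assumes "\<eta> > 0"
  obtains K where "K \<ge> 0" "\<And>x. x \<ge> 1 \<Longrightarrow> \<bar>S x * ln x - (1 + \<tau>) * U x\<bar> \<le> \<eta> * S x * ln x + K * S x"
proof -
  obtain K where K: "K \<ge> 0"
    "\<And>x. x \<ge> 1 \<Longrightarrow> \<bar>(\<Sum>n\<in>nats_le x. lam n / real n) - \<tau> * ln x\<bar> \<le> \<eta> * ln x + K"
    using sum_lam_over_n[OF assms] by blast
  have "\<bar>S x * ln x - (1 + \<tau>) * U x\<bar> \<le> \<eta> * S x * ln x + K * S x" if x: "x \<ge> 1" for x
  proof -
    have "S x * ln x - U x = (\<Sum>k\<in>nats_le x. f k * ln (real k) / real k)"
      using sum_f_ln_over_n[OF x] by simp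
    also have "\<dots> = (\<Sum>k\<in>nats_le x. \<Sum>d | d dvd k. lam d / real d * (f (k div d) / real (k div d)))"
    proof (intro sum.cong refl)
      fix k assume "k \<in> nats_le x"
      hence k: "k > 0" by (simp add: nats_le_def)
      have "f k * ln (real k) / real k = (\<Sum>d | d dvd k. lam d * f (k div d) / real k)"
        using k by (simp add: conv sum_divide_distrib)
      also have "\<dots> = (\<Sum>d | d dvd k. lam d / real d * (f (k div d) / real (k div d)))"
        by (intro sum.cong refl) (auto simp: of_nat_mult [symmetric] simp del: of_nat_mult)
      finally show "f k * ln (real k) / real k = (\<Sum>d | d dvd k. lam d / real d * (f (k div d) / real (k div d)))" .
    qed
    also have "\<dots> = (\<Sum>d\<in>nats_le x. \<Sum>m\<in>nats_le (x / d). lam d / real d * (f m / m))"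
      by (rule sum_nats_le_divisors [symmetric])
    also have "\<dots> = (\<Sum>m\<in>nats_le x. \<Sum>d\<in>nats_le (x / m). lam d / real d * (f m / m))"
      by (rule sum_nats_le_swap)
    finally have "S x * ln x - (1 + \<tau>) * U x =
        (\<Sum>m\<in>nats_le x. \<Sum>d\<in>nats_le (x / m). lam d / real d * (f m / m)) - \<tau> * U x"
      by (simp add: algebra_simps)
    also have "\<dots> = (\<Sum>m\<in>nats_le x. f m / m * ((\<Sum>n\<in>nats_le (x / m). lam n / real n) - \<tau> * ln (x / m)))"
      by (simp add: U_def sum_distrib_left sum_subtractf algebra_simps)
    also have "\<bar>\<dots>\<bar> \<le> (\<Sum>m\<in>nats_le x. f m / m * (\<eta> * ln x + K))"
    proof (rule order.trans[OF sum_abs], rule sum_mono)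
      fix m assume m: "m \<in> nats_le x"
      hence "x / m \<ge> 1" by (auto simp: nats_le_def)
      from K(2)[OF this]
      have "\<bar>(\<Sum>n\<in>nats_le (x / m). lam n / real n) - \<tau> * ln (x / m)\<bar> \<le> \<eta> * ln (x / m) + K" .
      also have "ln (x / m) \<le> ln x" using m x by (auto simp: nats_le_def field_simps)
      finally have "\<bar>(\<Sum>n\<in>nats_le (x / m). lam n / real n) - \<tau> * ln (x / m)\<bar> \<le> \<eta> * ln x + K"
        using assms by simp
      thus "\<bar>f m / m * ((\<Sum>n\<in>nats_le (x / m). lam n / real n) - \<tau> * ln (x / m))\<bar> \<le> f m / m * (\<eta> * ln x + K)"
        unfolding abs_mult using f_nonneg[of m] by (intro mult_mono) auto
    qed
    also have "\<dots> = S x * (\<eta> * ln x + K)" by (simp add: S_def sum_distrib_right)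
    finally show ?thesis by (simp add: algebra_simps)
  qed
  thus ?thesis using that K by blast
qed

text \<open>Selberg's formula at x / m, weighted with f(m). Splitting ln(x / m) into ln x - ln m
  produces \<open>A\<close> and, from the ln m part, \<open>G\<close>.\<close>

lemma Selberg_convolved:
  obtains K where "K \<ge> 0" "\<And>x. x \<ge> 1 \<Longrightarrow>
    \<bar>ln x * A x - (\<Sum>n\<in>nats_le x. mangoldt n * G (x / n)) + (\<Sum>n\<in>nats_le x. mangoldt n * A (x / n))
      - 2 * x * U x\<bar> \<le> K * x * S x"
proof -
  obtain K where K: "\<And>x. x \<ge> 1 \<Longrightarrow>
    \<bar>psi x * ln x + (\<Sum>n\<in>nats_le x. mangoldt n * psi (x / n)) - 2 * x * ln x\<bar> \<le> K * x"
    using Selberg_symmetry by blast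
  define D where "D = (\<lambda>x. psi x * ln x + (\<Sum>n\<in>nats_le x. mangoldt n * psi (x / n)) - 2 * x * ln x)"
  have K0: "K \<ge> 0" using K[of 1] by simp
  have "\<bar>ln x * A x - (\<Sum>n\<in>nats_le x. mangoldt n * G (x / n)) + (\<Sum>n\<in>nats_le x. mangoldt n * A (x / n))
      - 2 * x * U x\<bar> \<le> K * x * S x" if x: "x \<ge> 1" for x
  proof -
    have 1: "(\<Sum>m\<in>nats_le x. f m * ln (real m) * psi (x / m)) = (\<Sum>n\<in>nats_le x. mangoldt n * G (x / n))"
    proof -
      have "(\<Sum>m\<in>nats_le x. f m * ln (real m) * psi (x / m)) =
            (\<Sum>m\<in>nats_le x. \<Sum>n\<in>nats_le (x / m). f m * ln (real m) * mangoldt n)"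
        by (simp add: psi_def sum_distrib_left)
      also have "\<dots> = (\<Sum>n\<in>nats_le x. \<Sum>m\<in>nats_le (x / n). f m * ln (real m) * mangoldt n)"
        by (rule sum_nats_le_swap)
      finally show ?thesis by (simp add: G_def sum_distrib_left mult_ac)
    qed
    have 2: "(\<Sum>m\<in>nats_le x. f m * (psi (x / m) * ln (x / m))) =
        ln x * A x - (\<Sum>n\<in>nats_le x. mangoldt n * G (x / n))"
      unfolding 1 [symmetric] A_def sum_distrib_left sum_subtractf [symmetric]
      using x by (intro sum.cong refl) (auto simp: ln_div nats_le_def algebra_simps)
    have 3: "(\<Sum>m\<in>nats_le x. f m * (\<Sum>n\<in>nats_le (x / m). mangoldt n * psi (x / m / n))) =
        (\<Sum>n\<in>nats_le x. mangoldt n * A (x / n))"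
    proof -
      have "(\<Sum>m\<in>nats_le x. f m * (\<Sum>n\<in>nats_le (x / m). mangoldt n * psi (x / m / n))) =
            (\<Sum>m\<in>nats_le x. \<Sum>n\<in>nats_le (x / m). f m * (mangoldt n * psi (x / m / n)))"
        by (simp add: sum_distrib_left)
      also have "\<dots> = (\<Sum>n\<in>nats_le x. \<Sum>m\<in>nats_le (x / n). f m * (mangoldt n * psi (x / m / n)))"
        by (rule sum_nats_le_swap)
      finally show ?thesis by (simp add: A_def sum_distrib_left mult_ac)
    qed
    have 4: "(\<Sum>m\<in>nats_le x. f m * (2 * (x / m) * ln (x / m))) = 2 * x * U x"
      by (simp add: U_def sum_distrib_left mult_ac)
    have "(\<Sum>m\<in>nats_le x. f m * D (x / m)) = ln x * A x - (\<Sum>n\<in>nats_le x. mangoldt n * G (x / n))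
        + (\<Sum>n\<in>nats_le x. mangoldt n * A (x / n)) - 2 * x * U x"
      unfolding D_def right_diff_distrib distrib_left sum_subtractf sum.distrib 2 3 4 ..
    moreover have "\<bar>\<Sum>m\<in>nats_le x. f m * D (x / m)\<bar> \<le> (\<Sum>m\<in>nats_le x. f m * (K * (x / m)))"
    proof (rule order.trans[OF sum_abs], rule sum_mono)
      fix m assume m: "m \<in> nats_le x"
      hence "x / m \<ge> 1" by (auto simp: nats_le_def)
      from K[OF this] show "\<bar>f m * D (x / m)\<bar> \<le> f m * (K * (x / m))"
        unfolding abs_mult D_def using f_nonneg[of m] by (intro mult_mono) auto
    qed
    moreover have "(\<Sum>m\<in>nats_le x. f m * (K * (x / m))) = K * x * S x"
      by (simp add: S_def sum_distrib_left mult_ac)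
    ultimately show ?thesis by simp
  qed
  thus ?thesis using that K0 by blast
qed

text \<open>Averaging against \<open>mangoldt\<close> multiplies a bound of size x * S(x) by at most
  ln x to leading order. This is what lets a pointwise bound on \<open>R\<close> be fed back into
  the recursion without loss.\<close>

lemma sum_mangoldt_le:
  assumes x: "x \<ge> 1" and "\<beta> \<ge> 0" "K \<ge> 0"
    and bnd: "\<And>y. y \<ge> 1 \<Longrightarrow> \<bar>h y\<bar> \<le> \<beta> * y * S y + K * y"
  shows "(\<Sum>n\<in>nats_le x. mangoldt n * \<bar>h (x / n)\<bar>) \<le> \<beta> * x * S x * ln x + 15 * \<beta> * x * S x + K * x * ln x + 15 * K * x"
proof -
  have "(\<Sum>n\<in>nats_le x. mangoldt n * \<bar>h (x / n)\<bar>) \<le>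
        (\<Sum>n\<in>nats_le x. mangoldt n * (\<beta> * (x / n) * S (x / n) + K * (x / n)))"
    by (intro sum_mono mult_left_mono mangoldt_nonneg bnd) (auto simp: nats_le_def)
  also have "\<dots> = \<beta> * x * (\<Sum>n\<in>nats_le x. mangoldt n / real n * S (x / n)) + K * x * (\<Sum>n\<in>nats_le x. mangoldt n / real n)"
    by (simp add: sum_distrib_left sum.distrib algebra_simps)
  also have "\<dots> \<le> \<beta> * x * (S x * ln x + 15 * S x) + K * x * (ln x + 15)"
  proof (intro add_mono mult_left_mono)
    show "(\<Sum>n\<in>nats_le x. mangoldt n / real n * S (x / n)) \<le> S x * ln x + 15 * S x"
      using sum_mangoldt_S[OF x] U_le[OF x] by linarith
    show "(\<Sum>n\<in>nats_le x. mangoldt n / real n) \<le> ln x + 15"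
      using sum_mangoldt_over_n[OF x] by linarith
  qed (use assms in auto)
  finally show ?thesis by (simp add: algebra_simps)
qed

text \<open>Replacing \<open>G\<close> by \<tau> * \<open>A\<close> in the convolved Selberg formula
  leaves ln x * A(x) + (1 - \<tau>) * (average of A) \<approx> 2 * x * U(x). Subtracting the main
  terms x * S from both \<open>A\<close>s removes (1 + \<tau>) * x * U(x) and (1 - \<tau>) * x *
  U(x), which exhausts the right side, so the same relation holds for \<open>R\<close> with 0 on the
  right.\<close>

lemma R_recursion:
  assumes "\<eta> > 0"
  obtains K where "K \<ge> 0" "\<And>x. x \<ge> 1 \<Longrightarrow>
    \<bar>R x\<bar> * ln x \<le> (1 - \<tau>) * (\<Sum>n\<in>nats_le x. mangoldt n * \<bar>R (x / n)\<bar>)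
      + 2 * \<eta> * x * S x * ln x + K * (x * S x + x * ln x + x)"
proof -
  obtain K1 where K1: "K1 \<ge> 0" "\<And>x. x \<ge> 1 \<Longrightarrow>
    \<bar>ln x * A x - (\<Sum>n\<in>nats_le x. mangoldt n * G (x / n)) + (\<Sum>n\<in>nats_le x. mangoldt n * A (x / n))
      - 2 * x * U x\<bar> \<le> K1 * x * S x" using Selberg_convolved by blast
  obtain K2 where K2: "K2 \<ge> 0" "\<And>x. x \<ge> 1 \<Longrightarrow> \<bar>G x - \<tau> * A x\<bar> \<le> \<eta> * x * S x + K2 * x"
    using G_minus_A[OF assms] by blast
  obtain K3 where K3: "K3 \<ge> 0" "\<And>x. x \<ge> 1 \<Longrightarrow> \<bar>S x * ln x - (1 + \<tau>) * U x\<bar> \<le> \<eta> * S x * ln x + K3 * S x"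
    using V_minus_U[OF assms] by blast
  define K where "K = K1 + 15 * \<eta> + 15 * K2 + K3 + 15"
  show ?thesis
  proof (rule that[of K])
    show "K \<ge> 0" using K1 K2 K3 assms by (simp add: K_def)
  next
    fix x :: real assume x: "x \<ge> 1"
    define a where "a = ln x * A x - (\<Sum>n\<in>nats_le x. mangoldt n * G (x / n)) + (\<Sum>n\<in>nats_le x. mangoldt n * A (x / n))
      - 2 * x * U x"
    define b where "b = (\<Sum>n\<in>nats_le x. mangoldt n * (G (x / n) - \<tau> * A (x / n)))"
    define c where "c = S x * ln x - (1 + \<tau>) * U x"
    define W where "W = (\<Sum>n\<in>nats_le x. mangoldt n / real n * S (x / n))"
    define d where "d = W - U x"
    define r where "r = (\<Sum>n\<in>nats_le x. mangoldt n * R (x / n))"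
    have S0: "S x \<ge> 0" "ln x \<ge> 0" using S_nonneg x by auto
    have a: "\<bar>a\<bar> \<le> K1 * x * S x" unfolding a_def using K1(2)[OF x] .
    have b: "\<bar>b\<bar> \<le> \<eta> * x * S x * ln x + 15 * \<eta> * x * S x + K2 * x * ln x + 15 * K2 * x"
    proof -
      have "\<bar>b\<bar> \<le> (\<Sum>n\<in>nats_le x. mangoldt n * \<bar>G (x / n) - \<tau> * A (x / n)\<bar>)"
        unfolding b_def by (rule order.trans[OF sum_abs]) (simp add: abs_mult)
      thus ?thesis
        using sum_mangoldt_le[of x \<eta> K2 "\<lambda>y. G y - \<tau> * A y"] x assms K2 by force
    qed
    have c: "\<bar>x * c\<bar> \<le> \<eta> * x * S x * ln x + K3 * x * S x"
    proof -
      have "\<bar>x * c\<bar> = x * \<bar>c\<bar>" using x by (simp add: abs_mult)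
      also have "\<dots> \<le> x * (\<eta> * S x * ln x + K3 * S x)"
        unfolding c_def using x by (intro mult_left_mono K3) auto
      finally show ?thesis by (simp add: algebra_simps)
    qed
    have d: "\<bar>(1 - \<tau>) * x * d\<bar> \<le> 15 * x * S x"
    proof -
      have "\<bar>(1 - \<tau>) * x * d\<bar> \<le> 1 * x * (15 * S x)"
        unfolding abs_mult using sum_mangoldt_S[OF x] x tau
        by (intro mult_mono) (auto simp: d_def W_def)
      thus ?thesis by simp
    qed
    have r_eq: "r = (\<Sum>n\<in>nats_le x. mangoldt n * A (x / n)) - x * W"
      by (simp add: r_def R_def W_def sum_distrib_left sum_subtractf algebra_simps)
    have b_eq: "b = (\<Sum>n\<in>nats_le x. mangoldt n * G (x / n)) - \<tau> * (\<Sum>n\<in>nats_le x. mangoldt n * A (x / n))"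
      by (simp add: b_def sum_distrib_left sum_subtractf algebra_simps)
    \<comment> \<open>An exact identity: a, b, c and d are the errors of the four approximations,
      and r carries the recursion.\<close>
    have "R x * ln x = a + b - x * c - (1 - \<tau>) * x * d - (1 - \<tau>) * r"
      unfolding r_eq b_eq a_def c_def d_def R_def by (simp add: algebra_simps)
    hence "\<bar>R x * ln x\<bar> \<le> \<bar>a\<bar> + \<bar>b\<bar> + \<bar>x * c\<bar> + \<bar>(1 - \<tau>) * x * d\<bar> + \<bar>(1 - \<tau>) * r\<bar>"
      by linarith
    moreover have "\<bar>(1 - \<tau>) * r\<bar> \<le> (1 - \<tau>) * (\<Sum>n\<in>nats_le x. mangoldt n * \<bar>R (x / n)\<bar>)"
    proof -
      have "\<bar>r\<bar> \<le> (\<Sum>n\<in>nats_le x. mangoldt n * \<bar>R (x / n)\<bar>)"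
        unfolding r_def by (rule order.trans[OF sum_abs]) (simp add: abs_mult)
      thus ?thesis using tau by (simp add: abs_mult mult_left_mono)
    qed
    ultimately have "\<bar>R x\<bar> * ln x \<le> (1 - \<tau>) * (\<Sum>n\<in>nats_le x. mangoldt n * \<bar>R (x / n)\<bar>)
      + 2 * \<eta> * x * S x * ln x + ((K1 + 15 * \<eta> + K3 + 15) * (x * S x) + K2 * (x * ln x) + 15 * K2 * x)"
      using a b c d x by (simp add: abs_mult algebra_simps)
    moreover have "(K1 + 15 * \<eta> + K3 + 15) * (x * S x) \<le> K * (x * S x)" "K2 * (x * ln x) \<le> K * (x * ln x)"
         "15 * K2 * x \<le> K * x"
      using K1(1) K2(1) K3(1) assms x S0 by (auto intro!: mult_right_mono simp: K_def)
    ultimately show "\<bar>R x\<bar> * ln x \<le> (1 - \<tau>) * (\<Sum>n\<in>nats_le x. mangoldt n * \<bar>R (x / n)\<bar>)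
      + 2 * \<eta> * x * S x * ln x + K * (x * S x + x * ln x + x)"
      by (simp add: algebra_simps)
  qed
qed

lemma A_bound: "x \<ge> 0 \<Longrightarrow> A x \<le> 14 * x * S x"
proof -
  assume x: "x \<ge> 0"
  have "A x \<le> (\<Sum>n\<in>nats_le x. f n * (14 * (x / n)))"
    unfolding A_def using x by (intro sum_mono mult_left_mono psi_le f_nonneg) auto
  thus ?thesis by (simp add: S_def sum_distrib_left mult_ac)
qed

lemma R_bound: 
  assumes "x \<ge> 0"
  shows "\<bar>R x\<bar> \<le> 15 * x * S x"
proof -
  have "A x \<ge> 0" unfolding A_def by (intro sum_nonneg mult_nonneg_nonneg f_nonneg psi_nonneg)
  moreover have "x * S x \<ge> 0" using assms S_nonneg by simp
  ultimately show ?thesis using A_bound[OF assms] by (simp add: R_def abs_le_iff)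
qed

text \<open>One pass through the recursion improves the leading constant by a factor below 1 that
  does not depend on \<beta>; the price is a new additive constant.\<close>

lemma R_contraction:
  assumes bnd: "\<And>x. x \<ge> 1 \<Longrightarrow> \<bar>R x\<bar> \<le> \<beta> * x * S x + K * x" and "\<beta> > 0" "K \<ge> 0"
  obtains K' where "K' \<ge> 0" "\<And>x. x \<ge> 1 \<Longrightarrow> \<bar>R x\<bar> \<le> (1 - \<tau> / 2) * \<beta> * x * S x + K' * x"
proof -
  \<comment> \<open>The recursion contributes 2 * \<eta>, and the three lower-order terms are made
    at most \<eta> / 3 each. Altogether this is 3 * \<eta> = \<tau> * \<beta> / 2, half of what the
    factor 1 - \<tau> gains.\<close>
  define \<eta> where "\<eta> = \<tau> * \<beta> / 6"
  have \<eta>: "\<eta> > 0" using tau assms by (simp add: \<eta>_def)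
  obtain K1 where K1: "K1 \<ge> 0" "\<And>x. x \<ge> 1 \<Longrightarrow>
    \<bar>R x\<bar> * ln x \<le> (1 - \<tau>) * (\<Sum>n\<in>nats_le x. mangoldt n * \<bar>R (x / n)\<bar>)
      + 2 * \<eta> * x * S x * ln x + K1 * (x * S x + x * ln x + x)"
    using R_recursion[OF \<eta>] by blast
  define K2 where "K2 = K1 + 15 * \<beta> + 15 * K"
  have K2: "K2 \<ge> 0" using K1 assms by (simp add: K2_def)
  have rec: "\<bar>R x\<bar> * ln x \<le> (1 - \<tau>) * \<beta> * (x * S x * ln x) + 2 * \<eta> * (x * S x * ln x) + K2 * (x * S x + x * ln x + x)"
    if x: "x \<ge> 1" for x
  proof -
    define Z where "Z = 15 * \<beta> * x * S x + K * x * ln x + 15 * K * x"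
    have Z: "Z \<le> (15 * \<beta> + 15 * K) * (x * S x + x * ln x + x)" "Z \<ge> 0"
    proof -
      have "15 * \<beta> * (x * S x) \<le> (15 * \<beta> + 15 * K) * (x * S x)" "K * (x * ln x) \<le> (15 * \<beta> + 15 * K) * (x * ln x)"
        "15 * K * x \<le> (15 * \<beta> + 15 * K) * x"
        by (intro mult_right_mono; use x S_nonneg assms in simp)+
      thus "Z \<le> (15 * \<beta> + 15 * K) * (x * S x + x * ln x + x)" by (simp add: Z_def algebra_simps)
      show "Z \<ge> 0" unfolding Z_def using x S_nonneg assms by simp
    qed
    have "(1 - \<tau>) * (\<Sum>n\<in>nats_le x. mangoldt n * \<bar>R (x / n)\<bar>) \<le> (1 - \<tau>) * (\<beta> * x * S x * ln x + Z)"
      using sum_mangoldt_le[OF x _ _ bnd] assms tau by (intro mult_left_mono) (auto simp: Z_def add_ac)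
    also have "\<dots> = (1 - \<tau>) * \<beta> * (x * S x * ln x) + (1 - \<tau>) * Z" by (simp add: algebra_simps)
    also have "(1 - \<tau>) * Z \<le> 1 * Z" using Z tau by (intro mult_right_mono) auto
    finally show ?thesis using K1(2)[OF x] Z by (simp add: K2_def algebra_simps)
  qed
  have "eventually (\<lambda>x. S x \<ge> 3 * K2 / \<eta> + 1) at_top"
    using log_sum_at_top unfolding filterlim_at_top S_def by blast
  moreover have "eventually (\<lambda>x::real. ln x \<ge> 3 * K2 / \<eta> + 1) at_top"
    using ln_at_top unfolding filterlim_at_top by blast
  ultimately have "eventually (\<lambda>x. \<bar>R x\<bar> \<le> (1 - \<tau> / 2) * \<beta> * x * S x) at_top"
    using eventually_ge_at_top[of 1]
  proof eventually_elim
    case (elim x)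
    have l: "ln x \<ge> 1" "S x \<ge> 1" using elim K2 \<eta>
      by (smt (verit, best) divide_nonneg_nonneg)+
    have 1: "3 * K2 \<le> \<eta> * ln x" "3 * K2 \<le> \<eta> * S x"
      using elim \<eta> by (simp_all add: field_simps)
    have "3 * K2 * (x * S x) \<le> \<eta> * ln x * (x * S x)" using 1 elim l by (intro mult_right_mono) auto
    moreover have "3 * K2 * (x * ln x) \<le> \<eta> * S x * (x * ln x)" using 1 elim l by (intro mult_right_mono) auto
    moreover have "3 * K2 * (x * 1) \<le> \<eta> * S x * (x * ln x)"
      by (rule mult_mono[OF 1(2) mult_left_mono[OF l(1)]]) (use elim l \<eta> in auto)
    ultimately have "\<bar>R x\<bar> * ln x \<le> (1 - \<tau>) * \<beta> * (x * S x * ln x) + 3 * \<eta> * (x * S x * ln x)"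
      using rec[OF elim(3)] by (simp add: algebra_simps)
    also have "\<dots> = ((1 - \<tau> / 2) * \<beta> * x * S x) * ln x" by (simp add: \<eta>_def field_simps)
    finally show ?case using l by simp
  qed
  then obtain X where X: "\<And>x. x \<ge> X \<Longrightarrow> \<bar>R x\<bar> \<le> (1 - \<tau> / 2) * \<beta> * x * S x"
    unfolding eventually_at_top_linorder by blast
  have pos: "(1 - \<tau> / 2) * \<beta> * x * S x \<ge> 0" if "x \<ge> 1" for x
    using that S_nonneg assms tau by simp
  \<comment> \<open>Below the threshold X the trivial bound and the monotonicity of \<open>S\<close>
    give an error linear in x, so the bound again holds for all x \<ge> 1 and can be
    iterated.\<close>
  have "\<bar>R x\<bar> \<le> (1 - \<tau> / 2) * \<beta> * x * S x + 15 * S X * x" if x: "x \<ge> 1" for x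
  proof (cases "x \<ge> X")
    case True
    have "15 * S X * x \<ge> 0" using x S_nonneg by simp
    with X[OF True] show ?thesis by linarith
  next
    case False
    have "\<bar>R x\<bar> \<le> 15 * x * S x" using x by (intro R_bound) auto
    also have "\<dots> \<le> 15 * x * S X" using x False by (intro mult_left_mono S_mono) auto
    finally show ?thesis using pos[OF x] by (simp add: mult_ac)
  qed
  thus ?thesis using that[of "15 * S X"] S_nonneg by simp
qed

text \<open>The additive constant K depends on the number j of iterations, but j is fixed before x
  grows, and K * x is negligible against x * S(x).\<close>

lemma R_tendsto_0: "((\<lambda>x. R x / (x * S x)) \<longlongrightarrow> 0) at_top"
proof -
  have bnd: "\<exists>K\<ge>0. \<forall>x\<ge>1. \<bar>R x\<bar> \<le> ((1 - \<tau> / 2) ^ j * 15) * x * S x + K * x" for j :: nat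
  proof (induction j)
    case 0
    thus ?case using R_bound by (intro exI[of _ 0]) auto
  next
    case (Suc j)
    then obtain K where K: "K \<ge> 0" "\<And>x. x \<ge> 1 \<Longrightarrow> \<bar>R x\<bar> \<le> ((1 - \<tau> / 2) ^ j * 15) * x * S x + K * x" by blast
    have "(1 - \<tau> / 2) ^ j * 15 > 0" using tau by simp
    from R_contraction[OF K(2) this K(1)] show ?case by (auto simp: mult_ac)
  qed
  show ?thesis
    unfolding tendsto_iff dist_real_def
  proof safe
    fix \<epsilon> :: real assume \<epsilon>: "\<epsilon> > 0"
    obtain j where j: "(1 - \<tau> / 2) ^ j < \<epsilon> / 30"
      using real_arch_pow_inv[of "\<epsilon> / 30" "1 - \<tau> / 2"] \<epsilon> tau by auto
    obtain K where K: "K \<ge> 0" "\<And>x. x \<ge> 1 \<Longrightarrow> \<bar>R x\<bar> \<le> ((1 - \<tau> / 2) ^ j * 15) * x * S x + K * x"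
      using bnd by blast
    have "eventually (\<lambda>x. S x \<ge> 2 * K / \<epsilon> + 1) at_top"
      using log_sum_at_top unfolding filterlim_at_top S_def by blast
    thus "eventually (\<lambda>x. \<bar>R x / (x * S x) - 0\<bar> < \<epsilon>) at_top"
      using eventually_ge_at_top[of 1]
    proof eventually_elim
      case (elim x)
      have S: "S x \<ge> 1" using elim K \<epsilon> by (smt (verit, best) divide_nonneg_nonneg)
      have "2 * K < \<epsilon> * S x" using elim \<epsilon> by (simp add: field_simps)
      hence "K * x < \<epsilon> / 2 * S x * x" using elim by (intro mult_strict_right_mono) auto
      moreover have "((1 - \<tau> / 2) ^ j * 15) * (x * S x) \<le> (\<epsilon> / 2) * (x * S x)"
        using j elim S by (intro mult_right_mono) auto
      ultimately have "\<bar>R x\<bar> < \<epsilon> * (x * S x)" using K(2)[OF elim(2)] by (simp add: algebra_simps)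
      thus ?case using elim S by (simp add: abs_divide abs_mult field_simps)
    qed
  qed
qed

theorem sum_f_ln_asymp: "((\<lambda>x. (\<Sum>n\<in>nats_le x. f n * ln (real n)) / (x * S x)) \<longlongrightarrow> \<tau>) at_top"
proof -
  have "((\<lambda>x. G x / (x * S x) - \<tau> * (1 + R x / (x * S x))) \<longlongrightarrow> 0) at_top"
    unfolding tendsto_iff dist_real_def
  proof safe
    fix \<epsilon> :: real assume \<epsilon>: "\<epsilon> > 0"
    obtain K where K: "K \<ge> 0" "\<And>x. x \<ge> 1 \<Longrightarrow> \<bar>G x - \<tau> * A x\<bar> \<le> \<epsilon> / 2 * x * S x + K * x"
      using G_minus_A[of "\<epsilon> / 2"] \<epsilon> by auto
    have "eventually (\<lambda>x. S x \<ge> 2 * K / \<epsilon> + 1) at_top"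
      using log_sum_at_top unfolding filterlim_at_top S_def by blast
    thus "eventually (\<lambda>x. \<bar>G x / (x * S x) - \<tau> * (1 + R x / (x * S x)) - 0\<bar> < \<epsilon>) at_top"
      using eventually_ge_at_top[of 1]
    proof eventually_elim
      case (elim x)
      have S: "S x \<ge> 1" using elim K \<epsilon> by (smt (verit, best) divide_nonneg_nonneg)
      have "2 * K < \<epsilon> * S x" using elim \<epsilon> by (simp add: field_simps)
      hence "K * x < \<epsilon> / 2 * S x * x" using elim by (intro mult_strict_right_mono) auto
      hence "\<bar>G x - \<tau> * A x\<bar> < \<epsilon> * (x * S x)" using K(2)[OF elim(2)] by (simp add: algebra_simps)
      moreover have "G x / (x * S x) - \<tau> * (1 + R x / (x * S x)) = (G x - \<tau> * A x) / (x * S x)"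
        using S elim by (simp add: R_def field_simps)
      ultimately show ?case using elim S by (simp add: abs_divide abs_mult pos_divide_less_eq)
    qed
  qed
  moreover have "((\<lambda>x. \<tau> * (1 + R x / (x * S x))) \<longlongrightarrow> \<tau> * (1 + 0)) at_top"
    by (intro tendsto_intros R_tendsto_0)
  ultimately have "((\<lambda>x. G x / (x * S x) - \<tau> * (1 + R x / (x * S x)) + \<tau> * (1 + R x / (x * S x))) \<longlongrightarrow> 0 + \<tau> * (1 + 0)) at_top"
    by (rule tendsto_add)
  thus ?thesis by (simp add: G_def)
qed

end

section \<open>Karamata's Tauberian theorem\<close>

lemma Gamma_integral_scaled:
  fixes \<tau> k :: real
  assumes "\<tau> > 0" "k > 0"
  shows "((\<lambda>t. t powr (\<tau> - 1) * exp (- (k * t))) has_integral Gamma \<tau> * k powr (-\<tau>)) {0..}"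
proof -
  define f where "f = (\<lambda>t::real. t powr (\<tau> - 1) / exp t)"
  have f: "(f has_integral Gamma \<tau>) {0..}"
    unfolding f_def by (rule Gamma_integral_real) fact
  have "(\<lambda>t. k * t) ` {0..} = {0..}"
  proof (intro equalityI subsetI)
    fix x :: real assume "x \<in> {0..}"
    thus "x \<in> (\<lambda>t. k * t) ` {0..}"
      using assms by (intro image_eqI[of _ _ "x / k"]) auto
  qed (use assms in auto)
  moreover have "f absolutely_integrable_on {0..}"
    using f by (intro nonnegative_absolutely_integrable_1) (auto simp: f_def has_integral_iff)
  ultimately have "(\<lambda>t. \<bar>k\<bar> * f (k * t)) absolutely_integrable_on {0..} \<and>
         integral {0..} (\<lambda>t. \<bar>k\<bar> * f (k * t)) = Gamma \<tau>"
    using f assms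
    by (subst has_absolute_integral_change_of_variables_1'[where g' = "\<lambda>_. k"])
       (auto intro!: derivative_eq_intros inj_onI simp: has_integral_iff)
  hence "((\<lambda>t. k * f (k * t)) has_integral Gamma \<tau>) {0..}"
    using assms by (auto simp: has_integral_iff set_lebesgue_integral_eq_integral)
  hence "((\<lambda>t. k powr (-\<tau>) * (k * f (k * t))) has_integral k powr (-\<tau>) * Gamma \<tau>) {0..}"
    by (rule has_integral_mult_right)
  also have "?this \<longleftrightarrow> ((\<lambda>t. t powr (\<tau> - 1) * exp (- (k * t))) has_integral k powr (-\<tau>) * Gamma \<tau>) {0..}"
  proof (rule has_integral_cong)
    fix t :: real assume t: "t \<in> {0..}"
    have "k powr (-\<tau>) * k * k powr (\<tau> - 1) = k powr (-\<tau> + 1 + (\<tau> - 1))"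
      using assms by (simp only: powr_add powr_one)
    also have "\<dots> = 1" using assms by simp
    finally have 1: "k powr (-\<tau>) * k * k powr (\<tau> - 1) = 1" .
    have "k powr (-\<tau>) * (k * f (k * t)) = (k powr (-\<tau>) * k * k powr (\<tau> - 1)) * (t powr (\<tau> - 1) * exp (- (k * t)))"
      using t assms by (simp add: f_def powr_mult exp_minus field_simps)
    thus "k powr (-\<tau>) * (k * f (k * t)) = t powr (\<tau> - 1) * exp (- (k * t))" by (simp add: 1)
  qed
  finally show ?thesis by (simp add: mult.commute)
qed

lemma powr_integral_restricted:
  fixes \<tau> b :: real
  assumes "\<tau> > 0" "b \<ge> 0"
  shows "((\<lambda>t. if t \<le> b then t powr (\<tau> - 1) else 0) has_integral b powr \<tau> / \<tau>) {0..}"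
proof -
  have "((\<lambda>t. t powr (\<tau> - 1)) has_integral b powr (\<tau> - 1 + 1) / (\<tau> - 1 + 1)) {0..b}"
    using assms by (intro has_integral_powr_from_0) auto
  hence "((\<lambda>t. if t \<in> {0..b} then t powr (\<tau> - 1) else 0) has_integral b powr \<tau> / \<tau>) {0..}"
    by (subst has_integral_restrict) auto
  thus ?thesis by (rule has_integral_eq[rotated]) auto
qed

text \<open>Karamata's test function, 1 / y cut off at a point, is discontinuous there. A continuous
  function fits between the cutoffs at v and at u, and polynomials approximate that function
  uniformly.\<close>

lemma polynomial_sandwich:
  fixes u v \<epsilon> :: real
  assumes uv: "0 < u" "u < v" and \<epsilon>: "\<epsilon> > 0"
  obtains b :: "nat \<Rightarrow> real" and N :: nat and b' :: "nat \<Rightarrow> real" and N' :: nat where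
    "\<And>y. y \<in> {0..1} \<Longrightarrow> (if v \<le> y then 1 / y else 0) \<le> (\<Sum>i\<le>N. b i * y ^ i)"
    "\<And>y. y \<in> {0..1} \<Longrightarrow> (\<Sum>i\<le>N. b i * y ^ i) \<le> (if u \<le> y then 1 / y else 0) + \<epsilon>"
    "\<And>y. y \<in> {0..1} \<Longrightarrow> (if v \<le> y then 1 / y else 0) - \<epsilon> \<le> (\<Sum>i\<le>N'. b' i * y ^ i)"
    "\<And>y. y \<in> {0..1} \<Longrightarrow> (\<Sum>i\<le>N'. b' i * y ^ i) \<le> (if u \<le> y then 1 / y else 0)"
proof -
  \<comment> \<open>A linear ramp from 0 at u to 1 at v, divided by y; the denominator
    \<open>max y u\<close> avoids the pole without changing values at y \<ge> u. Shifting by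
    \<epsilon> / 2 up or down makes the approximation one-sided.\<close>
  define \<phi> where "\<phi> = (\<lambda>y::real. max 0 (min 1 ((y - u) / (v - u))) / max y u)"
  have cont: "continuous_on {0..1} \<phi>"
    unfolding \<phi>_def using uv by (intro continuous_intros) (auto simp: max_def)
  have lo: "(if v \<le> y then 1 / y else 0) \<le> \<phi> y" if "y \<ge> 0" for y
    using that uv by (auto simp: \<phi>_def max_def min_def field_simps)
  have hi: "\<phi> y \<le> (if u \<le> y then 1 / y else 0)" if "y \<ge> 0" for y
    using that uv by (auto simp: \<phi>_def max_def min_def field_simps)
  have app: "\<exists>(b :: nat \<Rightarrow> real) N. \<forall>y\<in>{0..1}. \<bar>\<phi> y + s - (\<Sum>i\<le>N. b i * y ^ i)\<bar> < \<epsilon> / 2" for s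
  proof -
    have c: "continuous_on {0..1} (\<lambda>y. \<phi> y + s)" by (intro continuous_intros cont)
    obtain g where g: "real_polynomial_function g" "\<And>y. y \<in> {0..1} \<Longrightarrow> \<bar>(\<phi> y + s) - g y\<bar> < \<epsilon> / 2"
      by (rule Stone_Weierstrass_real_polynomial_function[OF compact_Icc c, of "\<epsilon> / 2"]) (use \<epsilon> in auto)
    then obtain b N where "g = (\<lambda>x. \<Sum>i\<le>N. b i * x ^ i)"
      unfolding real_polynomial_function_iff_sum by (elim exE) (rule that)
    with g(2) show ?thesis by blast
  qed
  obtain b N where b: "\<forall>y\<in>{0..1}. \<bar>\<phi> y + \<epsilon> / 2 - (\<Sum>i\<le>N. b i * y ^ i)\<bar> < \<epsilon> / 2"
    using app[of "\<epsilon> / 2"] by blast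
  obtain b' N' where b': "\<forall>y\<in>{0..1}. \<bar>\<phi> y + (- \<epsilon> / 2) - (\<Sum>i\<le>N'. b' i * y ^ i)\<bar> < \<epsilon> / 2"
    using app[of "- \<epsilon> / 2"] by blast
  show ?thesis
  proof (rule that[of b N b' N'])
    fix y :: real assume y: "y \<in> {0..1}"
    hence "y \<ge> 0" by simp
    note * = lo[OF this] hi[OF this] b[rule_format, OF y] b'[rule_format, OF y]
    show "(if v \<le> y then 1 / y else 0) \<le> (\<Sum>i\<le>N. b i * y ^ i)" using * by linarith
    show "(\<Sum>i\<le>N. b i * y ^ i) \<le> (if u \<le> y then 1 / y else 0) + \<epsilon>" using * by linarith
    show "(if v \<le> y then 1 / y else 0) - \<epsilon> \<le> (\<Sum>i\<le>N'. b' i * y ^ i)" using * by linarith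
    show "(\<Sum>i\<le>N'. b' i * y ^ i) \<le> (if u \<le> y then 1 / y else 0)" using * by linarith
  qed
qed

text \<open>The Laplace-transform setting with mass \<open>c n\<close> at the point ln n. No
  condition on \<open>c 0\<close> is needed because \<open>0 powr x = 0\<close> removes that term
  from the series.\<close>

locale karamata =
  fixes c :: "nat \<Rightarrow> real" and \<tau> a :: real
  assumes c_nonneg: "c n \<ge> 0" and tau_pos: "\<tau> > 0"
    and summable_dirichlet: "\<delta> > 0 \<Longrightarrow> summable (\<lambda>n. c n * real n powr (-\<delta>))"
    and dirichlet_asymp: "((\<lambda>\<delta>. \<delta> powr \<tau> * (\<Sum>n. c n * real n powr (-\<delta>))) \<longlongrightarrow> a) (at_right 0)"
begin

lemma powr_neg_in_unit: "\<delta> > 0 \<Longrightarrow> real n powr (-\<delta>) \<in> {0..1}"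
  by (cases "n = 0") (auto simp: powr_minus inverse_le_1_iff intro!: ge_one_powr_ge_zero)

lemma poly_expand:
  assumes "\<delta> > 0"
  shows "c n * real n powr (-\<delta>) * (\<Sum>i\<le>N. b i * (real n powr (-\<delta>)) ^ i) =
         (\<Sum>i\<le>N. b i * (c n * real n powr (-(real (Suc i) * \<delta>))))"
proof (cases "n = 0")
  case False
  have "real n powr (-\<delta>) * (real n powr (-\<delta>)) ^ i = real n powr (-(real (Suc i) * \<delta>))" for i
  proof -
    have "(real n powr (-\<delta>)) ^ i = real n powr (-\<delta> * real i)"
      using False by (simp add: powr_realpow [symmetric] powr_powr)
    thus ?thesis using False by (simp add: powr_add [symmetric] algebra_simps)
  qed
  thus ?thesis unfolding sum_distrib_left
    by (intro sum.cong refl) (metis (no_types, opaque_lifting) mult.assoc mult.left_commute)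
qed simp

text \<open>With y = n powr -\<delta>, the monomial y^i turns the series at \<delta> into the series
  at (i+1) * \<delta>, whose asymptotics are known. Linearity then gives the limit for every
  polynomial.\<close>

lemma poly_functional:
  defines "L \<equiv> (\<lambda>(b :: nat \<Rightarrow> real) N \<delta>. \<delta> powr \<tau> * (\<Sum>n. c n * real n powr (-\<delta>) * (\<Sum>i\<le>N. b i * (real n powr (-\<delta>)) ^ i)))"
  shows "\<delta> > 0 \<Longrightarrow> summable (\<lambda>n. c n * real n powr (-\<delta>) * (\<Sum>i\<le>N. b i * (real n powr (-\<delta>)) ^ i))"
    and "(L b N \<longlongrightarrow> (\<Sum>i\<le>N. b i * (a * real (Suc i) powr (-\<tau>)))) (at_right 0)"
proof -
  have summ: "summable (\<lambda>n. b i * (c n * real n powr (-(real (Suc i) * \<delta>))))" if "\<delta> > 0" for i \<delta>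
    using that by (intro summable_mult summable_dirichlet) auto
  show "summable (\<lambda>n. c n * real n powr (-\<delta>) * (\<Sum>i\<le>N. b i * (real n powr (-\<delta>)) ^ i))" if "\<delta> > 0" for \<delta>
    using that by (simp only: poly_expand) (intro summable_sum summ)
  have tm: "((\<lambda>\<delta>. b i * (real (Suc i) powr (-\<tau>) * ((real (Suc i) * \<delta>) powr \<tau> *
                (\<Sum>n. c n * real n powr (-(real (Suc i) * \<delta>)))))) \<longlongrightarrow> b i * (real (Suc i) powr (-\<tau>) * a)) (at_right 0)" for i
  proof (intro tendsto_intros)
    have "filterlim (\<lambda>\<delta>. real (Suc i) * \<delta>) (at_right 0) (at_right 0)"
      unfolding filterlim_at
      by (auto intro!: tendsto_eq_intros eventually_at_rightI[of 0 1])
    from filterlim_compose[OF dirichlet_asymp this]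
    show "((\<lambda>\<delta>. (real (Suc i) * \<delta>) powr \<tau> * (\<Sum>n. c n * real n powr (-(real (Suc i) * \<delta>)))) \<longlongrightarrow> a) (at_right 0)" .
  qed
  have "((\<lambda>\<delta>. \<Sum>i\<le>N. b i * (real (Suc i) powr (-\<tau>) * ((real (Suc i) * \<delta>) powr \<tau> *
                (\<Sum>n. c n * real n powr (-(real (Suc i) * \<delta>)))))) \<longlongrightarrow> (\<Sum>i\<le>N. b i * (real (Suc i) powr (-\<tau>) * a))) (at_right 0)"
    by (intro tendsto_sum tm)
  moreover have "eventually (\<lambda>\<delta>. (\<Sum>i\<le>N. b i * (real (Suc i) powr (-\<tau>) * ((real (Suc i) * \<delta>) powr \<tau> *
                (\<Sum>n. c n * real n powr (-(real (Suc i) * \<delta>)))))) = L b N \<delta>) (at_right 0)"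
    using eventually_at_right_less[of 0]
  proof eventually_elim
    case (elim \<delta>)
    have "L b N \<delta> = \<delta> powr \<tau> * (\<Sum>i\<le>N. \<Sum>n. b i * (c n * real n powr (-(real (Suc i) * \<delta>))))"
      unfolding L_def poly_expand[OF elim] by (subst suminf_sum) (use summ elim in auto)
    also have "\<dots> = (\<Sum>i\<le>N. b i * (\<delta> powr \<tau> * (\<Sum>n. c n * real n powr (-(real (Suc i) * \<delta>)))))"
      unfolding sum_distrib_left using elim
      by (intro sum.cong refl) (subst suminf_mult, auto intro!: summable_dirichlet mult_pos_pos simp del: of_nat_Suc)
    also have "\<dots> = (\<Sum>i\<le>N. b i * (real (Suc i) powr (-\<tau>) * ((real (Suc i) * \<delta>) powr \<tau> *
                (\<Sum>n. c n * real n powr (-(real (Suc i) * \<delta>))))))"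
      using elim by (intro sum.cong refl) (simp add: powr_mult powr_minus field_simps del: of_nat_Suc)
    finally show ?case ..
  qed
  ultimately show "(L b N \<longlongrightarrow> (\<Sum>i\<le>N. b i * (a * real (Suc i) powr (-\<tau>)))) (at_right 0)"
    by (simp only: filterlim_cong[OF refl refl] mult.commute[of a])
qed

lemma a_nonneg: "a \<ge> 0"
proof (rule tendsto_lowerbound[OF dirichlet_asymp])
  show "eventually (\<lambda>\<delta>. \<delta> powr \<tau> * (\<Sum>n. c n * real n powr (-\<delta>)) \<ge> 0) (at_right 0)"
    using eventually_at_right_less[of 0]
    by eventually_elim (auto intro!: mult_nonneg_nonneg suminf_nonneg summable_dirichlet c_nonneg)
qed auto

text \<open>Up to the factor a / Gamma \<tau>, this integral is the limit in
  \<open>poly_functional\<close>. As an integral it can be compared with that of a truncated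
  function.\<close>

lemma poly_integral:
  "((\<lambda>t. t powr (\<tau> - 1) * (exp (-t) * (\<Sum>i\<le>N. b i * exp (-t) ^ i))) has_integral
     (Gamma \<tau> * (\<Sum>i\<le>N. b i * real (Suc i) powr (-\<tau>)))) {0..}"
proof -
  have "((\<lambda>t. \<Sum>i\<le>N. b i * (t powr (\<tau> - 1) * exp (- (real (Suc i) * t)))) has_integral
        (\<Sum>i\<le>N. b i * (Gamma \<tau> * real (Suc i) powr (-\<tau>)))) {0..}"
    by (intro has_integral_sum has_integral_mult_right Gamma_integral_scaled tau_pos) auto
  moreover have "(\<Sum>i\<le>N. b i * (t powr (\<tau> - 1) * exp (- (real (Suc i) * t)))) =
      t powr (\<tau> - 1) * (exp (-t) * (\<Sum>i\<le>N. b i * exp (-t) ^ i))" for t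
    unfolding sum_distrib_left
    by (intro sum.cong refl) (simp add: exp_add [symmetric] exp_of_nat_mult [symmetric] algebra_simps)
  ultimately show ?thesis by (simp add: sum_distrib_left mult_ac)
qed

text \<open>For n > 0, n \<le> exp (1 / \<delta>) means y = n powr -\<delta> \<ge> exp (-1).
  Multiplying y by the test function 1 / y cut off there gives exactly the indicator of the
  summation range.\<close>

lemma partial_sum_le:
  assumes \<delta>: "\<delta> > 0" and q: "\<And>y. y \<in> {0..1} \<Longrightarrow> (if exp (-1) \<le> y then 1 / y else 0) \<le> (\<Sum>i\<le>N. b i * y ^ i)"
  shows "(\<Sum>n\<in>nats_le (exp (1 / \<delta>)). c n) \<le> (\<Sum>n. c n * real n powr (-\<delta>) * (\<Sum>i\<le>N. b i * (real n powr (-\<delta>)) ^ i))"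
proof -
  have nonneg: "(\<Sum>i\<le>N. b i * (real n powr (-\<delta>)) ^ i) \<ge> 0" for n
    using q[OF powr_neg_in_unit[OF \<delta>, of n]] powr_neg_in_unit[OF \<delta>, of n]
    by (auto split: if_splits intro: order.trans[rotated])
  have "(\<Sum>n\<in>nats_le (exp (1 / \<delta>)). c n) \<le>
        (\<Sum>n\<in>nats_le (exp (1 / \<delta>)). c n * real n powr (-\<delta>) * (\<Sum>i\<le>N. b i * (real n powr (-\<delta>)) ^ i))"
  proof (rule sum_mono)
    fix n assume n: "n \<in> nats_le (exp (1 / \<delta>))"
    define y where "y = real n powr (-\<delta>)"
    have "ln (real n) \<le> ln (exp (1 / \<delta>))" using n by (subst ln_le_cancel_iff) (auto simp: nats_le_def)
    hence "ln (real n) \<le> 1 / \<delta>" by simp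
    hence "exp (-1) \<le> y" using n \<delta> by (simp add: y_def powr_def nats_le_def field_simps)
    moreover have "y > 0" using n by (simp add: y_def nats_le_def)
    ultimately have "1 \<le> y * (\<Sum>i\<le>N. b i * y ^ i)"
      using q[of y] powr_neg_in_unit[OF \<delta>, of n] by (simp add: y_def [symmetric] field_simps)
    from mult_left_mono[OF this c_nonneg[of n]]
    show "c n \<le> c n * real n powr (-\<delta>) * (\<Sum>i\<le>N. b i * (real n powr (-\<delta>)) ^ i)"
      by (simp add: y_def mult.assoc)
  qed
  also have "\<dots> \<le> (\<Sum>n. c n * real n powr (-\<delta>) * (\<Sum>i\<le>N. b i * (real n powr (-\<delta>)) ^ i))"
    by (intro sum_le_suminf poly_functional \<delta>) (auto intro!: mult_nonneg_nonneg c_nonneg nonneg)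
  finally show ?thesis .
qed

lemma partial_sum_ge:
  assumes \<delta>: "\<delta> > 0" and q: "\<And>y. y \<in> {0..1} \<Longrightarrow> (\<Sum>i\<le>N. b i * y ^ i) \<le> (if exp (-1) \<le> y then 1 / y else 0)"
  shows "(\<Sum>n. c n * real n powr (-\<delta>) * (\<Sum>i\<le>N. b i * (real n powr (-\<delta>)) ^ i)) \<le> (\<Sum>n\<in>nats_le (exp (1 / \<delta>)). c n)"
proof -
  define X where "X = nats_le (exp (1 / \<delta>))"
  have "(\<Sum>n. c n * real n powr (-\<delta>) * (\<Sum>i\<le>N. b i * (real n powr (-\<delta>)) ^ i)) \<le> (\<Sum>n. if n \<in> X then c n else 0)"
  proof (rule suminf_le)
    fix n
    define y where "y = real n powr (-\<delta>)"
    have y: "y \<in> {0..1}" unfolding y_def by (rule powr_neg_in_unit[OF \<delta>])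
    have qy: "y * (\<Sum>i\<le>N. b i * y ^ i) \<le> (if exp (-1) \<le> y then 1 else 0)"
      using mult_left_mono[OF q[OF y], of y] y by (auto split: if_splits)
    have "y * (\<Sum>i\<le>N. b i * y ^ i) \<le> (if n \<in> X then 1 else 0)"
    proof (cases "exp (-1) \<le> y")
      case True
      have n: "n > 0" using True by (intro Nat.gr0I) (auto simp: y_def)
      hence "-1 \<le> -\<delta> * ln (real n)" using True by (simp add: y_def powr_def)
      hence "ln (real n) \<le> 1 / \<delta>" using \<delta> by (simp add: field_simps)
      hence "exp (ln (real n)) \<le> exp (1 / \<delta>)" by (simp only: exp_le_cancel_iff)
      hence "n \<in> X" using n by (simp add: X_def nats_le_def)
      thus ?thesis using qy True by simp
    qed (use qy in auto)
    from mult_left_mono[OF this c_nonneg[of n]]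
    show "c n * real n powr (-\<delta>) * (\<Sum>i\<le>N. b i * (real n powr (-\<delta>)) ^ i) \<le> (if n \<in> X then c n else 0)"
      by (auto simp: y_def mult.assoc split: if_splits)
  next
    show "summable (\<lambda>n. if n \<in> X then c n else 0)"
      by (rule summable_finite[of X]) (auto simp: X_def)
  qed (use poly_functional \<delta> in auto)
  also have "(\<Sum>n. if n \<in> X then c n else 0) = (\<Sum>n\<in>X. if n \<in> X then c n else 0)"
    by (rule suminf_finite) (auto simp: X_def)
  also have "\<dots> = (\<Sum>n\<in>X. c n)" by (intro sum.cong) auto
  finally show ?thesis by (simp add: X_def)
qed

text \<open>Under y = exp (-t) the cutoff becomes t \<le> 1. The polynomials exceed it to 1 + \<eta>
  or fall short at 1 - \<eta>, so the limits lie within C * ((1 \<plusminus> \<eta>) powr \<tau> /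
  \<tau> \<plusminus> \<eta> * Gamma \<tau>), and \<eta> is arbitrarily small.\<close>

lemma partial_sum_asymp_exp:
  "((\<lambda>\<delta>. \<delta> powr \<tau> * (\<Sum>n\<in>nats_le (exp (1 / \<delta>)). c n)) \<longlongrightarrow> a / Gamma (\<tau> + 1)) (at_right 0)"
proof -
  define C where "C = a / Gamma \<tau>"
  have Gpos: "Gamma \<tau> > 0" using tau_pos by simp
  have C: "C \<ge> 0" unfolding C_def using a_nonneg Gpos by simp
  have target: "a / Gamma (\<tau> + 1) = C * (1 / \<tau>)"
  proof -
    have "\<tau> \<notin> \<int>\<^sub>\<le>\<^sub>0" using tau_pos nonpos_Ints_nonpos[of \<tau>] by auto
    from Gamma_plus1[OF this] show ?thesis by (simp add: C_def)
  qed
  have CG: "a * s = C * (Gamma \<tau> * s)" for s using Gpos by (simp add: C_def)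
  show ?thesis
  proof (rule order_tendstoI)
    fix z assume "a / Gamma (\<tau> + 1) < z"
    hence z: "C * (1 / \<tau>) < z" using target by simp
    have "((\<lambda>\<eta>. C * ((1 + \<eta>) powr \<tau> / \<tau> + \<eta> * Gamma \<tau>)) \<longlongrightarrow> C * ((1 + 0) powr \<tau> / \<tau> + 0 * Gamma \<tau>)) (at_right 0)"
      using tau_pos by (intro tendsto_intros) auto
    hence "eventually (\<lambda>\<eta>. C * ((1 + \<eta>) powr \<tau> / \<tau> + \<eta> * Gamma \<tau>) < z) (at_right 0)"
      using z by (intro order_tendstoD(2)) auto
    hence "eventually (\<lambda>\<eta>. C * ((1 + \<eta>) powr \<tau> / \<tau> + \<eta> * Gamma \<tau>) < z \<and> \<eta> > 0) (at_right 0)"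
      by (rule eventually_conj) (rule eventually_at_right_less)
    then obtain \<eta> where \<eta>: "\<eta> > 0" "C * ((1 + \<eta>) powr \<tau> / \<tau> + \<eta> * Gamma \<tau>) < z"
      using eventually_happens'[OF trivial_limit_at_right_real] by blast
    obtain b N where b:
      "\<And>y. y \<in> {0..1} \<Longrightarrow> (if exp (-1) \<le> y then 1 / y else 0) \<le> (\<Sum>i\<le>N. b i * y ^ i)"
      "\<And>y. y \<in> {0..1} \<Longrightarrow> (\<Sum>i\<le>N. b i * y ^ i) \<le> (if exp (-(1 + \<eta>)) \<le> y then 1 / y else 0) + \<eta>"
      by (rule polynomial_sandwich[of "exp (-(1 + \<eta>))" "exp (-1)" \<eta>]) (use \<eta> in auto)
    have "Gamma \<tau> * (\<Sum>i\<le>N. b i * real (Suc i) powr (-\<tau>)) \<le> (1 + \<eta>) powr \<tau> / \<tau> + \<eta> * (Gamma \<tau> * 1 powr (-\<tau>))"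
    proof (rule has_integral_le[OF poly_integral])
      show "((\<lambda>t. (if t \<le> 1 + \<eta> then t powr (\<tau> - 1) else 0) + \<eta> * (t powr (\<tau> - 1) * exp (- (1 * t))))
         has_integral (1 + \<eta>) powr \<tau> / \<tau> + \<eta> * (Gamma \<tau> * 1 powr (-\<tau>))) {0..}"
        using \<eta> tau_pos by (intro has_integral_add has_integral_mult_right powr_integral_restricted Gamma_integral_scaled) auto
      fix t :: real assume t: "t \<in> {0..}"
      have "exp (-t) * (\<Sum>i\<le>N. b i * exp (-t) ^ i) \<le> exp (-t) * ((if exp (-(1 + \<eta>)) \<le> exp (-t) then 1 / exp (-t) else 0) + \<eta>)"
        using t by (intro mult_left_mono b) auto
      also have "\<dots> = (if t \<le> 1 + \<eta> then 1 else 0) + \<eta> * exp (-t)"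
        by (auto simp: algebra_simps)
      finally have "t powr (\<tau> - 1) * (exp (-t) * (\<Sum>i\<le>N. b i * exp (-t) ^ i)) \<le>
          t powr (\<tau> - 1) * ((if t \<le> 1 + \<eta> then 1 else 0) + \<eta> * exp (-t))"
        by (intro mult_left_mono) auto
      thus "t powr (\<tau> - 1) * (exp (-t) * (\<Sum>i\<le>N. b i * exp (-t) ^ i)) \<le>
        (if t \<le> 1 + \<eta> then t powr (\<tau> - 1) else 0) + \<eta> * (t powr (\<tau> - 1) * exp (- (1 * t)))"
        by (auto simp: algebra_simps split: if_splits)
    qed
    hence "C * (Gamma \<tau> * (\<Sum>i\<le>N. b i * real (Suc i) powr (-\<tau>))) \<le> C * ((1 + \<eta>) powr \<tau> / \<tau> + \<eta> * Gamma \<tau>)"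
      using C by (intro mult_left_mono) auto
    also note \<eta>(2)
    also have "C * (Gamma \<tau> * (\<Sum>i\<le>N. b i * real (Suc i) powr (-\<tau>))) = (\<Sum>i\<le>N. b i * (a * real (Suc i) powr (-\<tau>)))"
      unfolding CG [symmetric] by (simp add: sum_distrib_left mult_ac)
    finally have "eventually (\<lambda>\<delta>. \<delta> powr \<tau> * (\<Sum>n. c n * real n powr (-\<delta>) * (\<Sum>i\<le>N. b i * (real n powr (-\<delta>)) ^ i)) < z) (at_right 0)"
      by (rule order_tendstoD(2)[OF poly_functional(2)])
    thus "eventually (\<lambda>\<delta>. \<delta> powr \<tau> * (\<Sum>n\<in>nats_le (exp (1 / \<delta>)). c n) < z) (at_right 0)"
      using eventually_at_right_less[of 0]
    proof eventually_elim
      case (elim \<delta>)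
      from partial_sum_le[OF elim(2) b(1)] elim(1) show ?case
        by (elim order.strict_trans1[rotated]) (auto intro!: mult_left_mono)
    qed
  next
    fix z assume "z < a / Gamma (\<tau> + 1)"
    hence z: "z < C * (1 / \<tau>)" using target by simp
    have "((\<lambda>\<eta>. C * ((1 - \<eta>) powr \<tau> / \<tau> - \<eta> * Gamma \<tau>)) \<longlongrightarrow> C * ((1 - 0) powr \<tau> / \<tau> - 0 * Gamma \<tau>)) (at_right 0)"
      using tau_pos by (intro tendsto_intros) auto
    hence "eventually (\<lambda>\<eta>. C * ((1 - \<eta>) powr \<tau> / \<tau> - \<eta> * Gamma \<tau>) > z) (at_right 0)"
      using z by (intro order_tendstoD(1)) auto
    hence "eventually (\<lambda>\<eta>. C * ((1 - \<eta>) powr \<tau> / \<tau> - \<eta> * Gamma \<tau>) > z \<and> \<eta> \<in> {0<..<1}) (at_right 0)"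
      by (rule eventually_conj) (rule eventually_at_right_real, simp)
    then obtain \<eta> where \<eta>: "\<eta> > 0" "\<eta> < 1" "z < C * ((1 - \<eta>) powr \<tau> / \<tau> - \<eta> * Gamma \<tau>)"
      using eventually_happens'[OF trivial_limit_at_right_real] by auto
    obtain b N where b:
      "\<And>y. y \<in> {0..1} \<Longrightarrow> (if exp (-(1 - \<eta>)) \<le> y then 1 / y else 0) - \<eta> \<le> (\<Sum>i\<le>N. b i * y ^ i)"
      "\<And>y. y \<in> {0..1} \<Longrightarrow> (\<Sum>i\<le>N. b i * y ^ i) \<le> (if exp (-1) \<le> y then 1 / y else 0)"
      by (rule polynomial_sandwich[of "exp (-1)" "exp (-(1 - \<eta>))" \<eta>]) (use \<eta> in auto)
    have "(1 - \<eta>) powr \<tau> / \<tau> - \<eta> * (Gamma \<tau> * 1 powr (-\<tau>)) \<le> Gamma \<tau> * (\<Sum>i\<le>N. b i * real (Suc i) powr (-\<tau>))"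
    proof (rule has_integral_le[OF _ poly_integral])
      show "((\<lambda>t. (if t \<le> 1 - \<eta> then t powr (\<tau> - 1) else 0) - \<eta> * (t powr (\<tau> - 1) * exp (- (1 * t))))
         has_integral (1 - \<eta>) powr \<tau> / \<tau> - \<eta> * (Gamma \<tau> * 1 powr (-\<tau>))) {0..}"
        using \<eta> tau_pos by (intro has_integral_diff has_integral_mult_right powr_integral_restricted Gamma_integral_scaled) auto
      fix t :: real assume t: "t \<in> {0..}"
      have "(if t \<le> 1 - \<eta> then 1 else 0) - \<eta> * exp (-t) = exp (-t) * ((if exp (-(1 - \<eta>)) \<le> exp (-t) then 1 / exp (-t) else 0) - \<eta>)"
        by (auto simp: algebra_simps)
      also have "\<dots> \<le> exp (-t) * (\<Sum>i\<le>N. b i * exp (-t) ^ i)"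
        using t by (intro mult_left_mono b) auto
      finally have "t powr (\<tau> - 1) * ((if t \<le> 1 - \<eta> then 1 else 0) - \<eta> * exp (-t)) \<le>
          t powr (\<tau> - 1) * (exp (-t) * (\<Sum>i\<le>N. b i * exp (-t) ^ i))"
        by (intro mult_left_mono) auto
      thus "(if t \<le> 1 - \<eta> then t powr (\<tau> - 1) else 0) - \<eta> * (t powr (\<tau> - 1) * exp (- (1 * t)))
        \<le> t powr (\<tau> - 1) * (exp (-t) * (\<Sum>i\<le>N. b i * exp (-t) ^ i))"
        by (auto simp: algebra_simps split: if_splits)
    qed
    hence "C * ((1 - \<eta>) powr \<tau> / \<tau> - \<eta> * Gamma \<tau>) \<le> C * (Gamma \<tau> * (\<Sum>i\<le>N. b i * real (Suc i) powr (-\<tau>)))"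
      using C by (intro mult_left_mono) auto
    with \<eta>(3) have "z < C * (Gamma \<tau> * (\<Sum>i\<le>N. b i * real (Suc i) powr (-\<tau>)))" by linarith
    also have "\<dots> = (\<Sum>i\<le>N. b i * (a * real (Suc i) powr (-\<tau>)))"
      unfolding CG [symmetric] by (simp add: sum_distrib_left mult_ac)
    finally have "eventually (\<lambda>\<delta>. z < \<delta> powr \<tau> * (\<Sum>n. c n * real n powr (-\<delta>) * (\<Sum>i\<le>N. b i * (real n powr (-\<delta>)) ^ i))) (at_right 0)"
      by (rule order_tendstoD(1)[OF poly_functional(2)])
    thus "eventually (\<lambda>\<delta>. z < \<delta> powr \<tau> * (\<Sum>n\<in>nats_le (exp (1 / \<delta>)). c n)) (at_right 0)"
      using eventually_at_right_less[of 0]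
    proof eventually_elim
      case (elim \<delta>)
      from partial_sum_ge[OF elim(2) b(2)] elim(1) show ?case
        by (elim order.strict_trans2) (auto intro!: mult_left_mono)
    qed
  qed
qed

theorem partial_sum_asymp: "((\<lambda>x. (\<Sum>n\<in>nats_le x. c n) / ln x powr \<tau>) \<longlongrightarrow> a / Gamma (\<tau> + 1)) at_top"
proof -
  have "filterlim (\<lambda>x::real. 1 / ln x) (at_right 0) at_top" by real_asymp
  from filterlim_compose[OF partial_sum_asymp_exp this]
  have "((\<lambda>x. (1 / ln x) powr \<tau> * (\<Sum>n\<in>nats_le (exp (1 / (1 / ln x))). c n)) \<longlongrightarrow> a / Gamma (\<tau> + 1)) at_top" .
  moreover have "eventually (\<lambda>x. (1 / ln x) powr \<tau> * (\<Sum>n\<in>nats_le (exp (1 / (1 / ln x))). c n) =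
      (\<Sum>n\<in>nats_le x. c n) / ln x powr \<tau>) at_top"
    using eventually_gt_at_top[of 1] by eventually_elim (auto simp: powr_divide)
  ultimately show ?thesis by (simp only: filterlim_cong[OF refl refl])
qed

end

section \<open>Euler products and the behaviour at 1\<close>

text \<open>Only the primes in the set matter, so a partition of all natural numbers can serve as a
  partition of the primes.\<close>

definition composed_of :: "nat set \<Rightarrow> nat set" where
  "composed_of P = {n. n > 0 \<and> (\<forall>p. prime p \<longrightarrow> p dvd n \<longrightarrow> p \<in> P)}"

lemma composed_of_empty: "composed_of {} = {1}"
  using prime_factor_nat by (auto simp: composed_of_def)

lemma composed_of_mono: "P \<subseteq> Q \<Longrightarrow> composed_of P \<subseteq> composed_of Q"
  by (auto simp: composed_of_def)

lemma composed_of_mult_iff: "m * n \<in> composed_of P \<longleftrightarrow> m \<in> composed_of P \<and> n \<in> composed_of P"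
  by (auto simp: composed_of_def prime_dvd_mult_iff)

text \<open>Unique factorisation for a single prime; it carries the induction for the Euler product,
  each prime contributing a geometric series.\<close>

lemma composed_of_insert:
  assumes "prime p" "p \<notin> T"
  shows "bij_betw (\<lambda>(k, n). p ^ k * n) (UNIV \<times> composed_of T) (composed_of (insert p T))"
proof (rule bij_betwI')
  fix x y :: "nat \<times> nat" assume "x \<in> UNIV \<times> composed_of T" "y \<in> UNIV \<times> composed_of T"
  then obtain k m k' m' where xy: "x = (k, m)" "y = (k', m')" "m \<in> composed_of T" "m' \<in> composed_of T"
    by auto
  hence m: "\<not> p dvd m" "\<not> p dvd m'" "m > 0" "m' > 0" using assms by (auto simp: composed_of_def)
  have mult: "multiplicity p (p ^ j * l) = j" if "\<not> p dvd l" for j l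
    using assms that by (intro multiplicity_eqI) (auto simp: mult_ac dest: prime_gt_0_nat)
  show "((case x of (k, n) \<Rightarrow> p ^ k * n) = (case y of (k, n) \<Rightarrow> p ^ k * n)) = (x = y)"
  proof
    assume "(case x of (k, n) \<Rightarrow> p ^ k * n) = (case y of (k, n) \<Rightarrow> p ^ k * n)"
    hence eq: "p ^ k * m = p ^ k' * m'" by (simp add: xy)
    have "k = k'" using arg_cong[OF eq, of "multiplicity p"] mult m by simp
    thus "x = y" using eq assms(1) by (simp add: xy prime_gt_0_nat)
  qed simp
next
  fix x :: "nat \<times> nat" assume "x \<in> UNIV \<times> composed_of T"
  then obtain k m where x: "x = (k, m)" "m \<in> composed_of T" by auto
  have "q \<in> insert p T" if "prime q" "q dvd p ^ k * m" for q
  proof -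
    have "q dvd p \<or> q dvd m"
      using that prime_dvd_power[OF that(1), of p k] by (auto simp: prime_dvd_mult_iff)
    thus ?thesis using that(1) x(2) assms(1) primes_dvd_imp_eq[of q p] by (auto simp: composed_of_def)
  qed
  moreover have "p ^ k * m > 0" using assms(1) x(2) by (auto simp: composed_of_def prime_gt_0_nat)
  ultimately show "(case x of (k, n) \<Rightarrow> p ^ k * n) \<in> composed_of (insert p T)"
    by (simp add: x composed_of_def)
next
  fix n assume n: "n \<in> composed_of (insert p T)"
  hence n0: "n > 0" by (simp add: composed_of_def)
  have "\<not> is_unit p" using assms(1) by auto
  then obtain m where m: "n = p ^ multiplicity p n * m" "\<not> p dvd m"
    using multiplicity_decompose'[of n p] n0 by auto
  have "m \<in> composed_of T"
    unfolding composed_of_def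
  proof safe
    show "m > 0" using m n0 by (auto intro!: Nat.gr0I)
  next
    fix q assume q: "prime q" "q dvd m"
    hence "q dvd n" using m(1) by (metis dvd_mult)
    hence "q \<in> insert p T" using n q by (auto simp: composed_of_def)
    with q m(2) show "q \<in> T" by auto
  qed
  thus "\<exists>x\<in>UNIV \<times> composed_of T. n = (case x of (k, n) \<Rightarrow> p ^ k * n)"
    using m(1) by (intro bexI[of _ "(multiplicity p n, m)"]) auto
qed

lemma prime_powr_less_1: "prime p \<Longrightarrow> s > 0 \<Longrightarrow> real p powr (-s) < 1"
  using prime_gt_1_nat[of p] by (simp add: powr_minus inverse_less_1_iff)

lemma euler_product_finite:
  fixes s :: real
  assumes "finite T" "\<And>p. p \<in> T \<Longrightarrow> prime p" "s > 0"
  shows "((\<lambda>n. real n powr (-s)) has_sum (\<Prod>p\<in>T. 1 / (1 - real p powr (-s)))) (composed_of T)"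
  using assms(1,2)
proof (induction T rule: finite_induct)
  case empty
  show ?case using has_sum_finite[of "{1::nat}" "\<lambda>n. real n powr (-s)"] by (simp add: composed_of_empty)
next
  case (insert p T)
  define y where "y = real p powr (-s)"
  define I where "I = (\<Prod>p\<in>T. 1 / (1 - real p powr (-s)))"
  have p: "prime p" using insert by simp
  have y: "y \<ge> 0" "y < 1" using p assms prime_powr_less_1 by (auto simp: y_def)
  have IH: "((\<lambda>n. real n powr (-s)) has_sum I) (composed_of T)"
    unfolding I_def using insert by auto
  have I: "I \<ge> 0" by (rule has_sum_nonneg[OF IH]) auto
  have fib: "((\<lambda>n. y ^ k * real n powr (-s)) has_sum (y ^ k * I)) (composed_of T)" for k :: nat
    by (intro has_sum_cmult_right IH)
  have geo: "((\<lambda>k. y ^ k * I) has_sum (1 / (1 - y) * I)) UNIV"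
    using y I by (intro sums_nonneg_imp_has_sum sums_mult2 geometric_sums) auto
  have "((\<lambda>(k, n). y ^ k * real n powr (-s)) has_sum (1 / (1 - y) * I)) (UNIV \<times> composed_of T)"
    using fib geo y
    by (intro has_sum_SigmaI[where g = "\<lambda>k. y ^ k * I"] summable_on_SigmaI[where g = "\<lambda>k. y ^ k * I"])
       (auto intro: has_sum_imp_summable)
  also have "(\<lambda>(k, n). y ^ k * real n powr (-s)) = (\<lambda>x. real (case x of (k, n) \<Rightarrow> p ^ k * n) powr (-s))"
  proof -
    have "y ^ k = real (p ^ k) powr (-s)" for k
      by (induction k) (auto simp: y_def powr_mult)
    thus ?thesis by (auto simp: fun_eq_iff powr_mult)
  qed
  also have "(\<dots> has_sum (1 / (1 - y) * I)) (UNIV \<times> composed_of T) \<longleftrightarrow>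
             ((\<lambda>n. real n powr (-s)) has_sum (1 / (1 - y) * I)) (composed_of (insert p T))"
    using composed_of_insert[OF p insert(2)] by (rule has_sum_reindex_bij_betw)
  finally show ?case using insert by (simp add: I_def y_def)
qed

text \<open>The logarithm of the Euler factor at p. Working with it rather than with p powr -s makes
  the Euler product the exact exponential of a sum.\<close>

definition prime_weight :: "real \<Rightarrow> nat \<Rightarrow> real" where
  "prime_weight s p = (if prime p then - ln (1 - real p powr (-s)) else 0)"

lemma exp_sum_prime_weight:
  assumes "s > 0"
  shows "exp (\<Sum>n\<in>{..N} \<inter> P. prime_weight s n) = (\<Prod>p\<in>{p\<in>P. prime p \<and> p \<le> N}. 1 / (1 - real p powr (-s)))"
proof -
  have "exp (\<Sum>n\<in>{..N} \<inter> P. prime_weight s n) = (\<Prod>n\<in>{..N} \<inter> P. exp (prime_weight s n))"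
    by (rule exp_sum) auto
  also have "\<dots> = (\<Prod>p\<in>{p\<in>P. prime p \<and> p \<le> N}. 1 / (1 - real p powr (-s)))"
    using prime_powr_less_1[OF _ assms]
    by (intro prod.mono_neutral_cong_right) (auto simp: prime_weight_def exp_minus inverse_eq_divide)
  finally show ?thesis .
qed

definition dirichlet_on :: "nat set \<Rightarrow> real \<Rightarrow> real" where
  "dirichlet_on A s = (\<Sum>n. indicator A n * real n powr (-s))"

lemma summable_indicator_powr:
  assumes "s > 1"
  shows "summable (\<lambda>n. indicator A n * real n powr (-s))"
proof (rule summable_comparison_test)
  show "summable (\<lambda>n. real n powr (-s))" using assms by (subst summable_real_powr_iff) auto
  show "\<exists>N. \<forall>n\<ge>N. norm (indicator A n * real n powr (-s)) \<le> real n powr (-s)"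
    by (auto simp: indicator_def)
qed

text \<open>An n \<le> N has no prime factor above N. The bound needs only s > 0, so it also applies
  at s = 1, where it yields the divergence of the prime weights.\<close>

lemma partial_sum_le_euler_product:
  assumes "s > 0"
  shows "(\<Sum>n\<in>nats_le (real N). indicator (composed_of P) n * real n powr (-s)) \<le> exp (\<Sum>n\<in>{..N} \<inter> P. prime_weight s n)"
proof -
  define T where "T = {p\<in>P. prime p \<and> p \<le> N}"
  have T: "finite T" "\<And>p. p \<in> T \<Longrightarrow> prime p"
    by (auto simp: T_def intro: finite_subset[of _ "{..N}"])
  have "(\<Sum>n\<in>nats_le (real N). indicator (composed_of P) n * real n powr (-s)) =
        (\<Sum>n\<in>nats_le (real N) \<inter> composed_of P. real n powr (-s))"
    by (subst sum.inter_restrict, simp, intro sum.cong refl) (auto simp: indicator_def)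
  also have "\<dots> \<le> (\<Prod>p\<in>T. 1 / (1 - real p powr (-s)))"
  proof (rule has_sum_mono2[OF has_sum_finite euler_product_finite[OF T assms]])
    show "nats_le (real N) \<inter> composed_of P \<subseteq> composed_of T"
      by (auto simp: composed_of_def T_def nats_le_def dest: dvd_imp_le)
  qed auto
  finally show ?thesis by (simp add: exp_sum_prime_weight[OF assms] T_def)
qed

lemma sum_prime_weight_le_dirichlet:
  assumes "s > 1"
  shows "exp (\<Sum>n\<in>{..N} \<inter> P. prime_weight s n) \<le> dirichlet_on (composed_of P) s"
proof -
  define T where "T = {p\<in>P. prime p \<and> p \<le> N}"
  have T: "finite T" "\<And>p. p \<in> T \<Longrightarrow> prime p"
    by (auto simp: T_def intro: finite_subset[of _ "{..N}"])
  have "((\<lambda>n. indicator (composed_of P) n * real n powr (-s)) has_sum dirichlet_on (composed_of P) s) UNIV"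
    unfolding dirichlet_on_def
    by (intro sums_nonneg_imp_has_sum summable_sums summable_indicator_powr assms) auto
  hence 1: "((\<lambda>n. real n powr (-s)) has_sum dirichlet_on (composed_of P) s) (composed_of P)"
    by (subst has_sum_cong_neutral[of UNIV _ "\<lambda>n. indicator (composed_of P) n * real n powr (-s)"])
       (auto simp: indicator_def)
  have "(\<Prod>p\<in>T. 1 / (1 - real p powr (-s))) \<le> dirichlet_on (composed_of P) s"
    by (rule has_sum_mono2[OF euler_product_finite[OF T] 1])
       (use assms in \<open>auto intro!: composed_of_mono simp: T_def\<close>)
  thus ?thesis using assms by (simp add: exp_sum_prime_weight T_def)
qed

lemma dirichlet_pos:
  assumes "s > 1" shows "dirichlet_on (composed_of P) s > 0"
  using sum_prime_weight_le_dirichlet[OF assms, of 0 P] by (auto intro: less_le_trans[OF exp_gt_zero])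

lemma ln_dirichlet:
  assumes "s > 1"
  shows "(\<lambda>N. \<Sum>n\<in>{..N} \<inter> P. prime_weight s n) \<longlonglongrightarrow> ln (dirichlet_on (composed_of P) s)"
proof -
  have s0: "s > 0" using assms by simp
  define a where "a = (\<lambda>n. indicator (composed_of P) n * real n powr (-s))"
  have "(\<lambda>N. \<Sum>n<N. a n) \<longlonglongrightarrow> dirichlet_on (composed_of P) s"
    unfolding dirichlet_on_def a_def [symmetric] using summable_indicator_powr[OF assms, of "composed_of P"]
    by (intro summable_LIMSEQ) (simp add: a_def)
  hence "(\<lambda>N. \<Sum>n<Suc N. a n) \<longlonglongrightarrow> dirichlet_on (composed_of P) s" by (rule LIMSEQ_Suc)
  moreover have "(\<Sum>n<Suc N. a n) = (\<Sum>n\<in>nats_le (real N). a n)" for N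
    by (intro sum.mono_neutral_right) (auto simp: nats_le_def a_def)
  ultimately have "(\<lambda>N. \<Sum>n\<in>nats_le (real N). a n) \<longlonglongrightarrow> dirichlet_on (composed_of P) s" by simp
  moreover have "(\<lambda>_. dirichlet_on (composed_of P) s) \<longlonglongrightarrow> dirichlet_on (composed_of P) s" by simp
  ultimately have "(\<lambda>N. exp (\<Sum>n\<in>{..N} \<inter> P. prime_weight s n)) \<longlonglongrightarrow> dirichlet_on (composed_of P) s"
    by (rule tendsto_sandwich[rotated 2])
       (auto simp only: a_def intro!: always_eventually allI
          partial_sum_le_euler_product[OF s0] sum_prime_weight_le_dirichlet[OF assms])
  hence "(\<lambda>N. ln (exp (\<Sum>n\<in>{..N} \<inter> P. prime_weight s n))) \<longlonglongrightarrow> ln (dirichlet_on (composed_of P) s)"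
    by (intro tendsto_ln) (use dirichlet_pos[OF assms, of P] in auto)
  thus ?thesis by simp
qed

text \<open>Euler's argument: the product over the primes up to N dominates the harmonic sum. The
  greedy choice relies on this to bring every negative deficit back.\<close>

lemma sum_prime_weight_at_top: "filterlim (\<lambda>N. \<Sum>n\<le>N. prime_weight 1 n) at_top sequentially"
proof -
  have le: "ln (harm N) \<le> (\<Sum>n\<le>N. prime_weight 1 n)" if "N > 0" for N
  proof -
    have "harm N = (\<Sum>n\<in>nats_le (real N). indicator (composed_of UNIV) n * real n powr (-1))"
      unfolding harm_def nats_le_altdef
      by (intro sum.cong) (auto simp: composed_of_def powr_minus)
    also have "\<dots> \<le> exp (\<Sum>n\<in>{..N} \<inter> UNIV. prime_weight 1 n)"
      by (rule partial_sum_le_euler_product) auto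
    finally have "harm N \<le> exp (\<Sum>n\<le>N. prime_weight 1 n)" by simp
    hence "ln (harm N) \<le> ln (exp (\<Sum>n\<le>N. prime_weight 1 n))"
      using that by (intro ln_mono) (auto intro!: harm_pos)
    thus ?thesis by simp
  qed
  have "filterlim (\<lambda>N. ln (harm N :: real)) at_top sequentially"
    by (intro filterlim_compose[OF ln_at_top] harm_at_top)
  thus ?thesis
    by (rule filterlim_at_top_mono) (use le in \<open>auto intro: eventually_mono[OF eventually_gt_at_top[of 0]]\<close>)
qed

lemma summation_by_parts_decreasing:
  fixes D g :: "nat \<Rightarrow> real"
  assumes "m \<le> N" and D: "\<And>n. n \<ge> m \<Longrightarrow> \<bar>D n\<bar> \<le> B"
    and g: "\<And>n. n \<ge> m \<Longrightarrow> g (Suc n) \<le> g n" "\<And>n. n \<ge> m \<Longrightarrow> g n \<ge> 0"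
  shows "\<bar>\<Sum>n=m..N. (D n - D (Suc n)) * g n\<bar> \<le> 2 * B * g m"
proof -
  \<comment> \<open>The factor 2 * g m - g N is the initial value g m plus the total variation g m -
    g N; the boundary term is kept inside so that the induction step is clean.\<close>
  have "\<bar>(\<Sum>n=m..N. (D n - D (Suc n)) * g n) + D (Suc N) * g N\<bar> \<le> B * (2 * g m - g N)"
    using assms(1)
  proof (induction N rule: dec_induct)
    case base
    have "\<bar>D m * g m\<bar> \<le> B * g m" unfolding abs_mult using D[of m] g(2)[of m] by (intro mult_mono) auto
    thus ?case by (simp add: algebra_simps)
  next
    case (step N)
    have "(\<Sum>n=m..Suc N. (D n - D (Suc n)) * g n) + D (Suc (Suc N)) * g (Suc N) =
          ((\<Sum>n=m..N. (D n - D (Suc n)) * g n) + D (Suc N) * g N) - D (Suc N) * (g N - g (Suc N))"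
      using step by (simp add: algebra_simps)
    also have "\<bar>\<dots>\<bar> \<le> B * (2 * g m - g N) + B * (g N - g (Suc N))"
    proof (intro order.trans[OF abs_triangle_ineq4] add_mono step.IH)
      show "\<bar>D (Suc N) * (g N - g (Suc N))\<bar> \<le> B * (g N - g (Suc N))"
        unfolding abs_mult using D[of "Suc N"] g(1)[of N] step by (intro mult_mono) auto
    qed
    finally show ?case by (simp add: algebra_simps)
  qed
  moreover have "\<bar>D (Suc N) * g N\<bar> \<le> B * g N"
    unfolding abs_mult using D[of "Suc N"] g(2)[of N] assms(1) by (intro mult_mono) auto
  moreover have "B * (2 * g m - g N) + B * g N = 2 * B * g m" by (simp add: algebra_simps)
  ultimately show ?thesis by linarith
qed

text \<open>Abel's limit theorem for Dirichlet series. Convergence at \<delta> = 0 makes the tails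
  small, and since n powr -\<delta> decreases in n, summation by parts bounds the weighted tails
  uniformly in \<delta>.\<close>

lemma abel_dirichlet:
  fixes c :: "nat \<Rightarrow> real"
  assumes conv: "(\<lambda>N. \<Sum>n=1..N. c n) \<longlonglongrightarrow> L"
    and J: "\<And>\<delta>. \<delta> > 0 \<Longrightarrow> (\<lambda>N. \<Sum>n=1..N. c n * real n powr (-\<delta>)) \<longlonglongrightarrow> J \<delta>"
  shows "(J \<longlongrightarrow> L) (at_right 0)"
  unfolding tendsto_iff dist_real_def
proof safe
  fix \<epsilon> :: real assume \<epsilon>: "\<epsilon> > 0"
  define D where "D = (\<lambda>n. L - (\<Sum>k=1..<n. c k))"
  have D_diff: "D n - D (Suc n) = c n" if "n \<ge> 1" for n
    using that by (simp add: D_def)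
  have "(\<lambda>N. D (Suc N)) \<longlonglongrightarrow> L - L"
    unfolding D_def using conv by (intro tendsto_intros) (simp add: atLeastLessThanSuc_atLeastAtMost)
  hence "eventually (\<lambda>N. \<bar>D (Suc N)\<bar> < \<epsilon> / 4) sequentially"
    using \<epsilon> unfolding tendsto_iff dist_real_def by (auto dest: spec[of _ "\<epsilon> / 4"])
  then obtain M0 where M0: "\<And>N. N \<ge> M0 \<Longrightarrow> \<bar>D (Suc N)\<bar> < \<epsilon> / 4"
    unfolding eventually_sequentially by blast
  define M where "M = Suc M0"
  have D: "\<bar>D n\<bar> \<le> \<epsilon> / 4" if "n \<ge> M" for n
    using M0[of "n - 1"] that by (cases n) (auto simp: M_def)
  define h where "h = (\<lambda>\<delta>. \<Sum>n=1..<M. c n * real n powr (-\<delta>))"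
  have "(h \<longlongrightarrow> (\<Sum>n=1..<M. c n * real n powr (-0))) (at_right 0)"
    unfolding h_def by (intro tendsto_intros) auto
  also have "(\<Sum>n=1..<M. c n * real n powr (-0)) = (\<Sum>n=1..<M. c n)"
    by (intro sum.cong) auto
  finally have "eventually (\<lambda>\<delta>. \<bar>h \<delta> - (\<Sum>n=1..<M. c n)\<bar> < \<epsilon> / 4) (at_right 0)"
    using \<epsilon> unfolding tendsto_iff dist_real_def by (auto dest: spec[of _ "\<epsilon> / 4"])
  thus "eventually (\<lambda>\<delta>. \<bar>J \<delta> - L\<bar> < \<epsilon>) (at_right 0)"
    using eventually_at_right_less[of 0]
  proof eventually_elim
    case (elim \<delta>)
    have tail: "\<bar>\<Sum>n=M..N. c n * real n powr (-\<delta>)\<bar> \<le> \<epsilon> / 2" if N: "N \<ge> M" for N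
    proof -
      have "(\<Sum>n=M..N. c n * real n powr (-\<delta>)) = (\<Sum>n=M..N. (D n - D (Suc n)) * real n powr (-\<delta>))"
        by (intro sum.cong refl) (auto simp: D_diff M_def)
      also have "\<bar>\<dots>\<bar> \<le> 2 * (\<epsilon> / 4) * real M powr (-\<delta>)"
        using N D elim(2)
        by (intro summation_by_parts_decreasing) (auto intro!: powr_mono2' simp: M_def)
      also have "\<dots> \<le> 2 * (\<epsilon> / 4) * 1"
        using elim(2) \<epsilon> by (intro mult_left_mono) (auto simp: M_def powr_minus inverse_le_1_iff intro!: ge_one_powr_ge_zero)
      finally show ?thesis by simp
    qed
    have "\<bar>J \<delta> - h \<delta>\<bar> \<le> \<epsilon> / 2"
    proof (rule tendsto_upperbound)
      show "(\<lambda>N. \<bar>(\<Sum>n=1..N. c n * real n powr (-\<delta>)) - h \<delta>\<bar>) \<longlonglongrightarrow> \<bar>J \<delta> - h \<delta>\<bar>"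
        using elim by (intro tendsto_intros J) auto
      show "eventually (\<lambda>N. \<bar>(\<Sum>n=1..N. c n * real n powr (-\<delta>)) - h \<delta>\<bar> \<le> \<epsilon> / 2) sequentially"
        using eventually_ge_at_top[of M]
      proof eventually_elim
        case (elim N)
        have "{1..N} = {1..<M} \<union> {M..N}" using elim by (auto simp: M_def)
        hence "(\<Sum>n=1..N. c n * real n powr (-\<delta>)) = h \<delta> + (\<Sum>n=M..N. c n * real n powr (-\<delta>))"
          unfolding h_def by (simp only:) (rule sum.union_disjoint, auto)
        thus ?case using tail[OF elim] by simp
      qed
    qed auto
    moreover have "\<bar>(\<Sum>n=1..<M. c n) - L\<bar> \<le> \<epsilon> / 4" using D[of M] by (simp add: D_def abs_minus_commute)
    ultimately show ?case using elim \<epsilon> by linarith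
  qed
qed

lemma prime_weight_remainder:
  assumes "s \<ge> 1" "prime p"
  shows "0 \<le> prime_weight s p - real p powr (-s)" "prime_weight s p - real p powr (-s) \<le> 2 * real p powr (-2)"
proof -
  define y where "y = real p powr (-s)"
  have p: "real p \<ge> 2" using prime_ge_2_nat[OF assms(2)] by simp
  have y1: "y \<le> real p powr (-1)" unfolding y_def using p assms by (intro powr_mono) auto
  also have "\<dots> \<le> 1 / 2" using p by (simp add: powr_minus field_simps)
  finally have y2: "y \<le> 1 / 2" .
  have y0: "y \<ge> 0" by (simp add: y_def)
  have "ln (1 - y) \<le> (1 - y) - 1" using y2 by (intro ln_le_minus_one) auto
  thus "0 \<le> prime_weight s p - real p powr (-s)" using assms by (simp add: prime_weight_def y_def)
  have "- y - 2 * y\<^sup>2 \<le> ln (1 - y)" using y0 y2 by (rule ln_one_minus_pos_lower_bound)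
  hence "prime_weight s p - real p powr (-s) \<le> 2 * y\<^sup>2" using assms by (simp add: prime_weight_def y_def)
  also have "y\<^sup>2 \<le> (real p powr (-1))\<^sup>2" using y0 y1 by (intro power_mono) auto
  also have "\<dots> = real p powr (-1 + -1)" by (simp only: power2_eq_square powr_add)
  also have "\<dots> = real p powr (-2)" by simp
  finally show "prime_weight s p - real p powr (-s) \<le> 2 * real p powr (-2)" by simp
qed

text \<open>The series converges only conditionally at s = 1, and \<open>prime_weight\<close> is not
  a coefficient times a power of n. Its leading part p powr -s falls under Abel's theorem; the
  remainder is dominated by 2 * p powr -2 and falls under Tannery's theorem.\<close>

lemma prime_weight_series_continuous:
  fixes e :: "nat \<Rightarrow> real"
  assumes e: "\<And>n. \<bar>e n\<bar> \<le> 1"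
    and conv: "(\<lambda>N. \<Sum>n\<le>N. e n * prime_weight 1 n) \<longlonglongrightarrow> L"
    and Q: "\<And>s. s > 1 \<Longrightarrow> (\<lambda>N. \<Sum>n\<le>N. e n * prime_weight s n) \<longlonglongrightarrow> Q s"
  shows "((\<lambda>\<delta>. Q (1 + \<delta>)) \<longlongrightarrow> L) (at_right 0)"
proof -
  define v where "v = (\<lambda>n \<delta>. if prime n then e n * (prime_weight (1 + \<delta>) n - real n powr (-(1 + \<delta>))) else 0)"
  define c where "c = (\<lambda>n. if prime n then e n * real n powr (-1) else 0)"
  have v_bound: "\<bar>v n \<delta>\<bar> \<le> 2 * real n powr (-2)" if "\<delta> \<ge> 0" for n \<delta>
  proof (cases "prime n")
    case True
    have r: "\<bar>prime_weight (1 + \<delta>) n - real n powr (-(1 + \<delta>))\<bar> \<le> 2 * real n powr (-2)"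
      using True prime_weight_remainder[of "1 + \<delta>" n] that by (simp only: abs_of_nonneg)
    have "\<bar>v n \<delta>\<bar> = \<bar>e n\<bar> * \<bar>prime_weight (1 + \<delta>) n - real n powr (-(1 + \<delta>))\<bar>"
      using True by (simp only: v_def abs_mult if_True)
    also have "\<dots> \<le> 1 * (2 * real n powr (-2))"
      using e[of n] r by (intro mult_mono) auto
    finally have "\<bar>v n \<delta>\<bar> \<le> 1 * (2 * real n powr (-2))" .
    thus ?thesis by simp
  qed (simp add: v_def)
  have summ: "summable (\<lambda>n. 2 * real n powr (-2))"
    by (intro summable_mult) (subst summable_real_powr_iff, auto)
  have v_summable: "summable (\<lambda>n. v n \<delta>)" if "\<delta> \<ge> 0" for \<delta>
    by (rule summable_comparison_test[OF _ summ]) (use v_bound that in auto)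
  have v_lim: "((\<lambda>\<delta>. v n \<delta>) \<longlongrightarrow> v n 0) (at_right 0)" for n
  proof (cases "prime n")
    case True
    have n: "real n > 1" using prime_gt_1_nat[OF True] by simp
    hence "real n powr (-1) < 1" by (simp add: powr_minus inverse_less_1_iff)
    thus ?thesis using True n unfolding v_def prime_weight_def
      by (auto intro!: tendsto_eq_intros)
  qed (simp add: v_def)
  have V: "((\<lambda>\<delta>. \<Sum>n. v n \<delta>) \<longlongrightarrow> (\<Sum>n. v n 0)) (at_right 0)"
  proof -
    have "eventually (\<lambda>(n, \<delta>). norm (v n \<delta>) \<le> 2 * real n powr (-2)) (at_top \<times>\<^sub>F at_right 0)"
      unfolding eventually_prod_filter
      by (rule exI[of _ "\<lambda>_. True"], rule exI[of _ "\<lambda>\<delta>. \<delta> > 0"])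
         (auto simp: v_bound eventually_at_right_less)
    from tannerys_theorem[OF v_lim this summ] show ?thesis by simp
  qed
  have split: "e n * prime_weight (1 + \<delta>) n = v n \<delta> + c n * real n powr (-\<delta>)" for n \<delta>
  proof (cases "prime n")
    case True
    have "real n powr (-(1 + \<delta>)) = real n powr (-1) * real n powr (-\<delta>)"
      by (simp only: powr_add [symmetric]) simp
    hence "e n * prime_weight (1 + \<delta>) n = e n * (prime_weight (1 + \<delta>) n - real n powr (-(1 + \<delta>)))
        + e n * real n powr (-1) * real n powr (-\<delta>)"
      by (simp only: right_diff_distrib mult.assoc diff_add_cancel)
    thus ?thesis using True by (simp only: v_def c_def if_True)
  qed (simp add: v_def c_def prime_weight_def)
  have csum: "(\<Sum>n\<le>N. c n * real n powr (-\<delta>)) = (\<Sum>n=1..N. c n * real n powr (-\<delta>))" for N \<delta>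
    by (intro sum.mono_neutral_right) auto
  have part: "(\<Sum>n=1..N. c n * real n powr (-\<delta>)) = (\<Sum>n\<le>N. e n * prime_weight (1 + \<delta>) n) - (\<Sum>n\<le>N. v n \<delta>)" for N \<delta>
    unfolding split sum.distrib csum by simp
  have vs: "(\<lambda>N. \<Sum>n\<le>N. v n \<delta>) \<longlonglongrightarrow> (\<Sum>n. v n \<delta>)" if "\<delta> \<ge> 0" for \<delta>
    using v_summable[OF that] by (rule summable_LIMSEQ')
  have J: "(\<lambda>N. \<Sum>n=1..N. c n * real n powr (-\<delta>)) \<longlonglongrightarrow> Q (1 + \<delta>) - (\<Sum>n. v n \<delta>)" if "\<delta> > 0" for \<delta>
    unfolding part using that by (intro tendsto_diff Q vs) auto
  have "(\<lambda>N. \<Sum>n=1..N. c n * real n powr (-0)) \<longlonglongrightarrow> L - (\<Sum>n. v n 0)"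
    unfolding part using conv by (intro tendsto_diff vs) auto
  moreover have "(\<Sum>n=1..N. c n * real n powr (-0)) = (\<Sum>n=1..N. c n)" for N
    by (intro sum.cong) auto
  ultimately have "(\<lambda>N. \<Sum>n=1..N. c n) \<longlonglongrightarrow> L - (\<Sum>n. v n 0)" by simp
  from tendsto_add[OF abel_dirichlet[OF this J] V] show ?thesis by simp
qed

text \<open>The simple pole of zeta with residue 1. Consecutive differences of n powr -\<delta> lie
  between neighbouring terms of \<delta> * n powr -(1 + \<delta>), so a telescoping series traps
  \<delta> * zeta(1 + \<delta>) between 1 and 1 + \<delta>.\<close>

lemma zeta_asymp: "((\<lambda>\<delta>. \<delta> * dirichlet_on (composed_of UNIV) (1 + \<delta>)) \<longlongrightarrow> 1) (at_right 0)"
proof -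
  have up: "real n powr (-\<delta>) - real (Suc n) powr (-\<delta>) \<le> \<delta> * real n powr (-(1 + \<delta>))"
    and lo: "\<delta> * real (Suc n) powr (-(1 + \<delta>)) \<le> real n powr (-\<delta>) - real (Suc n) powr (-\<delta>)"
    if "n > 0" "\<delta> > 0" for n \<delta>
  proof -
    define x where "x = 1 / real n"
    have n: "real n > 0" using that by simp
    have split1: "real k powr (-(1 + \<delta>)) = real k powr (-\<delta>) / real k" if "k > 0" for k
    proof -
      have "-(1 + \<delta>) = -\<delta> - 1" by simp
      hence "real k powr (-(1 + \<delta>)) = real k powr (-\<delta> - 1)" by (simp only:)
      thus ?thesis using that by (simp add: powr_diff)
    qed
    have "ln (real (Suc n) / real n) \<le> real (Suc n) / real n - 1"
      using n by (intro ln_le_minus_one) auto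
    hence l1: "ln (real (Suc n)) - ln (real n) \<le> 1 / real n" using n by (simp add: ln_div field_simps)
    have "ln (real n / real (Suc n)) \<le> real n / real (Suc n) - 1"
      using n by (intro ln_le_minus_one) auto
    hence l2: "1 / real (Suc n) \<le> ln (real (Suc n)) - ln (real n)" using n by (simp add: ln_div field_simps)
    have "real (Suc n) powr (-\<delta>) = real n powr (-\<delta>) * exp (-\<delta> * (ln (real (Suc n)) - ln (real n)))"
      using n by (simp add: powr_def exp_add [symmetric] algebra_simps)
    also have "\<dots> \<ge> real n powr (-\<delta>) * (1 - \<delta> * (1 / real n))"
    proof (intro mult_left_mono)
      have "1 + - \<delta> * (ln (real (Suc n)) - ln (real n)) \<le> exp (-\<delta> * (ln (real (Suc n)) - ln (real n)))"
        by (rule exp_ge_add_one_self)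
      moreover have "\<delta> * (ln (real (Suc n)) - ln (real n)) \<le> \<delta> * (1 / real n)"
        using l1 that by (intro mult_left_mono) auto
      ultimately show "1 - \<delta> * (1 / real n) \<le> exp (-\<delta> * (ln (real (Suc n)) - ln (real n)))" by linarith
    qed auto
    finally show "real n powr (-\<delta>) - real (Suc n) powr (-\<delta>) \<le> \<delta> * real n powr (-(1 + \<delta>))"
      using split1[of n] that(1) by (simp add: algebra_simps)
    have "real n powr (-\<delta>) = real (Suc n) powr (-\<delta>) * exp (\<delta> * (ln (real (Suc n)) - ln (real n)))"
      using n by (simp add: powr_def exp_add [symmetric] algebra_simps)
    also have "\<dots> \<ge> real (Suc n) powr (-\<delta>) * (1 + \<delta> * (1 / real (Suc n)))"
    proof (intro mult_left_mono)
      have "1 + \<delta> * (ln (real (Suc n)) - ln (real n)) \<le> exp (\<delta> * (ln (real (Suc n)) - ln (real n)))"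
        by (rule exp_ge_add_one_self)
      moreover have "\<delta> * (1 / real (Suc n)) \<le> \<delta> * (ln (real (Suc n)) - ln (real n))"
        using l2 that by (intro mult_left_mono) auto
      ultimately show "1 + \<delta> * (1 / real (Suc n)) \<le> exp (\<delta> * (ln (real (Suc n)) - ln (real n)))" by linarith
    qed auto
    finally show "\<delta> * real (Suc n) powr (-(1 + \<delta>)) \<le> real n powr (-\<delta>) - real (Suc n) powr (-\<delta>)"
      using split1[of "Suc n"] by (simp add: algebra_simps)
  qed
  define Z where "Z = (\<lambda>\<delta>. dirichlet_on (composed_of UNIV) (1 + \<delta>))"
  have bounds: "1 \<le> \<delta> * Z \<delta>" "\<delta> * Z \<delta> \<le> 1 + \<delta>" if \<delta>: "\<delta> > 0" for \<delta>
  proof -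
    define t where "t = (\<lambda>n. real (Suc n) powr (-\<delta>))"
    define z where "z = (\<lambda>n. real n powr (-(1 + \<delta>)))"
    have "t \<longlonglongrightarrow> 0" unfolding t_def using \<delta> by real_asymp
    hence tele: "(\<lambda>n. t n - t (Suc n)) sums (t 0 - 0)" by (rule telescope_sums')
    have zs: "summable z" unfolding z_def using \<delta> by (subst summable_real_powr_iff) auto
    have Z: "Z \<delta> = suminf z"
      unfolding Z_def dirichlet_on_def z_def
      by (intro suminf_cong) (auto simp: composed_of_def indicator_def)
    have z1: "suminf z = (\<Sum>n. z (Suc n))"
      using suminf_split_head[OF zs] by (simp add: z_def)
    have zs1: "summable (\<lambda>n. z (Suc n))" using zs by (subst summable_Suc_iff)
    have z2: "(\<Sum>n. z (Suc n)) = 1 + (\<Sum>n. z (Suc (Suc n)))"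
      using suminf_split_head[OF zs1] by (simp add: z_def)
    have zs2: "summable (\<lambda>n. z (Suc (Suc n)))" using zs1 by (subst summable_Suc_iff)
    have "t 0 - 0 \<le> (\<Sum>n. \<delta> * z (Suc n))"
      using tele up[OF _ \<delta>] zs1
      by (intro sums_le[OF _ tele summable_sums] summable_mult) (auto simp: t_def z_def simp del: of_nat_Suc)
    thus "1 \<le> \<delta> * Z \<delta>" using suminf_mult[OF zs1, of \<delta>] by (simp add: Z z1 t_def)
    have "(\<Sum>n. \<delta> * z (Suc (Suc n))) \<le> t 0 - 0"
      using tele lo[OF _ \<delta>] zs2
      by (intro sums_le[OF _ summable_sums tele] summable_mult) (auto simp: t_def z_def simp del: of_nat_Suc)
    thus "\<delta> * Z \<delta> \<le> 1 + \<delta>" using suminf_mult[OF zs2, of \<delta>] by (simp add: Z z1 z2 t_def algebra_simps)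
  qed
  show ?thesis
  proof (rule tendsto_sandwich)
    show "((\<lambda>_. 1) \<longlongrightarrow> (1::real)) (at_right 0)" by simp
    show "((\<lambda>\<delta>::real. 1 + \<delta>) \<longlongrightarrow> 1) (at_right 0)" by (auto intro!: tendsto_eq_intros)
    show "eventually (\<lambda>\<delta>. 1 \<le> \<delta> * dirichlet_on (composed_of UNIV) (1 + \<delta>)) (at_right 0)"
      using eventually_at_right_less[of 0] by eventually_elim (use bounds in \<open>simp add: Z_def\<close>)
    show "eventually (\<lambda>\<delta>. \<delta> * dirichlet_on (composed_of UNIV) (1 + \<delta>) \<le> 1 + \<delta>) (at_right 0)"
      using eventually_at_right_less[of 0] by eventually_elim (use bounds in \<open>simp add: Z_def\<close>)
  qed
qed

lemma dirichlet_composed_of_asymp: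
  fixes \<tau> a :: real
  assumes tau: "0 < \<tau>" "\<tau> \<le> 1" and a: "a > 0"
    and conv: "(\<lambda>N. \<Sum>n\<le>N. (indicator P n - \<tau>) * prime_weight 1 n) \<longlonglongrightarrow> ln a"
  shows "((\<lambda>\<delta>. \<delta> powr \<tau> * dirichlet_on (composed_of P) (1 + \<delta>)) \<longlongrightarrow> a) (at_right 0)"
proof -
  \<comment> \<open>Removing the share \<tau> of ln zeta cancels the divergence at s = 1; what
    remains converges to ln a.\<close>
  define Q where "Q = (\<lambda>s. ln (dirichlet_on (composed_of P) s) - \<tau> * ln (dirichlet_on (composed_of UNIV) s))"
  have Q: "(\<lambda>N. \<Sum>n\<le>N. (indicator P n - \<tau>) * prime_weight s n) \<longlonglongrightarrow> Q s" if "s > 1" for s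
  proof -
    have eq: "(\<Sum>n\<le>N. (indicator P n - \<tau>) * prime_weight s n) =
          (\<Sum>n\<in>{..N} \<inter> P. prime_weight s n) - \<tau> * (\<Sum>n\<in>{..N} \<inter> UNIV. prime_weight s n)" for N
      by (subst sum.inter_restrict)
         (auto simp: sum_distrib_left sum_subtractf [symmetric] indicator_def algebra_simps intro!: sum.cong)
    show ?thesis unfolding Q_def eq using that by (intro tendsto_intros ln_dirichlet)
  qed
  have "((\<lambda>\<delta>. Q (1 + \<delta>)) \<longlongrightarrow> ln a) (at_right 0)"
    by (rule prime_weight_series_continuous[OF _ conv Q]) (use tau in \<open>auto simp: indicator_def\<close>)
  hence "((\<lambda>\<delta>. exp (Q (1 + \<delta>)) * (\<delta> * dirichlet_on (composed_of UNIV) (1 + \<delta>)) powr \<tau>) \<longlongrightarrow> exp (ln a) * 1 powr \<tau>) (at_right 0)"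
    by (intro tendsto_intros zeta_asymp) auto
  also have "exp (ln a) * 1 powr \<tau> = a" using a by simp
  finally show ?thesis
  proof (rule Lim_transform_eventually)
    show "eventually (\<lambda>\<delta>. exp (Q (1 + \<delta>)) * (\<delta> * dirichlet_on (composed_of UNIV) (1 + \<delta>)) powr \<tau> =
            \<delta> powr \<tau> * dirichlet_on (composed_of P) (1 + \<delta>)) (at_right 0)"
      using eventually_at_right_less[of 0]
    proof eventually_elim
      case (elim \<delta>)
      have 1: "dirichlet_on (composed_of P) (1 + \<delta>) > 0" "dirichlet_on (composed_of UNIV) (1 + \<delta>) > 0"
        using elim by (auto intro!: dirichlet_pos)
      have "exp (Q (1 + \<delta>)) = dirichlet_on (composed_of P) (1 + \<delta>) / dirichlet_on (composed_of UNIV) (1 + \<delta>) powr \<tau>"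
        using 1 by (simp add: Q_def exp_diff powr_def)
      thus ?case using 1 elim by (simp add: powr_mult)
    qed
  qed
qed

section \<open>A greedy partition of the primes\<close>

text \<open>The constant 31 exceeds by one the sum of the two errors 15 in \<open>sum_mangoldt_over_n\<close>.\<close>
lemma psi_lower:
  obtains c where "c > 0" "\<And>x. x \<ge> exp 31 \<Longrightarrow> psi x \<ge> c * x"
proof (rule that[of "1 / exp 31"])
  fix x :: real assume x: "x \<ge> exp 31"
  define M where "M = (\<lambda>x::real. \<Sum>n\<in>nats_le x. mangoldt n / real n :: real)"
  \<comment> \<open>The Mertens sums at x and y differ by at least 1, and every n between y and x
    contributes with 1 / n \<le> 1 / y.\<close>
  define y where "y = x / exp 31"
  have x1: "x \<ge> 1" using x order.trans[of 1 "exp 31" x] by simp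
  have y1: "y \<ge> 1" using x by (simp add: y_def)
  have yx: "y \<le> x" using x1 by (simp add: y_def field_simps)
  have "ln y = ln x - 31" using x1 by (simp add: y_def ln_div)
  hence "1 \<le> M x - M y"
    using sum_mangoldt_over_n[OF x1] sum_mangoldt_over_n[OF y1] unfolding M_def by linarith
  also have "M x - M y = (\<Sum>n\<in>nats_le x - nats_le y. mangoldt n / real n)"
    unfolding M_def using nats_le_mono[OF yx] by (simp add: sum_diff)
  also have "\<dots> \<le> (\<Sum>n\<in>nats_le x - nats_le y. mangoldt n / y)"
    using y1 by (intro sum_mono divide_left_mono mangoldt_nonneg) (auto simp: nats_le_def)
  also have "\<dots> \<le> (\<Sum>n\<in>nats_le x. mangoldt n / y)"
    using y1 by (intro sum_mono2) (auto simp: mangoldt_nonneg)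
  also have "\<dots> = psi x / y" by (simp add: psi_def sum_divide_distrib)
  finally have "y \<le> psi x" using y1 by (simp add: pos_le_divide_eq)
  thus "psi x \<ge> 1 / exp 31 * x" by (simp add: y_def)
qed auto

text \<open>A proper prime power p^k \<le> x has p \<le> sqrt x and k \<le> 2 * ln x, and its weight
  is at most ln x.\<close>

lemma sum_mangoldt_nonprime:
  assumes x: "x \<ge> 1"
  shows "(\<Sum>n | n \<in> nats_le x \<and> \<not> prime n. mangoldt n) \<le> 2 * sqrt x * (ln x)\<^sup>2"
proof -
  define X where "X = {n \<in> nats_le x. primepow n \<and> \<not> prime n}"
  have "(\<Sum>n | n \<in> nats_le x \<and> \<not> prime n. mangoldt n) = (\<Sum>n\<in>X. mangoldt n :: real)"
    by (intro sum.mono_neutral_right) (auto simp: X_def mangoldt_def)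
  also have "\<dots> \<le> (\<Sum>n\<in>X. ln x)"
  proof (rule sum_mono)
    fix n assume n: "n \<in> X"
    hence "mangoldt n \<le> ln (real n)" by (intro mangoldt_le) (auto simp: X_def nats_le_def)
    also have "\<dots> \<le> ln x" using n by (auto simp: X_def nats_le_def)
    finally show "mangoldt n \<le> ln x" .
  qed
  also have "\<dots> = real (card X) * ln x" by simp
  also have "real (card X) \<le> sqrt x * (2 * ln x)"
  proof -
    have "X \<subseteq> (\<lambda>(p, k). p ^ k) ` (nats_le (sqrt x) \<times> nats_le (2 * ln x))"
    proof
      fix n assume "n \<in> X"
      then obtain p k where pk: "prime p" "k > 0" "n = p ^ k" and n: "real n \<le> x" "\<not> prime n"
        by (auto simp: X_def primepow_def nats_le_def)
      have "k \<noteq> 1" using n pk by auto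
      hence k: "k \<ge> 2" using pk by simp
      have p: "p \<ge> 2" using prime_ge_2_nat[OF pk(1)] .
      have "real p ^ 2 \<le> real p ^ k" using p k by (intro power_increasing) auto
      also have "\<dots> \<le> x" using n pk by simp
      finally have "real p \<le> sqrt x" by (rule real_le_rsqrt)
      moreover have "real k \<le> 2 * ln x"
      proof -
        have "(2::real) ^ k \<le> real p ^ k" using p by (intro power_mono) auto
        also have "\<dots> \<le> x" using n pk by simp
        finally have "ln (2 ^ k) \<le> ln x" using x by (subst ln_le_cancel_iff) auto
        hence "real k * ln 2 \<le> ln x" by (simp add: ln_realpow)
        moreover have "real k * (1 / 2) \<le> real k * ln 2"
          using ln2_ge_two_thirds by (intro mult_left_mono) auto
        ultimately show ?thesis by simp
      qed
      ultimately show "n \<in> (\<lambda>(p, k). p ^ k) ` (nats_le (sqrt x) \<times> nats_le (2 * ln x))"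
        using pk p by (intro image_eqI[of _ _ "(p, k)"]) (auto simp: nats_le_def)
    qed
    hence "card X \<le> card (nats_le (sqrt x) \<times> nats_le (2 * ln x))"
      by (intro surj_card_le) auto
    hence "real (card X) \<le> real (card (nats_le (sqrt x))) * real (card (nats_le (2 * ln x)))"
      by (simp add: card_cartesian_product flip: of_nat_mult)
    also have "\<dots> \<le> sqrt x * (2 * ln x)"
      using x by (intro mult_mono card_nats_le) auto
    finally show ?thesis .
  qed
  finally show ?thesis using x by (simp add: power2_eq_square mult_ac mult_right_mono)
qed

section \<open>A lower bound for the number of primes, and preparations for the greedy
  choice\<close>

definition prime_count :: "nat \<Rightarrow> nat" where
  "prime_count n = card {p. prime p \<and> p < n}"

lemma finite_primes_less [simp]: "finite {p::nat. prime p \<and> p < n}"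
  by (rule finite_subset[of _ "{..<n}"]) auto

lemma prime_count_Suc: "prime_count (Suc n) = prime_count n + (if prime n then 1 else 0)"
proof -
  have "{p. prime p \<and> p < Suc n} = (if prime n then insert n {p. prime p \<and> p < n} else {p. prime p \<and> p < n})"
    by (auto simp: less_Suc_eq)
  thus ?thesis by (simp add: prime_count_def)
qed

lemma prime_count_less: "n > 0 \<Longrightarrow> prime_count n < n"
proof -
  assume n: "n > 0"
  have "prime_count n \<le> card {1..<n}"
    unfolding prime_count_def by (intro card_mono) (auto dest: prime_gt_0_nat)
  thus ?thesis using n by simp
qed

text \<open>Chebyshev's lower bound without its logarithm. \<open>deficit_invariant\<close> needs an
  exponent whose 3/2-fold exceeds 1, that is, one above 2/3; here it becomes 9/8.\<close>

lemma prime_count_lower: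
  "eventually (\<lambda>n. real (prime_count n) + 1 \<ge> real n powr (3 / 4)) sequentially"
proof -
  obtain c where c: "c > 0" "\<And>x. x \<ge> exp 31 \<Longrightarrow> psi x \<ge> c * x" using psi_lower by blast
  have "eventually (\<lambda>x::real. x powr (3/4) * ln x + 2 * sqrt x * (ln x)\<^sup>2 \<le> c * x) at_top"
    using c(1) by real_asymp
  hence "eventually (\<lambda>n. real n powr (3/4) * ln (real n) + 2 * sqrt (real n) * (ln (real n))\<^sup>2 \<le> c * real n) sequentially"
    using filterlim_real_sequentially by (rule eventually_compose_filterlim)
  moreover have "eventually (\<lambda>n. real n \<ge> exp 31) sequentially"
    using filterlim_real_sequentially by (rule eventually_compose_filterlim[OF eventually_ge_at_top])
  ultimately show ?thesis using eventually_gt_at_top[of 1]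
  proof eventually_elim
    case (elim n)
    have "c * real n \<le> psi (real n)" using c(2) elim by blast
    also have "psi (real n) = (\<Sum>p | p \<in> nats_le (real n) \<and> prime p. mangoldt p) + (\<Sum>p | p \<in> nats_le (real n) \<and> \<not> prime p. mangoldt p)"
      unfolding psi_def by (subst sum.union_disjoint [symmetric]) (auto intro!: sum.cong)
    also have "\<dots> \<le> (real (prime_count n) + 1) * ln (real n) + 2 * sqrt (real n) * (ln (real n))\<^sup>2"
    proof (rule add_mono)
      have "(\<Sum>p | p \<in> nats_le (real n) \<and> prime p. mangoldt p) \<le> (\<Sum>p | p \<in> nats_le (real n) \<and> prime p. ln (real n))"
        by (intro sum_mono) (auto simp: nats_le_def prime_gt_0_nat)
      also have "\<dots> = real (card {p \<in> nats_le (real n). prime p}) * ln (real n)" by simp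
      also have "card {p \<in> nats_le (real n). prime p} = prime_count (Suc n)"
        unfolding prime_count_def
        by (intro arg_cong[where f = card]) (auto simp: nats_le_def dest: prime_gt_0_nat)
      also have "real (prime_count (Suc n)) * ln (real n) \<le> (real (prime_count n) + 1) * ln (real n)"
        using elim by (intro mult_right_mono) (auto simp: prime_count_Suc)
      finally show "(\<Sum>p | p \<in> nats_le (real n) \<and> prime p. mangoldt p) \<le> (real (prime_count n) + 1) * ln (real n)" .
      show "(\<Sum>p | p \<in> nats_le (real n) \<and> \<not> prime p. mangoldt p) \<le> 2 * sqrt (real n) * (ln (real n))\<^sup>2"
        using elim by (intro sum_mangoldt_nonprime) auto
    qed
    finally have "real n powr (3/4) * ln (real n) \<le> (real (prime_count n) + 1) * ln (real n)" using elim by linarith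
    thus ?case using elim by simp
  qed
qed

lemma prime_weight_bounds:
  assumes "prime p"
  shows "1 / real p \<le> prime_weight 1 p" "prime_weight 1 p \<le> 2 / real p"
proof -
  have p: "real p \<ge> 2" using prime_ge_2_nat[OF assms] by simp
  have eq: "real p powr (-1) = 1 / real p" using p by (simp add: powr_minus field_simps)
  show "1 / real p \<le> prime_weight 1 p" using prime_weight_remainder(1)[of 1 p] assms by (simp add: eq)
  have "- (1 / real p) - 2 * (1 / real p)\<^sup>2 \<le> ln (1 - 1 / real p)"
    using p by (intro ln_one_minus_pos_lower_bound) (auto simp: field_simps)
  moreover have "2 * (1 / real p)\<^sup>2 \<le> 1 / real p" using p by (simp add: power2_eq_square field_simps)
  moreover have "prime_weight 1 p = - ln (1 - 1 / real p)" using assms by (simp add: prime_weight_def eq)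
  ultimately show "prime_weight 1 p \<le> 2 / real p" by simp
qed

lemma prime_weight_nonneg: "prime_weight 1 n \<ge> 0"
proof (cases "prime n")
  case True
  thus ?thesis using prime_weight_bounds(1)[of n] order.trans[of 0 "1 / real n"] by simp
qed (simp add: prime_weight_def)

lemma summation_by_parts_increasing:
  fixes D g :: "nat \<Rightarrow> real"
  assumes "m \<le> N" and D: "\<And>n. n \<ge> m \<Longrightarrow> \<bar>D n\<bar> \<le> B"
    and g: "\<And>n. n \<ge> m \<Longrightarrow> g n \<le> g (Suc n)" "g m \<ge> 0"
  shows "\<bar>\<Sum>n=m..N. (D n - D (Suc n)) * g n\<bar> \<le> 2 * B * g N"
proof -
  have "g N \<ge> 0 \<and> \<bar>(\<Sum>n=m..N. (D n - D (Suc n)) * g n) + D (Suc N) * g N\<bar> \<le> B * g N"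
    using assms(1)
  proof (induction N rule: dec_induct)
    case base
    have "\<bar>D m * g m\<bar> \<le> B * g m" unfolding abs_mult using D[of m] g(2) by (intro mult_mono) auto
    thus ?case using g(2) by (simp add: algebra_simps)
  next
    case (step N)
    have "(\<Sum>n=m..Suc N. (D n - D (Suc n)) * g n) + D (Suc (Suc N)) * g (Suc N) =
          ((\<Sum>n=m..N. (D n - D (Suc n)) * g n) + D (Suc N) * g N) + D (Suc N) * (g (Suc N) - g N)"
      using step by (simp add: algebra_simps)
    also have "\<bar>\<dots>\<bar> \<le> B * g N + B * (g (Suc N) - g N)"
    proof (rule order.trans[OF abs_triangle_ineq add_mono])
      show "\<bar>(\<Sum>n=m..N. (D n - D (Suc n)) * g n) + D (Suc N) * g N\<bar> \<le> B * g N" using step.IH by blast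
      show "\<bar>D (Suc N) * (g (Suc N) - g N)\<bar> \<le> B * (g (Suc N) - g N)"
        unfolding abs_mult using D[of "Suc N"] g(1)[of N] step by (intro mult_mono) auto
    qed
    finally show ?case using step.IH g(1)[of N] step.hyps by (simp add: algebra_simps)
  qed
  moreover from this have "\<bar>D (Suc N) * g N\<bar> \<le> B * g N"
    unfolding abs_mult using D[of "Suc N"] assms(1) by (intro mult_mono) auto
  ultimately show ?thesis by linarith
qed

text \<open>The coefficients of -L' / L for the Dirichlet series L of \<open>composed_of P\<close>.
  Off the prime powers the choice made by \<open>aprimedivisor\<close> has no effect, since
  \<open>mangoldt\<close> vanishes there.\<close>

definition mangoldt_on :: "nat set \<Rightarrow> nat \<Rightarrow> real" where
  "mangoldt_on P n = (if aprimedivisor n \<in> P then mangoldt n else 0)"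

text \<open>\<open>\<l> i\<close> is the prescribed limit of the weighted sums for class i, namely
  the logarithm of the i-th constant.\<close>

locale greedy_partition =
  fixes h :: nat and \<tau> \<l> :: "nat \<Rightarrow> real"
  assumes h_pos: "h > 0"
    and tau_bounds: "i \<in> {1..h} \<Longrightarrow> \<tau> i \<in> {0<..<1}"
    and tau_sum: "(\<Sum>i=1..h. \<tau> i) = 1"
    and l_sum: "(\<Sum>i=1..h. \<l> i) = 0"
begin

definition pick :: "(nat \<Rightarrow> real) \<Rightarrow> nat" where
  "pick f = (SOME i. i \<in> {1..h} \<and> (\<forall>j\<in>{1..h}. f j \<le> f i))"

lemma pick: "pick f \<in> {1..h}" "j \<in> {1..h} \<Longrightarrow> f j \<le> f (pick f)"
proof -
  have "f ` {1..h} \<noteq> {}" using h_pos by auto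
  from Max_in[OF _ this] obtain i where i: "i \<in> {1..h}" "f i = Max (f ` {1..h})" by auto
  have "\<forall>j\<in>{1..h}. f j \<le> f i" unfolding i(2) by auto
  with i(1) have "\<exists>i. i \<in> {1..h} \<and> (\<forall>j\<in>{1..h}. f j \<le> f i)" by blast
  from someI_ex[OF this] show "pick f \<in> {1..h}" "j \<in> {1..h} \<Longrightarrow> f j \<le> f (pick f)"
    unfolding pick_def by blast+
qed

text \<open>
  Each prime \<open>n\<close> goes to a class whose deficit \<open>\<l> i - (\<Sum>p<n. (indicator (part i) p - \<tau> i) * prime_weight 1 p)\<close>
  is largest. The deficits sum to zero, so the largest one is nonnegative.
\<close>
primrec deficit :: "nat \<Rightarrow> nat \<Rightarrow> real" where
  "deficit 0 = \<l>"
| "deficit (Suc n) = (\<lambda>i. deficit n i - ((if i = pick (deficit n) then 1 else 0) - \<tau> i) * prime_weight 1 n)"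

definition class_of :: "nat \<Rightarrow> nat" where "class_of n = pick (deficit n)"

definition part :: "nat \<Rightarrow> nat set" where "part i = {n. class_of n = i}"

declare deficit.simps(2) [simp del]

lemma deficit_Suc: "deficit (Suc n) i = deficit n i - (indicator (part i) n - \<tau> i) * prime_weight 1 n"
  by (auto simp: deficit.simps(2) part_def class_of_def indicator_def)

lemma class_of_in: "class_of n \<in> {1..h}"
  unfolding class_of_def by (rule pick)

lemma deficit_conv: "deficit (Suc N) i = \<l> i - (\<Sum>n\<le>N. (indicator (part i) n - \<tau> i) * prime_weight 1 n)"
  by (induction N) (simp_all add: deficit_Suc)

lemma deficit_sum: "(\<Sum>i=1..h. deficit n i) = 0"
proof (induction n)
  case 0
  thus ?case using l_sum by simp
next
  case (Suc n)
  have "(\<Sum>i=1..h. indicator (part i) n :: real) = (\<Sum>i=1..h. if i = class_of n then 1 else 0)"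
    by (intro sum.cong) (auto simp: part_def indicator_def)
  also have "\<dots> = 1" using class_of_in[of n] by simp
  finally have "(\<Sum>i=1..h. (indicator (part i) n - \<tau> i) * prime_weight 1 n) = 0"
    unfolding sum_distrib_right [symmetric] sum_subtractf tau_sum by simp
  thus ?case using Suc by (simp add: deficit_Suc sum_subtractf)
qed

lemma deficit_class_of_nonneg: "deficit n (class_of n) \<ge> 0"
proof (rule ccontr)
  assume neg: "\<not> deficit n (class_of n) \<ge> 0"
  have "(\<Sum>i=1..h. deficit n i) \<le> (\<Sum>i=1..h. deficit n (class_of n))"
    unfolding class_of_def by (intro sum_mono pick)
  also have "\<dots> < 0" using neg h_pos by (simp add: mult_pos_neg)
  finally show False by (simp only: deficit_sum less_irrefl)
qed

text \<open>
  The rate at which the deficits tend to zero matters: \<open>mangoldt_on_asymp\<close> needs them to be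
  \<open>o(1 / ln n)\<close>. Measuring it by \<open>prime_count n\<close> rather than by \<open>n\<close> avoids any information on
  prime gaps.
\<close>
definition bound :: "nat \<Rightarrow> real" where "bound n = 2 / sqrt (real (prime_count n) + 1)"

lemma bound_pos: "bound n > 0"
  by (simp add: bound_def add_nonneg_pos)

text \<open>A picked class had a nonnegative deficit and loses at most 2 / n, which is below the
  next bound because the prime count is at most quadratic in n. A class passed over at a prime gains
  at least \<tau> / n, whereas the bound shrinks by at most n powr (-9/8).\<close>

lemma deficit_invariant:
  assumes i: "i \<in> {1..h}"
  shows "eventually (\<lambda>n. deficit n i \<ge> - bound n \<longrightarrow> deficit (Suc n) i \<ge> - bound (Suc n)) sequentially"
proof -
  have t: "\<tau> i > 0" "\<tau> i < 1" using tau_bounds[OF i] by auto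
  have "eventually (\<lambda>x::real. x powr (-9/8) \<le> \<tau> i / x) at_top" using t(1) by real_asymp
  hence "eventually (\<lambda>n. real n powr (-9/8) \<le> \<tau> i / real n) sequentially"
    using filterlim_real_sequentially by (rule eventually_compose_filterlim)
  thus ?thesis using prime_count_lower eventually_gt_at_top[of 1]
  proof eventually_elim
    case (elim n)
    show ?case
    proof
      assume ge: "deficit n i \<ge> - bound n"
      show "deficit (Suc n) i \<ge> - bound (Suc n)"
      proof (cases "prime n")
        case False
        thus ?thesis using ge by (simp add: deficit_Suc prime_weight_def bound_def prime_count_Suc)
      next
        case True
        note w = prime_weight_bounds[OF True]
        show ?thesis
        proof (cases "n \<in> part i")
          case picked: True
          have "real (prime_count (Suc n)) + 1 \<le> (real n)\<^sup>2"
          proof -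
            have "prime_count (Suc n) < Suc n" by (rule prime_count_less) auto
            hence "real (prime_count (Suc n)) + 1 \<le> real n + 1" by simp
            also have "\<dots> \<le> 2 * real n" using elim by simp
            also have "\<dots> \<le> real n * real n" using elim by (intro mult_right_mono) auto
            finally show ?thesis by (simp add: power2_eq_square)
          qed
          hence "sqrt (real (prime_count (Suc n)) + 1) \<le> real n" by (intro real_le_lsqrt) auto
          hence "2 / real n \<le> bound (Suc n)"
            unfolding bound_def using elim by (intro divide_left_mono) (auto intro!: mult_pos_pos add_nonneg_pos)
          moreover have "(1 - \<tau> i) * prime_weight 1 n \<le> 1 * prime_weight 1 n"
            using t prime_weight_nonneg by (intro mult_right_mono) auto
          moreover have "deficit n i \<ge> 0"
            using deficit_class_of_nonneg[of n] picked by (simp add: part_def)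
          ultimately show ?thesis using picked w by (simp add: deficit_Suc)
        next
          case not_picked: False
          define k where "k = real (prime_count n) + 1"
          have k: "k \<ge> 1" by (simp add: k_def)
          have "bound n - bound (Suc n) = 2 / sqrt k - 2 / sqrt (k + 1)"
            using True by (simp add: bound_def k_def prime_count_Suc add_ac)
          also have "\<dots> \<le> 1 / (k * sqrt k)"
          proof -
            define u v where "u = sqrt k" and "v = sqrt (k + 1)"
            have uv: "u \<ge> 1" "u \<le> v" "v * v = u * u + 1" "k = u * u"
              using k by (auto simp: u_def v_def)
            have "2 * (v - u) * u = (v - u) * (2 * u)" by simp
            also have "\<dots> \<le> (v - u) * (v + u)" using uv by (intro mult_left_mono) auto
            also have "\<dots> = 1" using uv by (simp add: algebra_simps)
            finally have 1: "2 * (v - u) * u \<le> 1" .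
            have "2 / u - 2 / v = 2 * (v - u) / (u * v)" using uv by (simp add: field_simps)
            also have "\<dots> \<le> 2 * (v - u) / (u * u)" using uv by (intro divide_left_mono mult_left_mono) auto
            also have "\<dots> = 2 * (v - u) * u / (u * u * u)" using uv by (simp add: field_simps)
            also have "\<dots> \<le> 1 / (u * u * u)" using uv 1 by (intro divide_right_mono) auto
            also have "u * u * u = k * u" using uv(4) by simp
            finally show ?thesis by (simp only: u_def v_def)
          qed
          also have "k * sqrt k = k powr (3/2)"
          proof -
            have "k powr (3/2) = k powr (1 + 1/2)" by simp
            also have "\<dots> = k * sqrt k" using k by (simp only: powr_add) (simp add: powr_half_sqrt)
            finally show ?thesis ..
          qed
          also have "1 / k powr (3/2) \<le> 1 / (real n powr (3/4)) powr (3/2)"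
            using elim k by (intro divide_left_mono powr_mono2 mult_pos_pos) (auto simp: k_def)
          also have "\<dots> = real n powr (-9/8)" by (simp add: powr_powr powr_minus field_simps)
          also have "\<dots> \<le> \<tau> i * (1 / real n)" using elim by simp
          also have "\<dots> \<le> \<tau> i * prime_weight 1 n" using t w by (intro mult_left_mono) auto
          finally have "bound n - bound (Suc n) \<le> \<tau> i * prime_weight 1 n" .
          thus ?thesis using not_picked ge by (simp add: deficit_Suc)
        qed
      qed
    qed
  qed
qed

text \<open>A class whose deficit stayed negative would never be picked again, so its deficit would
  grow by \<tau> times a divergent series.\<close>

lemma deficit_recovers:
  assumes i: "i \<in> {1..h}"
  shows "\<exists>n\<ge>n0. deficit n i \<ge> 0"
proof (rule ccontr)
  assume "\<not> (\<exists>n\<ge>n0. deficit n i \<ge> 0)"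
  hence neg: "deficit n i < 0" if "n \<ge> n0" for n using that not_le by blast
  have t: "\<tau> i > 0" using tau_bounds[OF i] by auto
  define W where "W = (\<lambda>N. \<Sum>n\<le>N. prime_weight 1 n)"
  have eq: "deficit (Suc N) i - \<tau> i * W N = deficit (Suc n0) i - \<tau> i * W n0" if "N \<ge> n0" for N
    using that
  proof (induction N rule: dec_induct)
    case (step N)
    have "Suc N \<notin> part i"
      using neg[of "Suc N"] deficit_class_of_nonneg[of "Suc N"] step by (auto simp: part_def)
    thus ?case using step.IH by (simp add: deficit_Suc W_def algebra_simps)
  qed simp
  define C where "C = deficit (Suc n0) i - \<tau> i * W n0"
  have "eventually (\<lambda>N. W N \<ge> - C / \<tau> i) sequentially"
    using sum_prime_weight_at_top unfolding W_def filterlim_at_top by blast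
  hence "eventually (\<lambda>N. W N \<ge> - C / \<tau> i \<and> N \<ge> n0) sequentially"
    using eventually_ge_at_top by (rule eventually_conj)
  then obtain N where N: "W N \<ge> - C / \<tau> i" "N \<ge> n0"
    by (auto dest: eventually_happens)
  have "\<tau> i * W N \<ge> - C" using N t by (simp add: field_simps)
  hence "deficit (Suc N) i \<ge> 0" using eq[OF N(2)] by (simp add: C_def)
  thus False using neg[of "Suc N"] N by simp
qed

lemma deficit_lower:
  assumes i: "i \<in> {1..h}"
  shows "eventually (\<lambda>n. deficit n i \<ge> - bound n) sequentially"
proof -
  from deficit_invariant[OF i] obtain n0 where
    n0: "\<And>n. n \<ge> n0 \<Longrightarrow> deficit n i \<ge> - bound n \<Longrightarrow> deficit (Suc n) i \<ge> - bound (Suc n)"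
    unfolding eventually_sequentially by blast
  obtain n1 where n1: "n1 \<ge> n0" "deficit n1 i \<ge> 0" using deficit_recovers[OF i] by blast
  have "deficit n i \<ge> - bound n" if "n \<ge> n1" for n
    using that
  proof (induction n rule: dec_induct)
    case base
    thus ?case using n1 bound_pos[of n1] by linarith
  next
    case (step n)
    thus ?case using n0 n1 by simp
  qed
  thus ?thesis unfolding eventually_sequentially by blast
qed

text \<open>The invariant bounds deficits only from below. Since they sum to zero, the lower bounds
  on the other classes give an upper bound on this one, at the cost of the factor h.\<close>

lemma deficit_bound:
  assumes i: "i \<in> {1..h}"
  shows "eventually (\<lambda>n. \<bar>deficit n i\<bar> \<le> 2 * real h * real n powr (-3/8)) sequentially"
proof -
  have "eventually (\<lambda>n. \<forall>j\<in>{1..h}. deficit n j \<ge> - bound n) sequentially"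
    by (intro eventually_ball_finite ballI deficit_lower) auto
  thus ?thesis using prime_count_lower eventually_gt_at_top[of 0]
  proof eventually_elim
    case (elim n)
    have "0 = deficit n i + (\<Sum>j\<in>{1..h} - {i}. deficit n j)"
      using deficit_sum[of n] i by (subst (asm) sum.remove[of _ i]) auto
    moreover have "(\<Sum>j\<in>{1..h} - {i}. deficit n j) \<ge> (\<Sum>j\<in>{1..h} - {i}. - bound n)"
      using elim by (intro sum_mono) auto
    moreover have "(\<Sum>j\<in>{1..h} - {i}. - bound n) = - (real h - 1) * bound n"
      using i by (simp add: of_nat_diff algebra_simps)
    moreover have "- (real h - 1) * bound n = bound n - real h * bound n" by (simp add: algebra_simps)
    ultimately have 1: "deficit n i \<le> real h * bound n" using bound_pos[of n] by linarith
    have "1 * bound n \<le> real h * bound n" using h_pos bound_pos[of n] by (intro mult_right_mono) auto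
    hence 2: "- deficit n i \<le> real h * bound n" using elim i by fastforce
    have "bound n \<le> 2 / sqrt (real n powr (3/4))"
      unfolding bound_def using elim by (intro divide_left_mono mult_pos_pos) (auto simp: add_nonneg_pos)
    also have "\<dots> = 2 * real n powr (-3/8)"
      by (simp add: powr_half_sqrt [symmetric] powr_powr powr_minus field_simps)
    finally have "real h * bound n \<le> real h * (2 * real n powr (-3/8))" by (intro mult_left_mono) auto
    thus ?case using 1 2 by (simp add: abs_le_iff)
  qed
qed

lemma deficit_tendsto_0:
  assumes i: "i \<in> {1..h}"
  shows "(\<lambda>n. deficit n i) \<longlonglongrightarrow> 0"
proof (rule Lim_null_comparison)
  show "eventually (\<lambda>n. norm (deficit n i) \<le> 2 * real h * real n powr (-3/8)) sequentially"
    using deficit_bound[OF i] by simp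
  show "(\<lambda>n. 2 * real h * real n powr (-3/8)) \<longlonglongrightarrow> 0"
    by (rule tendsto_mult_right_zero) real_asymp
qed

lemma weighted_sum_tendsto:
  assumes i: "i \<in> {1..h}"
  shows "(\<lambda>N. \<Sum>n\<le>N. (indicator (part i) n - \<tau> i) * prime_weight 1 n) \<longlonglongrightarrow> \<l> i"
proof -
  have "(\<lambda>N. \<l> i - deficit (Suc N) i) \<longlonglongrightarrow> \<l> i - 0"
    by (intro tendsto_intros LIMSEQ_Suc deficit_tendsto_0 i)
  thus ?thesis by (simp add: deficit_conv)
qed

text \<open>Passes from the weights \<open>prime_weight 1 p\<close> of the greedy choice to the
  weights ln p by summation by parts. The factor g grows like n * ln n, so the power saving in the
  deficits is what makes the result o(x).\<close>

lemma prime_log_sum_bound: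
  assumes i: "i \<in> {1..h}"
  obtains B where "eventually (\<lambda>x. \<bar>\<Sum>p | p \<in> nats_le x \<and> prime p. (indicator (part i) p - \<tau> i) * ln (real p)\<bar> \<le>
      B * (sqrt x * ln x) + 4 * real h * (x powr (-3/16) * (x * ln x))) at_top"
proof -
  define D where "D = (\<lambda>n. deficit n i)"
  \<comment> \<open>The quotient of the two weights at a prime, extended by the same formula to all
    n \<ge> 2. This keeps it monotone, while at nonprimes the deficit does not change and the term
    vanishes.\<close>
  define g where "g = (\<lambda>n. ln (real n) / (- ln (1 - 1 / real n)))"
  have "Bseq D" unfolding D_def using deficit_tendsto_0[OF i] by (intro convergent_imp_Bseq convergentI)
  then obtain B where B: "B > 0" "\<And>n. \<bar>D n\<bar> \<le> B" unfolding Bseq_def by auto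
  obtain n0 where n0: "\<And>n. n \<ge> n0 \<Longrightarrow> \<bar>D n\<bar> \<le> 2 * real h * real n powr (-3/8)"
    using deficit_bound[OF i] unfolding D_def eventually_sequentially by blast
  have l0: "- ln (1 - 1 / real n) \<ge> 1 / real n" if "n \<ge> 2" for n
    using ln_le_minus_one[of "1 - 1 / real n"] that by simp
  have l_pos: "- ln (1 - 1 / real n) > 0" if "n \<ge> 2" for n
  proof -
    have "0 < 1 / real n" using that by simp
    thus ?thesis using l0[OF that] by (rule less_le_trans)
  qed
  have g0: "g n \<ge> 0" if "n \<ge> 2" for n
    unfolding g_def by (rule divide_nonneg_pos[OF _ l_pos[OF that]]) (use that in simp)
  have g_mono: "g n \<le> g (Suc n)" if "n \<ge> 2" for n
  proof -
    have "1 / real (Suc n) \<le> 1 / real n" using that by (intro divide_left_mono) auto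
    hence "ln (1 - 1 / real n) \<le> ln (1 - 1 / real (Suc n))"
      using that by (subst ln_le_cancel_iff) (auto simp: field_simps)
    hence "- ln (1 - 1 / real (Suc n)) \<le> - ln (1 - 1 / real n)" by linarith
    moreover have "0 < - ln (1 - 1 / real (Suc n))" using that by (intro l_pos) simp
    moreover have "0 \<le> ln (real n)" "ln (real n) \<le> ln (real (Suc n))" "0 \<le> ln (real (Suc n))" using that by simp_all
    ultimately show ?thesis unfolding g_def by (intro frac_le)
  qed
  have g_le: "g n \<le> real n * ln (real n)" if "n \<ge> 2" for n
  proof -
    have "g n \<le> ln (real n) / (1 / real n)"
      unfolding g_def
      by (rule divide_left_mono[OF l0[OF that] _ mult_pos_pos[OF l_pos[OF that]]]) (use that in simp_all)
    thus ?thesis using that by (simp add: mult.commute)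
  qed
  have g_le': "g (nat \<lfloor>y\<rfloor>) \<le> y * ln y" if "y \<ge> 2" for y
  proof -
    have n: "nat \<lfloor>y\<rfloor> \<ge> 2" "real (nat \<lfloor>y\<rfloor>) \<le> y" using that by linarith+
    have "g (nat \<lfloor>y\<rfloor>) \<le> real (nat \<lfloor>y\<rfloor>) * ln (real (nat \<lfloor>y\<rfloor>))" by (rule g_le[OF n(1)])
    also have "\<dots> \<le> y * ln y" using n that by (intro mult_mono) auto
    finally show ?thesis .
  qed
  have summand: "(if prime n then (indicator (part i) n - \<tau> i) * ln (real n) else 0) = (D n - D (Suc n)) * g n" if "n \<ge> 2" for n
  proof (cases "prime n")
    case True
    have "prime_weight 1 n = - ln (1 - 1 / real n)"
      using True by (simp add: prime_weight_def powr_minus field_simps)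
    thus ?thesis using True l_pos[OF that] by (simp add: D_def deficit_Suc g_def)
  next
    case False
    thus ?thesis by (simp add: D_def deficit_Suc prime_weight_def)
  qed
  have "eventually (\<lambda>x. \<bar>\<Sum>p | p \<in> nats_le x \<and> prime p. (indicator (part i) p - \<tau> i) * ln (real p)\<bar> \<le>
      B * (sqrt x * ln x) + 4 * real h * (x powr (-3/16) * (x * ln x))) at_top"
    using eventually_ge_at_top[of "max 16 (real n0 ^ 2)"]
  proof eventually_elim
    case (elim x)
    \<comment> \<open>Up to sqrt x the deficits are merely bounded, but g is only O(sqrt x * ln x)
      there. Beyond sqrt x they are O(x powr (-3/16)).\<close>
    define M N where "M = nat \<lfloor>sqrt x\<rfloor>" and "N = nat \<lfloor>x\<rfloor>"
    have x: "x \<ge> 16" using elim by simp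
    have sx: "sqrt x \<ge> 4" using x real_le_rsqrt[of 4 x] by simp
    have sn: "sqrt x \<ge> real n0" using elim by (intro real_le_rsqrt) auto
    have "sqrt x + 1 \<le> sqrt x * sqrt x"
    proof -
      have "4 * sqrt x \<le> sqrt x * sqrt x" by (rule mult_right_mono[OF sx]) (use x in simp)
      thus ?thesis using sx by linarith
    qed
    also have "sqrt x * sqrt x = x" using x by simp
    finally have "sqrt x + 1 \<le> x" .
    hence MN: "M \<ge> 2" "Suc M \<le> N" "Suc M \<ge> n0" "real (Suc M) \<ge> sqrt x"
      using sx sn unfolding M_def N_def by linarith+
    have "(\<Sum>p | p \<in> nats_le x \<and> prime p. (indicator (part i) p - \<tau> i) * ln (real p)) =
          (\<Sum>n=2..N. if prime n then (indicator (part i) n - \<tau> i) * ln (real n) else 0)"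
      by (subst sum.inter_filter [symmetric])
         (auto intro!: sum.cong simp: nats_le_altdef N_def prime_ge_2_nat Suc_le_eq prime_gt_0_nat)
    also have "\<dots> = (\<Sum>n=2..N. (D n - D (Suc n)) * g n)"
      by (intro sum.cong refl summand) auto
    also have "\<dots> = (\<Sum>n=2..M. (D n - D (Suc n)) * g n) + (\<Sum>n=Suc M..N. (D n - D (Suc n)) * g n)"
    proof -
      have "{2..N} = {2..M} \<union> {Suc M..N}" using MN by auto
      thus ?thesis by (simp only:) (rule sum.union_disjoint, auto)
    qed
    also have "\<bar>\<dots>\<bar> \<le> 2 * B * g M + 2 * (2 * real h * x powr (-3/16)) * g N"
    proof (intro order.trans[OF abs_triangle_ineq] add_mono)
      show "\<bar>\<Sum>n=2..M. (D n - D (Suc n)) * g n\<bar> \<le> 2 * B * g M"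
        using MN by (intro summation_by_parts_increasing B g_mono g0) auto
      show "\<bar>\<Sum>n=Suc M..N. (D n - D (Suc n)) * g n\<bar> \<le> 2 * (2 * real h * x powr (-3/16)) * g N"
      proof (intro summation_by_parts_increasing g_mono g0)
        fix n assume n: "n \<ge> Suc M"
        have "\<bar>D n\<bar> \<le> 2 * real h * real n powr (-3/8)" using n MN by (intro n0) auto
        also have "real n powr (-3/8) \<le> sqrt x powr (-3/8)"
        proof (rule powr_mono2')
          show "0 < sqrt x" using x by simp
          have "real (Suc M) \<le> real n" using n by (simp only: of_nat_le_iff)
          thus "sqrt x \<le> real n" using MN(4) by linarith
        qed simp
        also have "sqrt x powr (-3/8) = x powr (-3/16)"
          using x by (simp add: powr_half_sqrt [symmetric] powr_powr)
        finally show "\<bar>D n\<bar> \<le> 2 * real h * x powr (-3/16)" by (simp add: mult_left_mono)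
      qed (use MN in auto)
    qed
    also have "\<dots> \<le> 2 * B * (sqrt x * ln (sqrt x)) + 2 * (2 * real h * x powr (-3/16)) * (x * ln x)"
    proof -
      have "0 \<le> x" "2 \<le> x" "2 \<le> sqrt x" using x sx by linarith+
      thus ?thesis unfolding M_def N_def using B(1)
        by (intro add_mono mult_left_mono g_le' mult_nonneg_nonneg) simp_all
    qed
    also have "\<dots> = B * (sqrt x * ln x) + 4 * real h * (x powr (-3/16) * (x * ln x))"
    proof -
      have "ln (sqrt x) = ln x / 2" using x by (intro ln_sqrt) simp
      thus ?thesis by simp
    qed
    finally show ?case .
  qed
  thus ?thesis using that by blast
qed

lemma mangoldt_on_asymp:
  assumes i: "i \<in> {1..h}"
  shows "((\<lambda>x. (\<Sum>n\<in>nats_le x. mangoldt_on (part i) n - \<tau> i * mangoldt n) / x) \<longlongrightarrow> 0) at_top"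
proof -
  have t: "\<tau> i > 0" "\<tau> i < 1" using tau_bounds[OF i] by auto
  obtain B where B: "eventually (\<lambda>x. \<bar>\<Sum>p | p \<in> nats_le x \<and> prime p. (indicator (part i) p - \<tau> i) * ln (real p)\<bar> \<le>
      B * (sqrt x * ln x) + 4 * real h * (x powr (-3/16) * (x * ln x))) at_top"
    using prime_log_sum_bound[OF i] by blast
  show ?thesis
  proof (rule Lim_null_comparison)
    show "eventually (\<lambda>x. norm ((\<Sum>n\<in>nats_le x. mangoldt_on (part i) n - \<tau> i * mangoldt n) / x) \<le>
        B * (sqrt x * ln x / x) + 4 * real h * (x powr (-3/16) * (x * ln x) / x) + 2 * sqrt x * (ln x)\<^sup>2 / x) at_top"
      using B eventually_ge_at_top[of 1]
    proof eventually_elim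
      case (elim x)
      define e where "e = (\<lambda>n. mangoldt_on (part i) n - \<tau> i * mangoldt n)"
      have "(\<Sum>n\<in>nats_le x. e n) = (\<Sum>n | n \<in> nats_le x \<and> prime n. e n) + (\<Sum>n | n \<in> nats_le x \<and> \<not> prime n. e n)"
        by (subst sum.union_disjoint [symmetric]) (auto intro!: sum.cong)
      also have "(\<Sum>n | n \<in> nats_le x \<and> prime n. e n) = (\<Sum>p | p \<in> nats_le x \<and> prime p. (indicator (part i) p - \<tau> i) * ln (real p))"
        by (intro sum.cong) (auto simp: e_def mangoldt_on_def indicator_def algebra_simps)
      finally have "\<bar>\<Sum>n\<in>nats_le x. e n\<bar> \<le> \<bar>\<Sum>p | p \<in> nats_le x \<and> prime p. (indicator (part i) p - \<tau> i) * ln (real p)\<bar>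
          + \<bar>\<Sum>n | n \<in> nats_le x \<and> \<not> prime n. e n\<bar>" by linarith
      also have "\<bar>\<Sum>n | n \<in> nats_le x \<and> \<not> prime n. e n\<bar> \<le> (\<Sum>n | n \<in> nats_le x \<and> \<not> prime n. mangoldt n)"
      proof (rule order.trans[OF sum_abs], rule sum_mono)
        fix n
        have "\<tau> i * mangoldt n \<le> 1 * mangoldt n" "\<tau> i * mangoldt n \<ge> 0"
          using t mangoldt_nonneg[of n] by (intro mult_right_mono mult_nonneg_nonneg; simp)+
        thus "\<bar>e n\<bar> \<le> mangoldt n" using mangoldt_nonneg[of n] by (auto simp: e_def mangoldt_on_def)
      qed
      also have "\<dots> \<le> 2 * sqrt x * (ln x)\<^sup>2" by (rule sum_mangoldt_nonprime) fact
      finally have "\<bar>\<Sum>n\<in>nats_le x. e n\<bar> \<le> B * (sqrt x * ln x) + 4 * real h * (x powr (-3/16) * (x * ln x)) + 2 * sqrt x * (ln x)\<^sup>2"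
        using elim(1) by linarith
      hence "\<bar>\<Sum>n\<in>nats_le x. e n\<bar> / x \<le> (B * (sqrt x * ln x) + 4 * real h * (x powr (-3/16) * (x * ln x)) + 2 * sqrt x * (ln x)\<^sup>2) / x"
        using elim(2) by (intro divide_right_mono) auto
      thus ?case using elim(2) by (simp add: e_def add_divide_distrib)
    qed
    have "((\<lambda>x::real. sqrt x * ln x / x) \<longlongrightarrow> 0) at_top" by real_asymp
    moreover have "((\<lambda>x::real. x powr (-3/16) * (x * ln x) / x) \<longlongrightarrow> 0) at_top" by real_asymp
    moreover have "((\<lambda>x::real. 2 * sqrt x * (ln x)\<^sup>2 / x) \<longlongrightarrow> 0) at_top" by real_asymp
    ultimately have "((\<lambda>x. B * (sqrt x * ln x / x) + 4 * real h * (x powr (-3/16) * (x * ln x) / x) + 2 * sqrt x * (ln x)\<^sup>2 / x) \<longlongrightarrow> B * 0 + 4 * real h * 0 + 0) at_top"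
      by (intro tendsto_intros)
    thus "((\<lambda>x. B * (sqrt x * ln x / x) + 4 * real h * (x powr (-3/16) * (x * ln x) / x) + 2 * sqrt x * (ln x)\<^sup>2 / x) \<longlongrightarrow> 0) at_top"
      by simp
  qed
qed

end

section \<open>The counting functions\<close>

lemma counting_fun_conv:
  assumes "A \<subseteq> {0<..}"
  shows "real (counting_fun A x) = (\<Sum>n\<in>nats_le x. indicator A n)"
proof -
  have "(\<Sum>n\<in>nats_le x. indicator A n) = real (card (nats_le x \<inter> A))"
    by (simp add: indicator_def sum.If_cases)
  also have "nats_le x \<inter> A = {a \<in> A. real a \<le> x}" using assms by (auto simp: nats_le_def)
  finally show ?thesis by (simp add: counting_fun_def)
qed

text \<open>For a prime power d dividing k, both factors on the right are nonzero exactly when k is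
  composed of P; what is left is the divisor sum of \<open>mangoldt\<close>.\<close>

lemma mangoldt_on_convolution:
  assumes "k > 0"
  shows "indicator (composed_of P) k * ln (real k) =
         (\<Sum>d | d dvd k. mangoldt_on P d * indicator (composed_of P) (k div d))"
proof -
  have *: "aprimedivisor d \<in> P \<and> k div d \<in> composed_of P \<longleftrightarrow> k \<in> composed_of P"
    if "d dvd k" "primepow d" for d
  proof -
    from that(2) obtain p j where pj: "prime p" "j > 0" "d = p ^ j" by (auto simp: primepow_def)
    have ap: "aprimedivisor d = p" using pj by (simp add: aprimedivisor_prime_power)
    have k: "k = d * (k div d)" using that by simp
    have "d \<in> composed_of P \<longleftrightarrow> p \<in> P"
    proof
      assume "d \<in> composed_of P"
      moreover have "p dvd d" using pj by (simp add: dvd_power)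
      ultimately show "p \<in> P" using pj by (auto simp: composed_of_def)
    next
      assume "p \<in> P"
      have "q \<in> P" if "prime q" "q dvd p ^ j" for q
      proof -
        have "q dvd p" using that by (rule prime_dvd_power)
        hence "q = p" by (rule primes_dvd_imp_eq[OF that(1) pj(1)])
        thus ?thesis using \<open>p \<in> P\<close> by simp
      qed
      moreover have "p ^ j > 0" using pj by (simp add: prime_gt_0_nat)
      ultimately show "d \<in> composed_of P" unfolding pj composed_of_def by blast
    qed
    thus ?thesis using composed_of_mult_iff[of d "k div d" P] k ap by simp
  qed
  have "(\<Sum>d | d dvd k. mangoldt_on P d * indicator (composed_of P) (k div d)) =
        (\<Sum>d | d dvd k. indicator (composed_of P) k * mangoldt d)"
  proof (intro sum.cong refl)
    fix d assume d: "d \<in> {d. d dvd k}"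
    show "mangoldt_on P d * indicator (composed_of P) (k div d) = indicator (composed_of P) k * mangoldt d"
    proof (cases "primepow d")
      case True
      thus ?thesis using *[of d] d by (auto simp: mangoldt_on_def indicator_def)
    qed (simp add: mangoldt_on_def mangoldt_def)
  qed
  also have "\<dots> = indicator (composed_of P) k * ln (real k)"
    using sum_mangoldt_dvd[OF assms] by (simp flip: sum_distrib_left)
  finally show ?thesis ..
qed

lemma sum_ln_divide_le:
  assumes "x \<ge> 1"
  shows "(\<Sum>n\<in>nats_le x. ln (x / real n)) \<le> 3 * x"
proof -
  have "(\<Sum>n\<in>nats_le x. ln (x / real n)) = (\<Sum>n\<in>nats_le x. ln x - ln (real n))"
    using assms by (intro sum.cong refl) (auto simp: nats_le_def ln_div)
  also have "\<dots> = real (card (nats_le x)) * ln x - (\<Sum>n\<in>nats_le x. ln (real n))"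
    by (simp add: sum_subtractf)
  also have "\<dots> \<le> x * ln x - (x * ln x - x - 1 - ln x)"
  proof (rule diff_mono)
    show "real (card (nats_le x)) * ln x \<le> x * ln x"
      using assms by (intro mult_right_mono card_nats_le) auto
    show "x * ln x - x - 1 - ln x \<le> (\<Sum>n\<in>nats_le x. ln (real n))"
      using sum_nats_le_ln[OF assms] by linarith
  qed
  also have "\<dots> \<le> 3 * x" using ln_le_minus_one[of x] assms by simp
  finally show ?thesis .
qed

theorem counting_fun_composed_of_asymp:
  fixes \<tau> a :: real
  assumes tau: "0 < \<tau>" "\<tau> < 1" and a: "a > 0"
    and conv: "(\<lambda>N. \<Sum>n\<le>N. (indicator P n - \<tau>) * prime_weight 1 n) \<longlonglongrightarrow> ln a"
    and mangoldt: "((\<lambda>x. (\<Sum>n\<in>nats_le x. mangoldt_on P n - \<tau> * mangoldt n) / x) \<longlongrightarrow> 0) at_top"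
  shows "((\<lambda>x. real (counting_fun (composed_of P) x) * (ln x powr (1 - \<tau>) / x)) \<longlongrightarrow> a / Gamma \<tau>) at_top"
proof -
  define f where "f = (indicator (composed_of P) :: nat \<Rightarrow> real)"
  define S where "S = (\<lambda>x. \<Sum>n\<in>nats_le x. f n / real n)"
  define G where "G = (\<lambda>x. \<Sum>n\<in>nats_le x. f n * ln (real n))"
  define F where "F = (\<lambda>x. \<Sum>n\<in>nats_le x. f n)"
  have f01: "f n \<ge> 0" "f n \<le> 1" for n by (auto simp: f_def indicator_def)
  have powr_eq: "f n / real n * real n powr (-\<delta>) = indicator (composed_of P) n * real n powr (-(1 + \<delta>))" for n \<delta>
  proof (cases "n = 0")
    case False
    have "-(1 + \<delta>) = -\<delta> - 1" by simp
    hence "real n powr (-(1 + \<delta>)) = real n powr (-\<delta>) / real n"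
      using False by (simp only: powr_diff) simp
    thus ?thesis by (simp add: f_def)
  qed simp
  interpret ka: karamata "\<lambda>n. f n / real n" \<tau> a
  proof
    show "((\<lambda>\<delta>. \<delta> powr \<tau> * (\<Sum>n. f n / real n * real n powr (-\<delta>))) \<longlongrightarrow> a) (at_right 0)"
      unfolding powr_eq using dirichlet_composed_of_asymp[OF tau(1) _ a conv] tau
      by (simp add: dirichlet_on_def)
    show "summable (\<lambda>n. f n / real n * real n powr (-\<delta>))" if "\<delta> > 0" for \<delta>
      unfolding powr_eq using that by (intro summable_indicator_powr) auto
  qed (use f01 tau in auto)
  have G1: "Gamma \<tau> > 0" using tau by simp
  have Gplus: "Gamma (\<tau> + 1) = \<tau> * Gamma \<tau>"
  proof -
    have "\<tau> \<notin> \<int>\<^sub>\<le>\<^sub>0" using tau nonpos_Ints_nonpos[of \<tau>] by auto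
    thus ?thesis by (rule Gamma_plus1)
  qed
  have S: "((\<lambda>x. S x / ln x powr \<tau>) \<longlongrightarrow> a / Gamma (\<tau> + 1)) at_top"
    unfolding S_def by (rule ka.partial_sum_asymp)
  have "filterlim (\<lambda>x. ln x powr \<tau>) at_top at_top" using tau(1) by real_asymp
  hence "filterlim (\<lambda>x. S x / ln x powr \<tau> * ln x powr \<tau>) at_top at_top"
    by (rule filterlim_tendsto_pos_mult_at_top[OF S, rotated]) (use a G1 Gplus tau in simp)
  moreover have "eventually (\<lambda>x. S x / ln x powr \<tau> * ln x powr \<tau> = S x) at_top"
    using eventually_gt_at_top[of 1] by eventually_elim simp
  ultimately have S_top: "filterlim S at_top at_top"
    by (simp only: filterlim_cong[OF refl refl])
  interpret lc: log_convolution f "mangoldt_on P" \<tau>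
  proof
    show "f k * ln (real k) = (\<Sum>d | d dvd k. mangoldt_on P d * f (k div d))" if "k > 0" for k
      unfolding f_def using that by (rule mangoldt_on_convolution)
    show "filterlim (\<lambda>x. \<Sum>n\<in>nats_le x. f n / real n) at_top at_top"
      using S_top by (simp add: S_def)
  qed (use f01 tau mangoldt in auto)
  have G: "((\<lambda>x. G x / (x * S x)) \<longlongrightarrow> \<tau>) at_top"
    using lc.sum_f_ln_asymp unfolding lc.S_def by (simp only: G_def S_def)
  \<comment> \<open>The difference is the sum of f(n) * ln(x / n), which is O(x) and hence
    negligible against x * S(x).\<close>
  have FG: "((\<lambda>x. (F x * ln x - G x) / (x * S x)) \<longlongrightarrow> 0) at_top"
  proof (rule Lim_null_comparison)
    show "eventually (\<lambda>x. norm ((F x * ln x - G x) / (x * S x)) \<le> 3 / S x) at_top"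
      using eventually_ge_at_top[of 1] S_top[unfolded filterlim_at_top, rule_format, of 1]
    proof eventually_elim
      case (elim x)
      have "F x * ln x - G x = (\<Sum>n\<in>nats_le x. f n * ln (x / real n))"
        unfolding F_def G_def sum_distrib_right sum_subtractf [symmetric]
        using elim by (intro sum.cong refl) (auto simp: nats_le_def ln_div algebra_simps)
      moreover have "(\<Sum>n\<in>nats_le x. f n * ln (x / real n)) \<ge> 0"
        using f01 by (intro sum_nonneg mult_nonneg_nonneg) (auto simp: nats_le_def)
      moreover have "(\<Sum>n\<in>nats_le x. f n * ln (x / real n)) \<le> (\<Sum>n\<in>nats_le x. 1 * ln (x / real n))"
        using f01 by (intro sum_mono mult_right_mono) (auto simp: nats_le_def)
      ultimately have "\<bar>F x * ln x - G x\<bar> \<le> 3 * x" using sum_ln_divide_le[OF elim(1)] by simp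
      thus ?case using elim by (simp add: abs_mult field_simps)
    qed
    have "((\<lambda>x. 3 * inverse (S x)) \<longlongrightarrow> 3 * 0) at_top"
      by (intro tendsto_mult tendsto_const filterlim_compose[OF tendsto_inverse_0_at_top[OF filterlim_ident] S_top])
    thus "((\<lambda>x. 3 / S x) \<longlongrightarrow> 0) at_top" by (simp add: divide_inverse)
  qed
  \<comment> \<open>The factor S(x) cancels, and Gamma (\<tau> + 1) = \<tau> * Gamma \<tau> absorbs
    the \<tau> contributed by G.\<close>
  have "((\<lambda>x. ((F x * ln x - G x) / (x * S x) + G x / (x * S x)) * (S x / ln x powr \<tau>)) \<longlongrightarrow> (0 + \<tau>) * (a / Gamma (\<tau> + 1))) at_top"
    by (intro tendsto_intros FG G S)
  moreover have "eventually (\<lambda>x. ((F x * ln x - G x) / (x * S x) + G x / (x * S x)) * (S x / ln x powr \<tau>) =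
      real (counting_fun (composed_of P) x) * (ln x powr (1 - \<tau>) / x)) at_top"
    using eventually_gt_at_top[of 1] S_top[unfolded filterlim_at_top, rule_format, of 1]
  proof eventually_elim
    case (elim x)
    have "real (counting_fun (composed_of P) x) = F x"
      unfolding F_def f_def by (rule counting_fun_conv) (auto simp: composed_of_def)
    thus ?case using elim by (simp add: add_divide_distrib [symmetric] powr_diff)
  qed
  ultimately have "((\<lambda>x. real (counting_fun (composed_of P) x) * (ln x powr (1 - \<tau>) / x)) \<longlongrightarrow> (0 + \<tau>) * (a / Gamma (\<tau> + 1))) at_top"
    by (rule Lim_transform_eventually)
  thus ?thesis using tau by (simp add: Gplus)
qed

lemma mult_complement_partition:
  assumes "\<And>n. cls n \<in> {1..h}"
  shows "mult_complement h (\<lambda>i. composed_of {p. cls p = i})"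
  unfolding mult_complement_def
proof safe
  fix i n assume "n \<in> composed_of {p. cls p = i}"
  thus "n > 0" by (simp add: composed_of_def)
next
  fix n :: nat assume n: "n > 0"
  \<comment> \<open>The part of n supported on class i; it is the empty product 1 when no prime
    factor of n lies in that class.\<close>
  define b where "b = (\<lambda>i. \<Prod>p | p \<in> prime_factors n \<and> cls p = i. p ^ multiplicity p n)"
  have "b i \<in> composed_of {p. cls p = i}" for i
    unfolding composed_of_def
  proof safe
    show "b i > 0" unfolding b_def by (intro prod_pos) (auto simp: prime_gt_0_nat in_prime_factors_iff)
  next
    fix q assume q: "prime q" "q dvd b i"
    then obtain p where p: "p \<in> prime_factors n" "cls p = i" "q dvd p ^ multiplicity p n"
      by (auto simp: b_def prime_dvd_prod_iff)
    hence "q dvd p" using q(1) prime_dvd_power by blast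
    hence "q = p" using q(1) p(1) by (intro primes_dvd_imp_eq) (auto simp: in_prime_factors_iff)
    thus "cls q = i" using p by simp
  qed
  moreover have "n = (\<Prod>i=1..h. b i)"
  proof -
    have "(\<Prod>i=1..h. b i) = (\<Prod>p\<in>prime_factors n. p ^ multiplicity p n)"
      unfolding b_def by (rule prod.group) (use assms in auto)
    also have "\<dots> = n" using n by (intro prime_factorization_nat [symmetric])
    finally show ?thesis ..
  qed
  ultimately show "\<exists>b. (\<forall>i\<in>{1..h}. b i \<in> composed_of {p. cls p = i}) \<and> n = (\<Prod>i=1..h. b i)"
    by blast
qed

theorem theorem7:
  fixes h :: nat and \<tau> a :: "nat \<Rightarrow> real"
  assumes "h > 0"
    and "\<And>i. i \<in> {1..h} \<Longrightarrow> \<tau> i \<in> {0<..<1}"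
    and "\<And>i. i \<in> {1..h} \<Longrightarrow> a i \<in> {0<..}"
    and "(\<Sum>i=1..h. \<tau> i) = 1"
    and "(\<Prod>i=1..h. a i) = 1"
  shows "\<exists>A :: nat \<Rightarrow> nat set. mult_complement h A \<and>
           (\<forall>i\<in>{1..h}.
              ((\<lambda>x::real. real (counting_fun (A i) x) * (ln x powr (1 - \<tau> i) / x))
                 \<longlongrightarrow> a i / Gamma (\<tau> i)) at_top)"
proof -
  \<comment> \<open>The product condition becomes the zero-sum condition on the initial
    deficits.\<close>
  have "(\<Sum>i=1..h. ln (a i)) = ln (\<Prod>i=1..h. a i)"
    using assms(3) by (intro ln_prod [symmetric]) force+
  hence "(\<Sum>i=1..h. ln (a i)) = 0" using assms(5) by simp
  then interpret greedy_partition h \<tau> "\<lambda>i. ln (a i)"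
    using assms by unfold_locales auto
  have "((\<lambda>x. real (counting_fun (composed_of (part i)) x) * (ln x powr (1 - \<tau> i) / x))
           \<longlongrightarrow> a i / Gamma (\<tau> i)) at_top" if i: "i \<in> {1..h}" for i
    using assms(2,3)[OF i]
    by (intro counting_fun_composed_of_asymp weighted_sum_tendsto mangoldt_on_asymp i) auto
  moreover have "mult_complement h (\<lambda>i. composed_of (part i))"
    unfolding part_def by (rule mult_complement_partition) (rule class_of_in)
  ultimately show ?thesis by (intro exI[of _ "\<lambda>i. composed_of (part i)"]) auto
qed

end
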